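(* Let $m\ge 1$ and $n\geq 1$ be integers, let $K$ be a field, let $X=(x_{ij})$ be an $(m\times n)$-matrix of indeterminates, let $S=K[x_{ij}: 1\le i\le m,\ 1\le j\le n]$, and let $\varphi:G\to F$ be the homomorphism of free $S$-modules of ranks $n$ and $m$ given by $X$. Let $C$ be an $m$-uniform clutter on the vertex set $[n]=\{1,\ldots,n\}$, with determinantal facet ideal $J_C\subset S$ and clique complex $\Delta(C)$, and let $\mathbb{F}$ be the minimal graded free resolution of $J_C$. Then the linear strand of $J_C$ is the generalized Eagon-Northcott complex of $\Delta(C)$, that is, there is an isomorphism of complexes of graded $S$-modules $$\mathbb{F}^{\mathrm{lin}}\cong \mathcal{C}(\Delta(C);\varphi).$$
   Context: $S$ is standard graded ($\deg x_{ij}=1$). Clutters: a clutter $C$ on $[n]$ is a collection of subsets of $[n]$ (called circuits) with no containment between its elements; every vertex in $[n]$ is assumed to belong to some circuit (in particular $C$ is nonempty). $C$ is $m$-uniform if all circuits have cardinality $m$ (hence $m\le n$). A clique of $C$ is a subset $\sigma\subseteq[n]$ such that each $m$-subset of $\sigma$ is a circuit of $C$; the clique complex $\Delta(C)$ is the simplicial complex whose faces are the cliques of $C$. The determinantal facet ideal $J_C\subset S$ is the ideal generated by the $m$-minors $\mathbf{m}_\tau$ of $X$, $\tau\in C$, where for $\tau=\{j_1<\cdots<j_m\}$, $\mathbf{m}_\tau$ is the minor of $X$ with columns $j_1,\ldots,j_m$. Linear strand: for a finitely generated graded $S$-module $M$ with initial degree $d$ (the smallest $i$ with $M_i\ne 0$;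 here $M=J_C$, $d=m$) and minimal graded free resolution $(\mathbb{F},\partial)$, $F_i=\bigoplus_j S(-j)^{\beta_{i,j}}$, let $F_i^{\mathrm{lin}}$ be the direct summand $S(-i-d)^{\beta_{i,i+d}}$ of $F_i$; then $\partial(F_i^{\mathrm{lin}})\subset F_{i-1}^{\mathrm{lin}}$ and the subcomplex $\mathbb{F}^{\mathrm{lin}}$ is the linear strand of $M$. Eagon-Northcott complex: $\mathcal{C}(\varphi)$ is the complex $0\to \mathcal{C}_{n-m}(\varphi)\to\cdots\to\mathcal{C}_1(\varphi)\to\mathcal{C}_0(\varphi)\to 0$, where $\mathcal{C}_i(\varphi)=\bigwedge^{m+i}G\otimes S_i(F)^*$ is the graded free $S$-module with basis the elements $\mathbf{b}(\sigma;\mathbf{a})$, $\sigma\subseteq[n]$ with $|\sigma|=m+i$, $\mathbf{a}\in\mathbb{Z}_{\ge 0}^m$ with $|\mathbf{a}|=a_1+\cdots+a_m=i$, each basis element having degree $m+i$. For $i\ge 1$ and $\sigma=\{j_1<\cdots<j_{m+i}\}$ the differential is $$\partial(\mathbf{b}(\sigma;\mathbf{a}))=\sum_{k=1}^{m+i}\sum_{\ell=1}^m(-1)^{k+1}x_{\ell j_k}\,\mathbf{b}(\sigma\setminus\{j_k\};\mathbf{a}-\mathbf{e}_\ell),$$ where $\mathbf{e}_1,\ldots,\mathbf{e}_m$ is the canonical basis of $\mathbb{Z}^m$ and $\mathbf{b}(\tau;\mathbf{c})=0$ if $\mathbf{c}$ has a negative entry. Generalized Eagon-Northcott complex: for a simplicial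 complex $\Delta$ on $[n]$, $\mathcal{C}(\Delta;\varphi)$ is the subcomplex of $\mathcal{C}(\varphi)$ whose module $\mathcal{C}_i(\Delta;\varphi)$ in homological degree $i$ is the free submodule of $\mathcal{C}_i(\varphi)$ generated by all $\mathbf{b}(\sigma;\mathbf{a})$ with $\sigma\in\Delta$, $|\sigma|=m+i$, $\mathbf{a}\in\mathbb{Z}^m_{\ge 0}$, $|\mathbf{a}|=i$. *)

theory Defs
  imports "HOL-Library.Poly_Mapping" "Jordan_Normal_Form.Determinant"
begin

section \<open>The polynomial ring\<close>

text \<open>
  Polynomials with coefficients in \<open>'k\<close> in the indeterminates \<open>x\<^sub>i\<^sub>j\<close>, where \<open>i\<close>, \<open>j\<close> range over
  all natural numbers: a polynomial is a finitely supported function from exponent vectors to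
  coefficients, and multiplication is the convolution product of \<^theory>\<open>HOL-Library.Poly_Mapping\<close>.
  The ring \<open>S = K[x\<^sub>i\<^sub>j : 1 \<le> i \<le> m, 1 \<le> j \<le> n]\<close> is the subring \<open>polyring m n\<close> of this type, and every
  module below is a module over that subring.
\<close>

type_synonym 'k poly_x = "((nat \<times> nat) \<Rightarrow>\<^sub>0 nat) \<Rightarrow>\<^sub>0 'k"

definition xvar :: "nat \<Rightarrow> nat \<Rightarrow> 'k::field poly_x" where
  "xvar i j = Poly_Mapping.single (Poly_Mapping.single (i, j) 1) 1"

definition polyring :: "nat \<Rightarrow> nat \<Rightarrow> 'k::field poly_x set" where
  "polyring m n = {p. \<forall>t \<in> Poly_Mapping.keys p. Poly_Mapping.keys t \<subseteq> {1..m} \<times> {1..n}}"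

definition total :: "('v \<Rightarrow>\<^sub>0 nat) \<Rightarrow> nat" where
  "total t = (\<Sum>v \<in> Poly_Mapping.keys t. Poly_Mapping.lookup t v)"

definition homogeneous :: "int \<Rightarrow> 'k::field poly_x \<Rightarrow> bool" where
  "homogeneous d p \<longleftrightarrow> (\<forall>t \<in> Poly_Mapping.keys p. int (total t) = d)"

section \<open>Clutters, clique complexes and determinantal facet ideals\<close>

definition clutter :: "nat \<Rightarrow> nat set set \<Rightarrow> bool" where
  "clutter n C \<longleftrightarrow>
     C \<subseteq> Pow {1..n} \<and> (\<forall>\<sigma>\<in>C. \<forall>\<tau>\<in>C. \<sigma> \<subseteq> \<tau> \<longrightarrow> \<sigma> = \<tau>) \<and> \<Union>C = {1..n}"

definition uniform_clutter :: "nat \<Rightarrow> nat \<Rightarrow> nat set set \<Rightarrow> bool" where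
  "uniform_clutter m n C \<longleftrightarrow> clutter n C \<and> (\<forall>\<sigma>\<in>C. card \<sigma> = m)"

definition clique_complex :: "nat \<Rightarrow> nat \<Rightarrow> nat set set \<Rightarrow> nat set set" where
  "clique_complex m n C = {\<sigma>. \<sigma> \<subseteq> {1..n} \<and> (\<forall>\<tau>. \<tau> \<subseteq> \<sigma> \<and> card \<tau> = m \<longrightarrow> \<tau> \<in> C)}"

text \<open>
  The \<open>m\<close>-minor of \<open>(x\<^sub>i\<^sub>j)\<close> on the columns \<open>\<tau>\<close>, taken in increasing order.  Matrices and lists are
  indexed from 0, the indeterminates from 1.
\<close>

definition max_minor :: "nat \<Rightarrow> nat set \<Rightarrow> 'k::field poly_x" where
  "max_minor m \<tau> = det (mat m m (\<lambda>(i, k). xvar (Suc i) (sorted_list_of_set \<tau> ! k)))"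

definition ideal_generated :: "nat \<Rightarrow> nat \<Rightarrow> 'k::field poly_x set \<Rightarrow> 'k poly_x set" where
  "ideal_generated m n A =
     {(\<Sum>g\<in>B. c g * g) | B c. finite B \<and> B \<subseteq> A \<and> c ` B \<subseteq> polyring m n}"

definition det_facet_ideal :: "nat \<Rightarrow> nat \<Rightarrow> nat set set \<Rightarrow> 'k::field poly_x set" where
  "det_facet_ideal m n C = ideal_generated m n (max_minor m ` C)"

definition initial_degree :: "'k::field poly_x set \<Rightarrow> nat" where
  "initial_degree J = (LEAST d. \<exists>p\<in>J. p \<noteq> 0 \<and> homogeneous (int d) p)"

section \<open>Graded free modules and their complexes\<close>

text \<open>
  A graded free \<open>S\<close>-module is presented by a set of basis elements together with their degrees, so
  that it is the direct sum of the modules \<open>S(- gdeg b)\<close> over the basis elements \<open>b\<close>.  Its elements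
  are the finitely supported functions from the basis to \<open>S\<close>.
\<close>

record 'b graded_free =
  gens :: "'b set"
  gdeg :: "'b \<Rightarrow> int"

type_synonym ('b, 'k) elem = "'b \<Rightarrow>\<^sub>0 'k poly_x"

definition smul :: "'k::field poly_x \<Rightarrow> ('b, 'k) elem \<Rightarrow> ('b, 'k) elem" where
  "smul s f = Poly_Mapping.map (\<lambda>c. s * c) f"

definition elems :: "nat \<Rightarrow> nat \<Rightarrow> 'b graded_free \<Rightarrow> ('b, 'k::field) elem set" where
  "elems m n M =
     {f. Poly_Mapping.keys f \<subseteq> gens M \<and> (\<forall>b. Poly_Mapping.lookup f b \<in> polyring m n)}"

definition graded_piece :: "nat \<Rightarrow> nat \<Rightarrow> 'b graded_free \<Rightarrow> int \<Rightarrow> ('b, 'k::field) elem set" where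
  "graded_piece m n M d =
     {f \<in> elems m n M.
        \<forall>b \<in> Poly_Mapping.keys f. homogeneous (d - gdeg M b) (Poly_Mapping.lookup f b)}"

definition graded_hom ::
  "nat \<Rightarrow> nat \<Rightarrow> 'b graded_free \<Rightarrow> 'c graded_free \<Rightarrow> (('b, 'k::field) elem \<Rightarrow> ('c, 'k) elem) \<Rightarrow> bool" where
  "graded_hom m n M N f \<longleftrightarrow>
     f ` elems m n M \<subseteq> elems m n N \<and>
     (\<forall>x \<in> elems m n M. \<forall>y \<in> elems m n M. f (x + y) = f x + f y) \<and>
     (\<forall>s \<in> polyring m n. \<forall>x \<in> elems m n M. f (smul s x) = smul s (f x)) \<and>
     (\<forall>d. f ` graded_piece m n M d \<subseteq> graded_piece m n N d)"

text \<open>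
  In a complex \<open>F\<close>, \<open>diff F i\<close> is the differential from homological degree \<open>i\<close> to \<open>i - 1\<close>, for
  \<open>i \<ge> 1\<close>; the value of \<open>diff F 0\<close> and the values of the maps outside the modules are irrelevant.
\<close>

record (overloaded) ('b, 'k::zero) fcomplex =
  modl :: "nat \<Rightarrow> 'b graded_free"
  diff :: "nat \<Rightarrow> ('b \<Rightarrow>\<^sub>0 'k poly_x) \<Rightarrow> ('b \<Rightarrow>\<^sub>0 'k poly_x)"

definition graded_free_complex :: "nat \<Rightarrow> nat \<Rightarrow> ('b, 'k::field) fcomplex \<Rightarrow> bool" where
  "graded_free_complex m n F \<longleftrightarrow>
     (\<forall>i. finite (gens (modl F i))) \<and>
     (\<forall>i. graded_hom m n (modl F (Suc i)) (modl F i) (diff F (Suc i))) \<and>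
     (\<forall>i. \<forall>x \<in> elems m n (modl F (Suc (Suc i))). diff F (Suc i) (diff F (Suc (Suc i)) x) = 0)"

definition complex_isomorphic ::
  "nat \<Rightarrow> nat \<Rightarrow> ('b, 'k::field) fcomplex \<Rightarrow> ('c, 'k) fcomplex \<Rightarrow> bool" where
  "complex_isomorphic m n F G \<longleftrightarrow>
     graded_free_complex m n F \<and> graded_free_complex m n G \<and>
     (\<exists>\<Phi> :: nat \<Rightarrow> ('b, 'k) elem \<Rightarrow> ('c, 'k) elem.
        (\<forall>i. graded_hom m n (modl F i) (modl G i) (\<Phi> i)) \<and>
        (\<forall>i. bij_betw (\<Phi> i) (elems m n (modl F i)) (elems m n (modl G i))) \<and>
        (\<forall>i. \<forall>x \<in> elems m n (modl F (Suc i)).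
           \<Phi> i (diff F (Suc i) x) = diff G (Suc i) (\<Phi> (Suc i) x)))"

text \<open>
  Keep in homological degree \<open>i\<close> only the basis elements satisfying \<open>P i\<close>.  The result is a
  complex only if the differential respects the smaller modules; \<^const>\<open>complex_isomorphic\<close> requires
  this on both sides.
\<close>

definition restrict_gens ::
  "(nat \<Rightarrow> 'b \<Rightarrow> bool) \<Rightarrow> ('b, 'k::zero) fcomplex \<Rightarrow> ('b, 'k) fcomplex" where
  "restrict_gens P F =
     F\<lparr>modl := \<lambda>i. (modl F i)\<lparr>gens := {b \<in> gens (modl F i). P i b}\<rparr>\<rparr>"

section \<open>Minimal graded free resolutions and linear strands\<close>

text \<open>
  \<open>F\<close> with augmentation \<open>\<epsilon>\<close> is a minimal graded free resolution of the homogeneous ideal \<open>J\<close>, regarded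
  as a graded \<open>S\<close>-module.  The last conjunct is minimality: the image of each differential lies in
  \<open>\<mm> F\<^sub>i\<close>, where \<open>\<mm>\<close> consists of the polynomials with constant term 0.
\<close>

definition minimal_graded_free_resolution ::
  "nat \<Rightarrow> nat \<Rightarrow> 'k::field poly_x set \<Rightarrow> ('b, 'k) fcomplex \<Rightarrow> (('b, 'k) elem \<Rightarrow> 'k poly_x) \<Rightarrow> bool" where
  "minimal_graded_free_resolution m n J F \<epsilon> \<longleftrightarrow>
     graded_free_complex m n F \<and>
     (\<forall>x \<in> elems m n (modl F 0). \<forall>y \<in> elems m n (modl F 0). \<epsilon> (x + y) = \<epsilon> x + \<epsilon> y) \<and>
     (\<forall>s \<in> polyring m n. \<forall>x \<in> elems m n (modl F 0). \<epsilon> (smul s x) = s * \<epsilon> x) \<and>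
     (\<forall>d. \<forall>x \<in> graded_piece m n (modl F 0) d. homogeneous d (\<epsilon> x)) \<and>
     \<epsilon> ` elems m n (modl F 0) = J \<and>
     {x \<in> elems m n (modl F 0). \<epsilon> x = 0} = diff F 1 ` elems m n (modl F 1) \<and>
     (\<forall>i. {x \<in> elems m n (modl F (Suc i)). diff F (Suc i) x = 0} =
          diff F (Suc (Suc i)) ` elems m n (modl F (Suc (Suc i)))) \<and>
     (\<forall>i. \<forall>x \<in> elems m n (modl F (Suc i)). \<forall>b.
        Poly_Mapping.lookup (Poly_Mapping.lookup (diff F (Suc i) x) b) 0 = 0)"

text \<open>For a minimal resolution of a module with initial degree \<open>d\<close>.\<close>

definition linear_strand :: "nat \<Rightarrow> ('b, 'k::zero) fcomplex \<Rightarrow> ('b, 'k) fcomplex" where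
  "linear_strand d F = restrict_gens (\<lambda>i b. gdeg (modl F i) b = int (i + d)) F"

section \<open>The Eagon-Northcott complex and its generalization\<close>

text \<open>
  The basis element \<open>b(\<sigma>; a)\<close> is indexed by the pair \<open>(\<sigma>, a)\<close>, with \<open>a\<close> a finitely supported function
  vanishing outside \<open>{1..m}\<close>.  As \<open>a\<close> has natural number entries, the convention that \<open>b(\<tau>; c) = 0\<close>
  if \<open>c\<close> has a negative entry becomes the test for \<open>a\<^sub>l = 0\<close> in the differential.
\<close>

type_synonym en_index = "nat set \<times> (nat \<Rightarrow>\<^sub>0 nat)"

definition en_module :: "nat \<Rightarrow> nat \<Rightarrow> nat \<Rightarrow> en_index graded_free" where
  "en_module m n i =
     \<lparr>gens = {(\<sigma>, a). \<sigma> \<subseteq> {1..n} \<and> card \<sigma> = m + i \<and> Poly_Mapping.keys a \<subseteq> {1..m} \<and> total a = i},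
      gdeg = (\<lambda>_. int (m + i))\<rparr>"

text \<open>The index \<open>k\<close> runs from 0, whence the sign \<open>(- 1) ^ k\<close>.\<close>

definition en_boundary :: "nat \<Rightarrow> en_index \<Rightarrow> (en_index, 'k::field) elem" where
  "en_boundary m = (\<lambda>(\<sigma>, a).
     \<Sum>k<card \<sigma>. \<Sum>l\<in>{1..m}.
       (let j = sorted_list_of_set \<sigma> ! k in
        if Poly_Mapping.lookup a l = 0 then 0
        else smul ((- 1) ^ k * xvar l j)
               (Poly_Mapping.single (\<sigma> - {j}, a - Poly_Mapping.single l 1) 1)))"

definition eagon_northcott :: "nat \<Rightarrow> nat \<Rightarrow> (en_index, 'k::field) fcomplex" where
  "eagon_northcott m n =
     \<lparr>modl = en_module m n,
      diff = (\<lambda>i f. \<Sum>b \<in> Poly_Mapping.keys f. smul (Poly_Mapping.lookup f b) (en_boundary m b))\<rparr>"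

definition generalized_eagon_northcott ::
  "nat \<Rightarrow> nat \<Rightarrow> nat set set \<Rightarrow> (en_index, 'k::field) fcomplex" where
  "generalized_eagon_northcott m n \<Delta> = restrict_gens (\<lambda>i b. fst b \<in> \<Delta>) (eagon_northcott m n)"

end

theory Submission
  imports Defs
begin

text \<open>
  Consider complexes of graded free modules whose \<open>i\<close>-th module is generated in degree \<open>d + i\<close>.
  Their differentials are matrices of linear forms, and a generator in homological degree \<open>i + 1\<close>
  has its boundary in the piece of degree \<open>d + i + 1\<close> of the preceding module.  Call such a complex,
  with an augmentation to an ideal \<open>J\<close>, linearly exact if the augmentation identifies the \<open>K\<close>-span of
  the generators in homological degree 0 with \<open>J\<^sub>d\<close>, and if for every \<open>i\<close> the differential identifies
  the \<open>K\<close>-span of the generators in homological degree \<open>i + 1\<close> with the cycles of degree \<open>d + i + 1\<close>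
  in homological degree \<open>i\<close>.  Nothing is asked about cycles of higher degree.

  Linear exactness determines the complex.  An isomorphism is built degree by degree: once it is
  known in homological degree \<open>i\<close>, it matches the cycles of degree \<open>d + i + 1\<close>, hence the generators
  of the next modules (\<open>linearly_exact_unique\<close>).  So it suffices to see that both complexes are
  linearly exact for \<open>J = J\<^sub>C\<close> and \<open>d = m\<close>.

  For the linear strand this is formal (\<open>linear_strand_linearly_exact\<close>).  By minimality, \<open>F\<^sub>i\<close> has no
  generators of degree less than \<open>d + i\<close>, and the boundary of a generator has no component at a
  generator of the same degree; so in these lowest degrees the exactness of the resolution is a
  statement about the strand alone.

  For \<open>\<C>(\<Delta>(C);\<phi>)\<close> it is a computation with coefficients.  Different basis elements \<open>b(\<sigma>;a)\<close> have
  boundaries without a common term \<open>x\<^bsub>lj\<^esub> b(\<tau>;c)\<close>, because \<open>\<sigma> = \<tau> \<union> {j}\<close> and \<open>a = c + e\<^sub>l\<close>.  This gives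
  injectivity, and it reduces the claim on cycles to the following: if \<open>z\<close> is a cycle with linear
  coefficients, then the coefficient of \<open>x\<^bsub>lj\<^esub> b(\<tau>;c)\<close> in \<open>z\<close> vanishes for \<open>j \<in> \<tau>\<close>, and otherwise,
  up to the sign of the differential, it depends only on \<open>\<tau> \<union> {j}\<close> and \<open>c + e\<^sub>l\<close>.  It also explains the
  clique complex: if a basis element \<open>b(\<rho>;b)\<close> of the full complex is needed to bound \<open>z\<close>, then all
  facets of \<open>\<rho>\<close> occur in \<open>z\<close>, so they are cliques, and then \<open>\<rho>\<close> is a clique
  (\<open>linear_boundary_criterion\<close>).  In positive homological degree the required property of \<open>z\<close> is read
  off from the coefficients of the quadratic monomials in the boundary of \<open>z\<close>
  (\<open>higher_linear_cycle\<close>).  In homological degree 0, where \<open>z\<close> is a linear syzygy of minors, it is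
  read off from monomials \<open>x\<^bsub>lp\<^esub> t\<close>, with \<open>t\<close> a term of a minor: rows and columns of the variables
  involved leave only one or two ways to write such a monomial as a variable times a term of a minor
  (\<open>max_minor_multiple_unique\<close>).
\<close>

section \<open>Polynomials\<close>

lemma lookup_single_mult:
  fixes p :: "'k::field poly_x"
  shows "Poly_Mapping.lookup (Poly_Mapping.single s c * p) t =
    c * Sum_any (\<lambda>q. Poly_Mapping.lookup p q when t = s + q)"
proof -
  have "Poly_Mapping.lookup (Poly_Mapping.single s c * p) t =
      Sum_any (\<lambda>l. (c * Sum_any (\<lambda>q. Poly_Mapping.lookup p q when t = s + q)) when s = l)"
    unfolding lookup_mult lookup_single
    by (rule Sum_any.cong) (simp add: when_def)
  then show ?thesis by simp
qed

lemma lookup_single_mult_add: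
  fixes p :: "'k::field poly_x"
  shows "Poly_Mapping.lookup (Poly_Mapping.single s c * p) (s + t) = c * Poly_Mapping.lookup p t"
  by (simp add: lookup_single_mult)

lemma minus_single_add_single:
  fixes t :: "'v \<Rightarrow>\<^sub>0 nat"
  assumes "Poly_Mapping.lookup t v \<noteq> 0"
  shows "Poly_Mapping.single v 1 + (t - Poly_Mapping.single v 1) = t"
  using assms by (intro poly_mapping_eqI) (auto simp: lookup_add lookup_minus lookup_single when_def)

lemma lookup_xvar_mult:
  fixes p :: "'k::field poly_x"
  shows "Poly_Mapping.lookup (xvar i j * p) t =
    (if Poly_Mapping.lookup t (i, j) = 0 then 0
     else Poly_Mapping.lookup p (t - Poly_Mapping.single (i, j) 1))"
proof (cases "Poly_Mapping.lookup t (i, j) = 0")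
  case True
  then have "t \<noteq> Poly_Mapping.single (i, j) 1 + q" for q
    by (auto simp: lookup_add)
  then show ?thesis using True by (simp add: xvar_def lookup_single_mult)
next
  case False
  then show ?thesis
    using lookup_single_mult_add[of "Poly_Mapping.single (i, j) 1" 1 p "t - Poly_Mapping.single (i, j) 1"]
      minus_single_add_single[of t "(i, j)"]
    by (simp add: xvar_def)
qed

lemma lookup_const_mult:
  fixes p :: "'k::field poly_x"
  shows "Poly_Mapping.lookup (Poly_Mapping.single 0 c * p) t = c * Poly_Mapping.lookup p t"
  using lookup_single_mult_add[of 0 c p t] by simp

lemma polyring_zero [simp]: "0 \<in> polyring m n"
  by (simp add: polyring_def)

lemma polyring_one [simp]: "1 \<in> polyring m n"
  by (simp add: polyring_def)

lemma polyring_const [simp]: "Poly_Mapping.single 0 c \<in> polyring m n"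
  by (simp add: polyring_def)

lemma polyring_xvar: "\<lbrakk>i \<in> {1..m}; j \<in> {1..n}\<rbrakk> \<Longrightarrow> xvar i j \<in> polyring m n"
  by (simp add: polyring_def xvar_def)

lemma polyring_add: "\<lbrakk>p \<in> polyring m n; q \<in> polyring m n\<rbrakk> \<Longrightarrow> p + q \<in> polyring m n"
  unfolding polyring_def using keys_add[of p q] by blast

lemma polyring_uminus: "p \<in> polyring m n \<Longrightarrow> - p \<in> polyring m n"
  unfolding polyring_def by (auto simp: in_keys_iff)

lemma polyring_mult:
  assumes "p \<in> polyring m n" "q \<in> polyring m n"
  shows "p * q \<in> polyring m n"
proof -
  have "Poly_Mapping.keys t \<subseteq> {1..m} \<times> {1..n}" if t: "t \<in> Poly_Mapping.keys (p * q)" for t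
  proof -
    obtain a b where "t = a + b" "a \<in> Poly_Mapping.keys p" "b \<in> Poly_Mapping.keys q"
      using t keys_mult[of p q] by blast
    then show ?thesis using assms keys_add[of a b] unfolding polyring_def by blast
  qed
  then show ?thesis by (auto simp: polyring_def)
qed

lemma polyring_sum: "(\<And>i. i \<in> A \<Longrightarrow> f i \<in> polyring m n) \<Longrightarrow> sum f A \<in> polyring m n"
  by (induction A rule: infinite_finite_induct) (auto intro: polyring_add)

lemma polyring_sign: "(- 1) ^ k \<in> polyring m n"
  by (induction k) (auto intro: polyring_uminus)

lemma total_zero [simp]: "total 0 = 0"
  by (simp add: total_def)

lemma total_superset:
  "\<lbrakk>finite A; Poly_Mapping.keys t \<subseteq> A\<rbrakk> \<Longrightarrow> total t = (\<Sum>v\<in>A. Poly_Mapping.lookup t v)"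
  unfolding total_def by (rule sum.mono_neutral_left) (auto simp: in_keys_iff)

lemma total_add [simp]: "total (s + t) = total s + total t"
proof -
  let ?A = "Poly_Mapping.keys s \<union> Poly_Mapping.keys t"
  have "Poly_Mapping.keys (s + t) \<subseteq> ?A" by (rule keys_add)
  then show ?thesis
    using total_superset[of ?A s] total_superset[of ?A t] total_superset[of ?A "s + t"]
    by (simp add: lookup_add sum.distrib)
qed

lemma total_single [simp]: "total (Poly_Mapping.single v k) = k"
  by (cases "k = 0") (simp_all add: total_def)

lemma total_eq_0_iff: "total t = 0 \<longleftrightarrow> t = 0"
proof
  assume "total t = 0"
  then show "t = 0" by (intro poly_mapping_eqI) (auto simp: total_def in_keys_iff)
qed simp

lemma homogeneous_iff:
  "homogeneous d p \<longleftrightarrow> (\<forall>t. Poly_Mapping.lookup p t \<noteq> 0 \<longrightarrow> int (total t) = d)"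
  by (auto simp: homogeneous_def in_keys_iff)

lemma homogeneous_zero [simp]: "homogeneous d 0"
  by (simp add: homogeneous_def)

lemma homogeneous_one [simp]: "homogeneous 0 1"
  by (simp add: homogeneous_def)

lemma homogeneous_const [simp]: "homogeneous 0 (Poly_Mapping.single 0 c)"
  by (simp add: homogeneous_def)

lemma homogeneous_xvar: "homogeneous 1 (xvar i j)"
  by (simp add: homogeneous_def xvar_def)

lemma homogeneous_add: "\<lbrakk>homogeneous d p; homogeneous d q\<rbrakk> \<Longrightarrow> homogeneous d (p + q)"
  unfolding homogeneous_iff lookup_add by (metis add_0)

lemma homogeneous_uminus: "homogeneous d p \<Longrightarrow> homogeneous d (- p)"
  by (auto simp: homogeneous_iff)

lemma homogeneous_mult:
  assumes "homogeneous d p" "homogeneous e q"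
  shows "homogeneous (d + e) (p * q)"
  unfolding homogeneous_def
proof
  fix t assume "t \<in> Poly_Mapping.keys (p * q)"
  then obtain a b where "t = a + b" "a \<in> Poly_Mapping.keys p" "b \<in> Poly_Mapping.keys q"
    using keys_mult[of p q] by blast
  then show "int (total t) = d + e" using assms by (simp add: homogeneous_def)
qed

lemma homogeneous_sum: "(\<And>i. i \<in> A \<Longrightarrow> homogeneous d (f i)) \<Longrightarrow> homogeneous d (sum f A)"
  by (induction A rule: infinite_finite_induct) (auto intro: homogeneous_add)

lemma homogeneous_sign: "homogeneous 0 ((- 1) ^ k)"
proof (induction k)
  case (Suc k)
  then show ?case using homogeneous_uminus[of 0 "(- 1) ^ k"] by simp
qed simp

lemma homogeneous_neg:
  assumes "homogeneous d p" "d < 0"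
  shows "p = 0"
proof (rule poly_mapping_eqI)
  fix t
  show "Poly_Mapping.lookup p t = Poly_Mapping.lookup 0 t"
    using assms by (force simp: homogeneous_iff)
qed

text \<open>
  In a minimal resolution the coefficients of a boundary have no constant term, so by this lemma the
  boundary of a homogeneous element has no component at generators of the same or of higher degree.
\<close>

lemma homogeneous_nonpos_no_constant:
  assumes "homogeneous d p" "d \<le> 0" "Poly_Mapping.lookup p 0 = 0"
  shows "p = 0"
proof (rule poly_mapping_eqI)
  fix t
  have "t = 0" if "Poly_Mapping.lookup p t \<noteq> 0"
  proof -
    have "int (total t) \<le> 0" using assms(1,2) that by (simp add: homogeneous_iff)
    then show ?thesis using total_eq_0_iff[of t] by simp
  qed
  then show "Poly_Mapping.lookup p t = Poly_Mapping.lookup 0 t" using assms(3) by auto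
qed

lemma homogeneous_0_const:
  assumes "homogeneous 0 p"
  shows "p = Poly_Mapping.single 0 (Poly_Mapping.lookup p 0)"
proof (rule poly_mapping_eqI)
  fix t
  have "t = 0" if "Poly_Mapping.lookup p t \<noteq> 0"
    using assms that total_eq_0_iff[of t] by (simp add: homogeneous_iff)
  then show "Poly_Mapping.lookup p t =
      Poly_Mapping.lookup (Poly_Mapping.single 0 (Poly_Mapping.lookup p 0)) t"
    by (auto simp: lookup_single when_def)
qed

definition homogeneous_part :: "int \<Rightarrow> 'k::field poly_x \<Rightarrow> 'k poly_x" where
  "homogeneous_part d p = (\<Sum>t\<in>{t \<in> Poly_Mapping.keys p. int (total t) = d}.
     Poly_Mapping.single t (Poly_Mapping.lookup p t))"

lemma lookup_homogeneous_part:
  "Poly_Mapping.lookup (homogeneous_part d p) t = (if int (total t) = d then Poly_Mapping.lookup p t else 0)"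
proof -
  have "Poly_Mapping.lookup (homogeneous_part d p) t =
      (\<Sum>s\<in>{s \<in> Poly_Mapping.keys p. int (total s) = d}. if s = t then Poly_Mapping.lookup p t else 0)"
    unfolding homogeneous_part_def lookup_sum lookup_single by (intro sum.cong) (auto simp: when_def)
  then show ?thesis by (auto simp: in_keys_iff)
qed

lemma homogeneous_homogeneous_part: "homogeneous d (homogeneous_part d p)"
  by (auto simp: homogeneous_iff lookup_homogeneous_part)

lemma polyring_homogeneous_part: "p \<in> polyring m n \<Longrightarrow> homogeneous_part d p \<in> polyring m n"
  by (auto simp: polyring_def in_keys_iff lookup_homogeneous_part split: if_splits)

lemma homogeneous_part_zero [simp]: "homogeneous_part d 0 = 0"
  by (simp add: homogeneous_part_def)

lemma homogeneous_part_homogeneous: "homogeneous e p \<Longrightarrow> homogeneous_part d p = (if d = e then p else 0)"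
  by (intro poly_mapping_eqI) (auto simp: lookup_homogeneous_part homogeneous_iff)

lemma homogeneous_part_add: "homogeneous_part d (p + q) = homogeneous_part d p + homogeneous_part d q"
  by (intro poly_mapping_eqI) (auto simp: lookup_homogeneous_part lookup_add)

lemma sum_homogeneous_part:
  assumes "finite D" "\<And>t. t \<in> Poly_Mapping.keys p \<Longrightarrow> int (total t) \<in> D"
  shows "(\<Sum>d\<in>D. homogeneous_part d p) = p"
  using assms by (intro poly_mapping_eqI) (auto simp: lookup_sum lookup_homogeneous_part in_keys_iff)

section \<open>Graded free modules\<close>

lemma lookup_smul [simp]: "Poly_Mapping.lookup (smul s f) b = s * Poly_Mapping.lookup f b"
  by (simp add: smul_def Poly_Mapping.map.rep_eq when_def)

lemma smul_add_left: "smul (s + t) f = smul s f + smul t f"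
  by (intro poly_mapping_eqI) (simp add: lookup_add distrib_right)

lemma smul_smul: "smul s (smul t f) = smul (s * t) f"
  by (intro poly_mapping_eqI) (simp add: mult.assoc)

lemma smul_one [simp]: "smul 1 f = f"
  by (intro poly_mapping_eqI) simp

lemma smul_zero [simp]: "smul s 0 = 0" "smul 0 f = 0"
  by (auto intro: poly_mapping_eqI)

lemma smul_sum: "smul s (sum f A) = (\<Sum>i\<in>A. smul s (f i))"
  by (intro poly_mapping_eqI) (simp add: lookup_sum sum_distrib_left)

abbreviation basis_elem :: "'b \<Rightarrow> ('b, 'k::field) elem" where
  "basis_elem b \<equiv> Poly_Mapping.single b 1"

lemma elems_iff:
  "f \<in> elems m n M \<longleftrightarrow>
    (\<forall>b. Poly_Mapping.lookup f b \<in> polyring m n \<and> (b \<notin> gens M \<longrightarrow> Poly_Mapping.lookup f b = 0))"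
  by (auto simp: elems_def in_keys_iff)

lemma graded_piece_iff:
  "f \<in> graded_piece m n M d \<longleftrightarrow>
    f \<in> elems m n M \<and> (\<forall>b. homogeneous (d - gdeg M b) (Poly_Mapping.lookup f b))"
proof -
  have "(\<forall>b\<in>Poly_Mapping.keys f. homogeneous (d - gdeg M b) (Poly_Mapping.lookup f b)) \<longleftrightarrow>
      (\<forall>b. homogeneous (d - gdeg M b) (Poly_Mapping.lookup f b))"
    by (metis homogeneous_zero in_keys_iff)
  then show ?thesis by (simp add: graded_piece_def)
qed

lemma graded_piece_elems: "f \<in> graded_piece m n M d \<Longrightarrow> f \<in> elems m n M"
  by (simp add: graded_piece_def)

lemma elems_zero [simp]: "0 \<in> elems m n M"
  by (simp add: elems_def)

lemma elems_add: "\<lbrakk>f \<in> elems m n M; g \<in> elems m n M\<rbrakk> \<Longrightarrow> f + g \<in> elems m n M"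
  by (auto simp: elems_iff lookup_add intro: polyring_add)

lemma elems_smul: "\<lbrakk>s \<in> polyring m n; f \<in> elems m n M\<rbrakk> \<Longrightarrow> smul s f \<in> elems m n M"
  by (auto simp: elems_iff intro: polyring_mult)

lemma elems_sum: "(\<And>i. i \<in> A \<Longrightarrow> f i \<in> elems m n M) \<Longrightarrow> sum f A \<in> elems m n M"
  by (induction A rule: infinite_finite_induct) (auto intro: elems_add)

lemma graded_piece_zero [simp]: "0 \<in> graded_piece m n M d"
  by (simp add: graded_piece_iff)

lemma graded_piece_add:
  "\<lbrakk>f \<in> graded_piece m n M d; g \<in> graded_piece m n M d\<rbrakk> \<Longrightarrow> f + g \<in> graded_piece m n M d"
  by (auto simp: graded_piece_iff lookup_add intro: elems_add homogeneous_add)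

lemma graded_piece_sum:
  "(\<And>i. i \<in> A \<Longrightarrow> f i \<in> graded_piece m n M d) \<Longrightarrow> sum f A \<in> graded_piece m n M d"
  by (induction A rule: infinite_finite_induct) (auto intro: graded_piece_add)

lemma graded_piece_smul:
  assumes "s \<in> polyring m n" "homogeneous e s" "f \<in> graded_piece m n M d"
  shows "smul s f \<in> graded_piece m n M (e + d)"
proof -
  have "homogeneous (e + (d - gdeg M b)) (s * Poly_Mapping.lookup f b)" for b
    using assms by (intro homogeneous_mult) (auto simp: graded_piece_iff)
  then show ?thesis using assms by (auto simp: graded_piece_iff elems_smul algebra_simps)
qed

lemma basis_elem_graded_piece:
  "\<lbrakk>b \<in> gens M; d = gdeg M b\<rbrakk> \<Longrightarrow> basis_elem b \<in> graded_piece m n M d"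
  by (auto simp: graded_piece_def elems_iff lookup_single when_def)

lemma basis_elem_elems: "b \<in> gens M \<Longrightarrow> basis_elem b \<in> elems m n M"
  by (rule graded_piece_elems[OF basis_elem_graded_piece[OF _ refl]])

lemma elem_expand:
  assumes "finite A" "Poly_Mapping.keys x \<subseteq> A"
  shows "x = (\<Sum>b\<in>A. smul (Poly_Mapping.lookup x b) (basis_elem b))"
proof (rule poly_mapping_eqI)
  fix c
  have "(\<Sum>b\<in>A. Poly_Mapping.lookup (smul (Poly_Mapping.lookup x b) (basis_elem b)) c) =
      (\<Sum>b\<in>A. if b = c then Poly_Mapping.lookup x c else 0)"
    by (intro sum.cong) (auto simp: lookup_single when_def)
  then show "Poly_Mapping.lookup x c =
      Poly_Mapping.lookup (\<Sum>b\<in>A. smul (Poly_Mapping.lookup x b) (basis_elem b)) c"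
    using assms by (auto simp: lookup_sum in_keys_iff subset_iff)
qed

text \<open>
  The sum over the support of the element, rather than over a chosen set of generators, makes the
  Eagon-Northcott differential an instance.
\<close>

definition linear_extension :: "('b \<Rightarrow> ('c, 'k::field) elem) \<Rightarrow> ('b, 'k) elem \<Rightarrow> ('c, 'k) elem" where
  "linear_extension \<phi> x = (\<Sum>b\<in>Poly_Mapping.keys x. smul (Poly_Mapping.lookup x b) (\<phi> b))"

lemma linear_extension_superset:
  assumes "finite A" "Poly_Mapping.keys x \<subseteq> A"
  shows "linear_extension \<phi> x = (\<Sum>b\<in>A. smul (Poly_Mapping.lookup x b) (\<phi> b))"
  unfolding linear_extension_def using assms
  by (intro sum.mono_neutral_left) (auto simp: in_keys_iff)

lemma linear_extension_add:
  "linear_extension \<phi> (x + y) = linear_extension \<phi> x + linear_extension \<phi> y"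
proof -
  let ?A = "Poly_Mapping.keys x \<union> Poly_Mapping.keys y"
  have "Poly_Mapping.keys (x + y) \<subseteq> ?A" by (rule keys_add)
  then show ?thesis
    using linear_extension_superset[of ?A x \<phi>] linear_extension_superset[of ?A y \<phi>]
      linear_extension_superset[of ?A "x + y" \<phi>]
    by (simp add: lookup_add sum.distrib smul_add_left)
qed

lemma linear_extension_smul:
  "linear_extension \<phi> (smul s x) = smul s (linear_extension \<phi> x)"
proof -
  have "Poly_Mapping.keys (smul s x) \<subseteq> Poly_Mapping.keys x" by (auto simp: in_keys_iff)
  then show ?thesis
    using linear_extension_superset[of "Poly_Mapping.keys x" "smul s x" \<phi>]
    by (simp add: linear_extension_def smul_sum smul_smul)
qed

lemma linear_extension_basis_elem: "linear_extension \<phi> (basis_elem b) = \<phi> b"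
  using linear_extension_superset[of "{b}" "basis_elem b" \<phi>] by simp

lemma graded_hom_linear_extension:
  assumes "\<And>b. b \<in> gens M \<Longrightarrow> \<phi> b \<in> graded_piece m n N (gdeg M b)"
  shows "graded_hom m n M N (linear_extension \<phi>)"
proof -
  have gens: "b \<in> gens M" if "x \<in> elems m n M" "b \<in> Poly_Mapping.keys x" for x b
    using that by (auto simp: elems_def)
  have "linear_extension \<phi> x \<in> elems m n N" if "x \<in> elems m n M" for x
    unfolding linear_extension_def
  proof (intro elems_sum elems_smul)
    fix b assume "b \<in> Poly_Mapping.keys x"
    then show "\<phi> b \<in> elems m n N"
      using assms[OF gens[OF that]] graded_piece_elems by blast
  qed (use that in \<open>auto simp: elems_iff\<close>)
  moreover have "linear_extension \<phi> x \<in> graded_piece m n N d" if x: "x \<in> graded_piece m n M d" for x d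
    unfolding linear_extension_def
  proof (rule graded_piece_sum)
    fix b assume b: "b \<in> Poly_Mapping.keys x"
    have "smul (Poly_Mapping.lookup x b) (\<phi> b) \<in> graded_piece m n N ((d - gdeg M b) + gdeg M b)"
      using x b assms gens[OF graded_piece_elems[OF x] b]
      by (intro graded_piece_smul) (auto simp: graded_piece_iff elems_iff)
    then show "smul (Poly_Mapping.lookup x b) (\<phi> b) \<in> graded_piece m n N d" by simp
  qed
  ultimately show ?thesis
    unfolding graded_hom_def by (auto simp: linear_extension_add linear_extension_smul)
qed

lemma graded_homD:
  assumes "graded_hom m n M N f"
  shows "x \<in> elems m n M \<Longrightarrow> f x \<in> elems m n N"
    and "\<lbrakk>x \<in> elems m n M; y \<in> elems m n M\<rbrakk> \<Longrightarrow> f (x + y) = f x + f y"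
    and "\<lbrakk>s \<in> polyring m n; x \<in> elems m n M\<rbrakk> \<Longrightarrow> f (smul s x) = smul s (f x)"
    and "x \<in> graded_piece m n M d \<Longrightarrow> f x \<in> graded_piece m n N d"
    and "f 0 = 0"
proof -
  show "f 0 = 0"
    using assms unfolding graded_hom_def by (metis elems_zero polyring_zero smul_zero(2))
qed (use assms in \<open>auto simp: graded_hom_def image_subset_iff\<close>)

lemma graded_hom_sum:
  assumes "graded_hom m n M N f" "\<And>i. i \<in> A \<Longrightarrow> g i \<in> elems m n M"
  shows "f (sum g A) = (\<Sum>i\<in>A. f (g i))"
  using assms(2)
  by (induction A rule: infinite_finite_induct)
     (auto simp: graded_homD(5)[OF assms(1)] graded_homD(2)[OF assms(1)] elems_sum)

lemma graded_hom_eq_linear_extension: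
  assumes f: "graded_hom m n M N f" and x: "x \<in> elems m n M"
  shows "f x = linear_extension (\<lambda>b. f (basis_elem b)) x"
proof -
  have b: "basis_elem b \<in> elems m n M" "Poly_Mapping.lookup x b \<in> polyring m n"
    if "b \<in> Poly_Mapping.keys x" for b
    using x that basis_elem_elems[of b M m n] by (auto simp: elems_def)
  have "f x = f (\<Sum>b\<in>Poly_Mapping.keys x. smul (Poly_Mapping.lookup x b) (basis_elem b))"
    using elem_expand[of "Poly_Mapping.keys x" x] by simp
  also have "\<dots> = (\<Sum>b\<in>Poly_Mapping.keys x. f (smul (Poly_Mapping.lookup x b) (basis_elem b)))"
    by (intro graded_hom_sum[OF f] elems_smul b)
  also have "\<dots> = linear_extension (\<lambda>b. f (basis_elem b)) x"
    unfolding linear_extension_def using b by (intro sum.cong refl graded_homD(3)[OF f])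
  finally show ?thesis .
qed

lemma graded_hom_eqI:
  assumes "graded_hom m n M N f" "graded_hom m n M N g"
    and "\<And>b. b \<in> gens M \<Longrightarrow> f (basis_elem b) = g (basis_elem b)"
    and "x \<in> elems m n M"
  shows "f x = g x"
proof -
  have "linear_extension (\<lambda>b. f (basis_elem b)) x = linear_extension (\<lambda>b. g (basis_elem b)) x"
    unfolding linear_extension_def using assms(3,4) by (intro sum.cong) (auto simp: elems_def)
  then show ?thesis using assms graded_hom_eq_linear_extension by metis
qed

lemma graded_hom_comp:
  assumes "graded_hom m n M N f" "graded_hom m n N P g"
  shows "graded_hom m n M P (\<lambda>x. g (f x))"
  using assms unfolding graded_hom_def by (auto simp: image_subset_iff)

lemma graded_hom_id: "graded_hom m n M M (\<lambda>x. x)"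
  by (auto simp: graded_hom_def)

definition homogeneous_component :: "'b graded_free \<Rightarrow> int \<Rightarrow> ('b, 'k::field) elem \<Rightarrow> ('b, 'k) elem" where
  "homogeneous_component M d x =
    (\<Sum>b\<in>Poly_Mapping.keys x. Poly_Mapping.single b (homogeneous_part (d - gdeg M b) (Poly_Mapping.lookup x b)))"

lemma lookup_homogeneous_component:
  "Poly_Mapping.lookup (homogeneous_component M d x) b = homogeneous_part (d - gdeg M b) (Poly_Mapping.lookup x b)"
proof -
  have "Poly_Mapping.lookup (homogeneous_component M d x) b =
      (\<Sum>c\<in>Poly_Mapping.keys x. if c = b then homogeneous_part (d - gdeg M b) (Poly_Mapping.lookup x b) else 0)"
    unfolding homogeneous_component_def lookup_sum lookup_single by (intro sum.cong) (auto simp: when_def)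
  then show ?thesis by (auto simp: in_keys_iff)
qed

lemma homogeneous_component_graded_piece: "x \<in> elems m n M \<Longrightarrow> homogeneous_component M d x \<in> graded_piece m n M d"
  by (auto simp: graded_piece_iff elems_iff lookup_homogeneous_component homogeneous_homogeneous_part polyring_homogeneous_part)

lemma homogeneous_component_of_graded_piece:
  assumes "x \<in> graded_piece m n M e"
  shows "homogeneous_component M d x = (if d = e then x else 0)"
proof (rule poly_mapping_eqI)
  fix b
  have "homogeneous (e - gdeg M b) (Poly_Mapping.lookup x b)"
    using assms by (simp add: graded_piece_iff)
  from homogeneous_part_homogeneous[OF this, of "d - gdeg M b"]
  show "Poly_Mapping.lookup (homogeneous_component M d x) b = Poly_Mapping.lookup (if d = e then x else 0) b"
    by (simp add: lookup_homogeneous_component)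
qed

lemma homogeneous_component_zero [simp]: "homogeneous_component M d 0 = 0"
  by (simp add: homogeneous_component_def)

lemma homogeneous_component_sum:
  fixes f :: "'i \<Rightarrow> ('a, 'c::field) elem"
  shows "homogeneous_component M d (sum f A) = (\<Sum>i\<in>A. homogeneous_component M d (f i))"
proof -
  have *: "homogeneous_component M d (x + y) = homogeneous_component M d x + homogeneous_component M d y" for x y :: "('a, 'c) elem"
    by (intro poly_mapping_eqI) (simp add: lookup_homogeneous_component lookup_add homogeneous_part_add)
  show ?thesis
    by (induction A rule: infinite_finite_induct) (auto simp: *)
qed

lemma sum_homogeneous_component: obtains D where "finite D" "x = (\<Sum>d\<in>D. homogeneous_component M d x)"
proof -
  define D where "D = (\<Union>b\<in>Poly_Mapping.keys x.
    (\<lambda>t. int (total t) + gdeg M b) ` Poly_Mapping.keys (Poly_Mapping.lookup x b))"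
  have fin: "finite D" by (simp add: D_def)
  have "Poly_Mapping.lookup x b = (\<Sum>d\<in>D. homogeneous_part (d - gdeg M b) (Poly_Mapping.lookup x b))" for b
  proof -
    have "(\<Sum>d\<in>D. homogeneous_part (d - gdeg M b) (Poly_Mapping.lookup x b)) =
        (\<Sum>d\<in>(\<lambda>d. d - gdeg M b) ` D. homogeneous_part d (Poly_Mapping.lookup x b))"
      by (subst sum.reindex) (auto simp: inj_on_def)
    also have "\<dots> = Poly_Mapping.lookup x b"
    proof (rule sum_homogeneous_part)
      fix t assume t: "t \<in> Poly_Mapping.keys (Poly_Mapping.lookup x b)"
      then have "b \<in> Poly_Mapping.keys x" by (metis in_keys_iff keys_zero empty_iff)
      with t have "int (total t) + gdeg M b \<in> D" by (auto simp: D_def)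
      then show "int (total t) \<in> (\<lambda>d. d - gdeg M b) ` D" by force
    qed (use fin in simp)
    finally show ?thesis by simp
  qed
  then have "x = (\<Sum>d\<in>D. homogeneous_component M d x)"
    by (intro poly_mapping_eqI) (simp add: lookup_sum lookup_homogeneous_component)
  with fin that show thesis by blast
qed

lemma graded_hom_homogeneous_component:
  assumes f: "graded_hom m n M N f" and x: "x \<in> elems m n M"
  shows "f (homogeneous_component M d x) = homogeneous_component N d (f x)"
proof -
  obtain D where D: "finite D" "x = (\<Sum>e\<in>D. homogeneous_component M e x)" by (rule sum_homogeneous_component)
  have mem: "homogeneous_component M e x \<in> graded_piece m n M e" for e by (rule homogeneous_component_graded_piece[OF x])
  have "f x = f (\<Sum>e\<in>D. homogeneous_component M e x)" using D(2) by simp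
  also have "\<dots> = (\<Sum>e\<in>D. f (homogeneous_component M e x))"
    by (rule graded_hom_sum[OF f]) (rule graded_piece_elems[OF mem])
  finally have "homogeneous_component N d (f x) = (\<Sum>e\<in>D. homogeneous_component N d (f (homogeneous_component M e x)))"
    by (simp add: homogeneous_component_sum)
  also have "\<dots> = (\<Sum>e\<in>D. f (homogeneous_component M d (homogeneous_component M e x)))"
    by (intro sum.cong refl)
       (simp add: homogeneous_component_of_graded_piece[OF graded_homD(4)[OF f mem]] homogeneous_component_of_graded_piece[OF mem]
          graded_homD(5)[OF f])
  also have "\<dots> = f (\<Sum>e\<in>D. homogeneous_component M d (homogeneous_component M e x))"
    by (rule graded_hom_sum[OF f, symmetric])
       (auto intro!: graded_piece_elems[OF homogeneous_component_graded_piece] graded_piece_elems[OF mem])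
  also have "(\<Sum>e\<in>D. homogeneous_component M d (homogeneous_component M e x)) = homogeneous_component M d x"
    using D(2) by (simp add: homogeneous_component_sum[symmetric])
  finally show ?thesis by simp
qed

text \<open>
  Graded homomorphisms commute with taking homogeneous components, so a homogeneous element of the
  image is the image of a homogeneous element of the same degree.
\<close>

lemma graded_lift:
  assumes "graded_hom m n M N f" "x \<in> elems m n M" "f x \<in> graded_piece m n N d"
  obtains x' where "x' \<in> graded_piece m n M d" "f x' = f x"
  using graded_hom_homogeneous_component[OF assms(1,2), of d] homogeneous_component_of_graded_piece[OF assms(3), of d]
    homogeneous_component_graded_piece[OF assms(2), of d] that by auto

section \<open>Linearly exact complexes\<close>

text \<open>
  The ring as a graded free module of rank one, so that facts on homomorphisms of free modules apply
  to augmentations as well.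
\<close>

definition ring_module :: "unit graded_free" where
  "ring_module = \<lparr>gens = {()}, gdeg = (\<lambda>_. 0)\<rparr>"

definition to_ring_module :: "'k::field poly_x \<Rightarrow> (unit, 'k) elem" where
  "to_ring_module p = Poly_Mapping.single () p"

lemma to_ring_module_simps [simp]:
  "to_ring_module p = to_ring_module q \<longleftrightarrow> p = q"
  "to_ring_module p = 0 \<longleftrightarrow> p = 0"
  "to_ring_module p \<in> elems m n ring_module \<longleftrightarrow> p \<in> polyring m n"
  "to_ring_module p \<in> graded_piece m n ring_module d \<longleftrightarrow> p \<in> polyring m n \<and> homogeneous d p"
  "to_ring_module p + to_ring_module q = to_ring_module (p + q)"
  "smul s (to_ring_module p) = to_ring_module (s * p)"
  "Poly_Mapping.lookup (to_ring_module p) () = p"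
proof -
  show "to_ring_module p = 0 \<longleftrightarrow> p = 0"
    unfolding to_ring_module_def by (metis lookup_single_eq lookup_zero single_zero)
  show "to_ring_module p = to_ring_module q \<longleftrightarrow> p = q"
    unfolding to_ring_module_def by (metis lookup_single_eq)
qed (auto simp: to_ring_module_def elems_iff graded_piece_iff ring_module_def single_add
  intro: poly_mapping_eqI)

definition augmentation ::
  "nat \<Rightarrow> nat \<Rightarrow> ('b, 'k::field) fcomplex \<Rightarrow> (('b, 'k) elem \<Rightarrow> 'k poly_x) \<Rightarrow> bool" where
  "augmentation m n L \<epsilon> \<longleftrightarrow> graded_hom m n (modl L 0) ring_module (\<lambda>x. to_ring_module (\<epsilon> x))"

definition cycle ::
  "('b, 'k::field) fcomplex \<Rightarrow> (('b, 'k) elem \<Rightarrow> 'k poly_x) \<Rightarrow> nat \<Rightarrow> ('b, 'k) elem \<Rightarrow> bool" where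
  "cycle L \<epsilon> i x \<longleftrightarrow> (if i = 0 then \<epsilon> x = 0 else diff L i x = 0)"

lemma cycle_simps [simp]:
  "cycle L \<epsilon> 0 x \<longleftrightarrow> \<epsilon> x = 0"
  "cycle L \<epsilon> (Suc i) x \<longleftrightarrow> diff L (Suc i) x = 0"
  by (simp_all add: cycle_def)

text \<open>
  As all generators of \<open>L\<^sub>i\<close> have degree \<open>d + i\<close>, the graded piece of \<open>L\<^sub>i\<close> in that degree is the
  \<open>K\<close>-span of the generators.  Every condition below thus concerns a space of generators.
\<close>

definition linearly_exact ::
  "nat \<Rightarrow> nat \<Rightarrow> nat \<Rightarrow> 'k::field poly_x set \<Rightarrow>
    ('b, 'k) fcomplex \<Rightarrow> (('b, 'k) elem \<Rightarrow> 'k poly_x) \<Rightarrow> bool" where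
  "linearly_exact m n d J L \<epsilon> \<longleftrightarrow>
     graded_free_complex m n L \<and> augmentation m n L \<epsilon> \<and>
     (\<forall>i. \<forall>b \<in> gens (modl L i). gdeg (modl L i) b = int (d + i)) \<and>
     bij_betw \<epsilon> (graded_piece m n (modl L 0) (int d)) {p \<in> J. homogeneous (int d) p} \<and>
     (\<forall>i. bij_betw (diff L (Suc i)) (graded_piece m n (modl L (Suc i)) (int (d + Suc i)))
            {x \<in> graded_piece m n (modl L i) (int (d + Suc i)). cycle L \<epsilon> i x})"

text \<open>
  A degree-preserving homomorphism between free modules generated in one degree is a matrix over \<open>K\<close>,
  so an inverse on the spaces of generators extends linearly to an inverse.
\<close>

lemma graded_iso_of_bij_generators:
  fixes f :: "('b, 'k::field) elem \<Rightarrow> ('c, 'k) elem"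
  assumes f: "graded_hom m n M N f"
    and degM: "\<And>b. b \<in> gens M \<Longrightarrow> gdeg M b = e" and degN: "\<And>b. b \<in> gens N \<Longrightarrow> gdeg N b = e"
    and bij: "bij_betw f (graded_piece m n M e) (graded_piece m n N e)"
  shows "bij_betw f (elems m n M) (elems m n N)"
    and "bij_betw f (graded_piece m n M d) (graded_piece m n N d)"
proof -
  define h where "h b = inv_into (graded_piece m n M e) f (basis_elem b)" for b
  define g where "g = linear_extension h"
  have h: "h b \<in> graded_piece m n M e" "f (h b) = basis_elem b" if "b \<in> gens N" for b
  proof -
    have "basis_elem b \<in> f ` graded_piece m n M e"
      using bij basis_elem_graded_piece[OF that, of e] degN[OF that] by (simp add: bij_betw_def)
    then show "h b \<in> graded_piece m n M e" "f (h b) = basis_elem b"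
      unfolding h_def by (auto intro: inv_into_into f_inv_into_f)
  qed
  have g: "graded_hom m n N M g"
    unfolding g_def using h degN by (intro graded_hom_linear_extension) simp
  have fg: "f (g y) = y" if "y \<in> elems m n N" for y
  proof (rule graded_hom_eqI[OF graded_hom_comp[OF g f] graded_hom_id _ that])
    fix b assume "b \<in> gens N"
    then show "f (g (basis_elem b)) = basis_elem b"
      by (simp add: g_def linear_extension_basis_elem h)
  qed
  have gf: "g (f x) = x" if "x \<in> elems m n M" for x
  proof (rule graded_hom_eqI[OF graded_hom_comp[OF f g] graded_hom_id _ that])
    fix b assume b: "b \<in> gens M"
    have 1: "basis_elem b \<in> graded_piece m n M e"
      using b degM by (simp add: basis_elem_graded_piece)
    then have 2: "g (f (basis_elem b)) \<in> graded_piece m n M e"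
      by (intro graded_homD(4)[OF g] graded_homD(4)[OF f])
    have "f (g (f (basis_elem b))) = f (basis_elem b)"
      by (intro fg graded_homD(1)[OF f] graded_piece_elems[OF 1])
    then show "g (f (basis_elem b)) = basis_elem b"
      using bij 1 2 unfolding bij_betw_def inj_on_def by blast
  qed
  show "bij_betw f (elems m n M) (elems m n N)"
    by (rule bij_betw_byWitness[where f' = g]) (use fg gf graded_homD(1)[OF f] graded_homD(1)[OF g] in blast)+
  show "bij_betw f (graded_piece m n M d) (graded_piece m n N d)"
    by (rule bij_betw_byWitness[where f' = g])
       (use fg gf graded_piece_elems graded_homD(4)[OF f] graded_homD(4)[OF g] in blast)+
qed

text \<open>
  The induction step for isomorphisms of linearly exact complexes: a map \<open>f\<close> in one homological degree
  is continued to the next one as soon as it matches the images of the two spaces of generators.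
\<close>

lemma graded_iso_lift:
  fixes f :: "('b, 'k::field) elem \<Rightarrow> ('c, 'k) elem"
    and p :: "('d, 'k) elem \<Rightarrow> ('b, 'k) elem" and q :: "('e, 'k) elem \<Rightarrow> ('c, 'k) elem"
  assumes f: "graded_hom m n M N f" and p: "graded_hom m n M' M p" and q: "graded_hom m n N' N q"
    and degM: "\<And>b. b \<in> gens M' \<Longrightarrow> gdeg M' b = e" and degN: "\<And>b. b \<in> gens N' \<Longrightarrow> gdeg N' b = e"
    and p_bij: "bij_betw p (graded_piece m n M' e) A"
    and q_bij: "bij_betw q (graded_piece m n N' e) B"
    and f_bij: "bij_betw f A B"
  obtains f' where "graded_hom m n M' N' f'"
    and "bij_betw f' (elems m n M') (elems m n N')"
    and "\<And>d. bij_betw f' (graded_piece m n M' d) (graded_piece m n N' d)"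
    and "\<And>x. x \<in> elems m n M' \<Longrightarrow> q (f' x) = f (p x)"
proof -
  define h where "h x = inv_into (graded_piece m n N' e) q (f (p x))" for x
  define f' where "f' = linear_extension (\<lambda>b. h (basis_elem b))"
  have h: "h x \<in> graded_piece m n N' e" "q (h x) = f (p x)" if "x \<in> graded_piece m n M' e" for x
  proof -
    have "f (p x) \<in> q ` graded_piece m n N' e"
      using that p_bij f_bij q_bij unfolding bij_betw_def by blast
    then show "h x \<in> graded_piece m n N' e" "q (h x) = f (p x)"
      unfolding h_def by (auto intro: inv_into_into f_inv_into_f)
  qed
  have f': "graded_hom m n M' N' f'"
    unfolding f'_def using degM
    by (intro graded_hom_linear_extension) (simp add: h basis_elem_graded_piece)
  have comm: "q (f' x) = f (p x)" if "x \<in> elems m n M'" for x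
  proof (rule graded_hom_eqI[OF graded_hom_comp[OF f' q] graded_hom_comp[OF p f] _ that])
    fix b assume "b \<in> gens M'"
    then show "q (f' (basis_elem b)) = f (p (basis_elem b))"
      by (simp add: f'_def linear_extension_basis_elem h basis_elem_graded_piece degM)
  qed
  \<comment> \<open>\<open>q\<close> is injective on the generators, so \<open>f'\<close> is the composite bijection \<open>q\<inverse> f p\<close> on them.\<close>
  have f'_h: "f' x = h x" if x: "x \<in> graded_piece m n M' e" for x
    using q_bij comm[OF graded_piece_elems[OF x]] h[OF x] graded_homD(4)[OF f' x]
    unfolding bij_betw_def inj_on_def by metis
  have "bij_betw h (graded_piece m n M' e) (graded_piece m n N' e)"
    unfolding h_def
    using bij_betw_trans[OF bij_betw_trans[OF p_bij f_bij] bij_betw_inv_into[OF q_bij]]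
    by (simp add: comp_def)
  then have "bij_betw f' (graded_piece m n M' e) (graded_piece m n N' e)"
    using f'_h by (simp cong: bij_betw_cong)
  from graded_iso_of_bij_generators[OF f' degM degN this] f' comm show thesis
    by (intro that) auto
qed

text \<open>
  The isomorphism is constructed by induction on the homological degree.  An isomorphism in degree \<open>i\<close>
  that is compatible with the map before it preserves cycles, and these are the images of the
  generators in degree \<open>i + 1\<close>.
\<close>

theorem linearly_exact_unique:
  fixes L :: "('b, 'k::field) fcomplex" and M :: "('c, 'k) fcomplex"
  assumes L: "linearly_exact m n d J L \<epsilon>" and M: "linearly_exact m n d J M \<eta>"
  shows "complex_isomorphic m n L M"
proof -
  have cL: "graded_free_complex m n L" and cM: "graded_free_complex m n M"
    using L M by (auto simp: linearly_exact_def)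
  have dL: "graded_hom m n (modl L (Suc i)) (modl L i) (diff L (Suc i))"
    and dM: "graded_hom m n (modl M (Suc i)) (modl M i) (diff M (Suc i))" for i
    using cL cM by (auto simp: graded_free_complex_def)
  have augL: "graded_hom m n (modl L 0) ring_module (\<lambda>x. to_ring_module (\<epsilon> x))"
    and augM: "graded_hom m n (modl M 0) ring_module (\<lambda>x. to_ring_module (\<eta> x))"
    using L M by (auto simp: linearly_exact_def augmentation_def)
  have degL: "b \<in> gens (modl L i) \<Longrightarrow> gdeg (modl L i) b = int (d + i)"
    and degM: "c \<in> gens (modl M i) \<Longrightarrow> gdeg (modl M i) c = int (d + i)" for i b c
    using L M by (auto simp: linearly_exact_def)
  have exL: "bij_betw (diff L (Suc i)) (graded_piece m n (modl L (Suc i)) (int (d + Suc i)))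
      {x \<in> graded_piece m n (modl L i) (int (d + Suc i)). cycle L \<epsilon> i x}"
    and exM: "bij_betw (diff M (Suc i)) (graded_piece m n (modl M (Suc i)) (int (d + Suc i)))
      {x \<in> graded_piece m n (modl M i) (int (d + Suc i)). cycle M \<eta> i x}" for i
    using L M by (simp_all add: linearly_exact_def)
  define P where "P i f \<longleftrightarrow> graded_hom m n (modl L i) (modl M i) f \<and>
      bij_betw f (elems m n (modl L i)) (elems m n (modl M i)) \<and>
      (\<forall>e. bij_betw f (graded_piece m n (modl L i) e) (graded_piece m n (modl M i) e)) \<and>
      (\<forall>x\<in>elems m n (modl L i). cycle M \<eta> i (f x) \<longleftrightarrow> cycle L \<epsilon> i x)"
    for i and f :: "('b, 'k) elem \<Rightarrow> ('c, 'k) elem"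
  have base: "\<exists>f. P 0 f"
  proof -
    let ?A = "to_ring_module ` {p \<in> J. homogeneous (int d) p}"
    have inj: "bij_betw to_ring_module {p \<in> J. homogeneous (int d) p} ?A"
      by (auto simp: bij_betw_def inj_on_def)
    have 1: "bij_betw (\<lambda>x. to_ring_module (\<epsilon> x)) (graded_piece m n (modl L 0) (int d)) ?A"
      using bij_betw_trans[OF _ inj, of \<epsilon>] L by (auto simp: linearly_exact_def comp_def)
    have 2: "bij_betw (\<lambda>x. to_ring_module (\<eta> x)) (graded_piece m n (modl M 0) (int d)) ?A"
      using bij_betw_trans[OF _ inj, of \<eta>] M by (auto simp: linearly_exact_def comp_def)
    have 3: "bij_betw (\<lambda>x. x) ?A ?A" by (simp add: bij_betw_def)
    obtain f where f: "graded_hom m n (modl L 0) (modl M 0) f"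
      "bij_betw f (elems m n (modl L 0)) (elems m n (modl M 0))"
      "\<And>e. bij_betw f (graded_piece m n (modl L 0) e) (graded_piece m n (modl M 0) e)"
      "\<And>x. x \<in> elems m n (modl L 0) \<Longrightarrow> to_ring_module (\<eta> (f x)) = to_ring_module (\<epsilon> x)"
      by (rule graded_iso_lift[OF graded_hom_id augL augM _ _ 1 2 3]) (auto simp: degL degM)
    then have "P 0 f" by (simp add: P_def)
    then show ?thesis by blast
  qed
  have step: "\<exists>g. P (Suc i) g \<and>
      (\<forall>x\<in>elems m n (modl L (Suc i)). f (diff L (Suc i) x) = diff M (Suc i) (g x))"
    if Pf: "P i f" for i f
  proof -
    let ?A = "{x \<in> graded_piece m n (modl L i) (int (d + Suc i)). cycle L \<epsilon> i x}"
    let ?B = "{x \<in> graded_piece m n (modl M i) (int (d + Suc i)). cycle M \<eta> i x}"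
    have f: "graded_hom m n (modl L i) (modl M i) f" using Pf by (simp add: P_def)
    have fbij: "bij_betw f (graded_piece m n (modl L i) (int (d + Suc i)))
        (graded_piece m n (modl M i) (int (d + Suc i)))" using Pf unfolding P_def by blast
    have cyc: "x \<in> graded_piece m n (modl L i) e \<Longrightarrow> cycle M \<eta> i (f x) \<longleftrightarrow> cycle L \<epsilon> i x" for x e
      using Pf graded_piece_elems[of x m n "modl L i"] by (auto simp: P_def)
    have AB: "bij_betw f ?A ?B"
    proof (rule bij_betw_subset[OF fbij])
      have "f ` ?A = {y \<in> f ` graded_piece m n (modl L i) (int (d + Suc i)). cycle M \<eta> i y}"
        by (auto simp: cyc)
      then show "f ` ?A = ?B" using fbij by (simp add: bij_betw_def)
    qed auto
    obtain g where g: "graded_hom m n (modl L (Suc i)) (modl M (Suc i)) g"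
      "bij_betw g (elems m n (modl L (Suc i))) (elems m n (modl M (Suc i)))"
      "\<And>e. bij_betw g (graded_piece m n (modl L (Suc i)) e) (graded_piece m n (modl M (Suc i)) e)"
      "\<And>x. x \<in> elems m n (modl L (Suc i)) \<Longrightarrow> diff M (Suc i) (g x) = f (diff L (Suc i) x)"
      by (rule graded_iso_lift[OF f dL dM degL degM exL exM AB]) auto
    have "diff M (Suc i) (g x) = 0 \<longleftrightarrow> diff L (Suc i) x = 0" if x: "x \<in> elems m n (modl L (Suc i))" for x
    proof -
      have "f (diff L (Suc i) x) = 0 \<longleftrightarrow> diff L (Suc i) x = 0"
        using Pf graded_homD(1)[OF dL x] graded_homD(5)[OF f] elems_zero
        unfolding P_def bij_betw_def inj_on_def by metis
      then show ?thesis using g(4)[OF x] by simp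
    qed
    then show ?thesis using g by (intro exI[of _ g]) (simp add: P_def)
  qed
  obtain \<Phi> where \<Phi>: "\<And>i. P i (\<Phi> i)"
    "\<And>i x. x \<in> elems m n (modl L (Suc i)) \<Longrightarrow> \<Phi> i (diff L (Suc i) x) = diff M (Suc i) (\<Phi> (Suc i) x)"
    using dependent_nat_choice[of P "\<lambda>i f g. \<forall>x\<in>elems m n (modl L (Suc i)).
      f (diff L (Suc i) x) = diff M (Suc i) (g x)", OF base step] by auto
  show ?thesis
    unfolding complex_isomorphic_def using cL cM \<Phi> by (auto simp: P_def intro!: exI[of _ \<Phi>])
qed

lemma graded_hom_cong:
  assumes "graded_hom m n M N g" "\<And>x. x \<in> elems m n M \<Longrightarrow> f x = g x"
  shows "graded_hom m n M N f"
  using assms unfolding graded_hom_def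
  by (auto simp: image_subset_iff elems_add elems_smul graded_piece_elems)

lemma inj_on_graded_piece:
  fixes f :: "('b, 'k::field) elem \<Rightarrow> ('c, 'k) elem"
  assumes f: "graded_hom m n M N f"
    and ker: "\<And>x. \<lbrakk>x \<in> graded_piece m n M e; f x = 0\<rbrakk> \<Longrightarrow> x = 0"
  shows "inj_on f (graded_piece m n M e)"
proof (rule inj_onI)
  fix x y assume x: "x \<in> graded_piece m n M e" and y: "y \<in> graded_piece m n M e" and xy: "f x = f y"
  have s: "(- 1 :: 'k poly_x) \<in> polyring m n" "homogeneous 0 (- 1 :: 'k poly_x)"
    by (simp_all add: polyring_uminus homogeneous_uminus)
  have minus: "z + smul (- 1) w = z - w" for z w :: "('c, 'k) elem"
    by (intro poly_mapping_eqI) (simp add: lookup_add lookup_minus)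
  have minus': "z + smul (- 1) w = z - w" for z w :: "('b, 'k) elem"
    by (intro poly_mapping_eqI) (simp add: lookup_add lookup_minus)
  have sy: "smul (- 1) y \<in> graded_piece m n M e" using graded_piece_smul[OF s y] by simp
  have "f (x + smul (- 1) y) = f x + smul (- 1) (f y)"
    using x y sy s by (simp add: graded_homD(2,3)[OF f] graded_piece_elems)
  then have "f (x + smul (- 1) y) = 0" using xy by (simp add: minus)
  then have "x + smul (- 1) y = 0" using ker graded_piece_add[OF x sy] by blast
  then show "x = y" by (simp add: minus')
qed

section \<open>The linear strand of a minimal resolution\<close>

text \<open>
  By minimality a cycle of a minimal resolution has coefficients without constant term.  If \<open>F\<^sub>i\<close> had
  a generator of degree less than \<open>d + i\<close>, then by induction its boundary would have coefficients of
  degree at most 0, hence vanish (for \<open>i = 0\<close>, its image in \<open>J\<close> vanishes, as \<open>J\<close> is zero below degree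
  \<open>d\<close>), and the generator would be a cycle.  For the same reason the boundary
  of an element of degree \<open>d + i + 1\<close> lies in the strand, and no nonzero cycle of \<open>F\<^sub>i\<close> in the strand
  has degree \<open>d + i\<close>.
\<close>

theorem linear_strand_linearly_exact:
  fixes F :: "('b, 'k::field) fcomplex"
  assumes res: "minimal_graded_free_resolution m n J F \<epsilon>"
    and J: "J \<subseteq> polyring m n"
    and init: "\<And>p e. \<lbrakk>p \<in> J; homogeneous e p; e < int d\<rbrakk> \<Longrightarrow> p = 0"
  shows "linearly_exact m n d J (linear_strand d F) \<epsilon>"
proof -
  let ?F = "modl F" and ?L = "modl (linear_strand d F)"
  have cF: "graded_free_complex m n F" using res by (simp add: minimal_graded_free_resolution_def)
  have dF: "graded_hom m n (?F (Suc i)) (?F i) (diff F (Suc i))" for i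
    using cF by (auto simp: graded_free_complex_def)
  have im_\<epsilon>: "\<epsilon> ` elems m n (?F 0) = J"
    using res by (simp add: minimal_graded_free_resolution_def)
  have augF: "graded_hom m n (?F 0) ring_module (\<lambda>x. to_ring_module (\<epsilon> x))"
  proof -
    have "\<epsilon> x \<in> polyring m n" if "x \<in> elems m n (?F 0)" for x using that im_\<epsilon> J by blast
    then show ?thesis
      using res unfolding graded_hom_def minimal_graded_free_resolution_def
      by (auto simp: image_subset_iff graded_piece_elems)
  qed
  have cyc_iff: "{x \<in> elems m n (?F i). cycle F \<epsilon> i x} =
      diff F (Suc i) ` elems m n (?F (Suc i))" for i
    using res unfolding minimal_graded_free_resolution_def by (cases i) auto
  have minimal: "Poly_Mapping.lookup (Poly_Mapping.lookup x b) 0 = 0"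
    if x: "x \<in> elems m n (?F i)" "cycle F \<epsilon> i x" for i x b
  proof -
    obtain y where "y \<in> elems m n (?F (Suc i))" "x = diff F (Suc i) y"
      using x cyc_iff[of i] by blast
    then show ?thesis using res by (simp add: minimal_graded_free_resolution_def)
  qed
  have boundary_cycle: "cycle F \<epsilon> i (diff F (Suc i) x)" if "x \<in> elems m n (?F (Suc i))" for i x
    using that cyc_iff[of i] by blast
  have d_elems: "diff F (Suc i) x \<in> elems m n (?F i)" if "x \<in> elems m n (?F (Suc i))" for i x
    by (rule graded_homD(1)[OF dF that])

  have deg_ge: "int (d + i) \<le> gdeg (?F i) b" if "b \<in> gens (?F i)" for i b
    using that
  proof (induction i arbitrary: b)
    case (0 b)
    show ?case
    proof (rule ccontr)
      assume "\<not> ?thesis"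
      then have lt: "gdeg (?F 0) b < int d" by simp
      have b: "basis_elem b \<in> graded_piece m n (?F 0) (gdeg (?F 0) b)"
        using 0 by (simp add: basis_elem_graded_piece)
      have "homogeneous (gdeg (?F 0) b) (\<epsilon> (basis_elem b))"
        using graded_homD(4)[OF augF b] by simp
      moreover have "\<epsilon> (basis_elem b) \<in> J"
        using im_\<epsilon> graded_piece_elems[OF b] by blast
      ultimately have "cycle F \<epsilon> 0 (basis_elem b)" using init lt by simp
      from minimal[OF graded_piece_elems[OF b] this, of b] show False by simp
    qed
  next
    case (Suc i b)
    show ?case
    proof (rule ccontr)
      assume "\<not> ?thesis"
      then have lt: "gdeg (?F (Suc i)) b \<le> int (d + i)" by simp
      have b: "basis_elem b \<in> graded_piece m n (?F (Suc i)) (gdeg (?F (Suc i)) b)"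
        using Suc.prems by (simp add: basis_elem_graded_piece)
      let ?x = "diff F (Suc i) (basis_elem b)"
      have x: "?x \<in> graded_piece m n (?F i) (gdeg (?F (Suc i)) b)" by (rule graded_homD(4)[OF dF b])
      have "Poly_Mapping.lookup ?x c = 0" for c
      proof (cases "c \<in> gens (?F i)")
        case True
        then have "gdeg (?F (Suc i)) b - gdeg (?F i) c \<le> 0" using Suc.IH[of c] lt by simp
        moreover have "Poly_Mapping.lookup (Poly_Mapping.lookup ?x c) 0 = 0"
          by (rule minimal[OF d_elems boundary_cycle]) (rule graded_piece_elems[OF b])+
        ultimately show ?thesis
          using x by (intro homogeneous_nonpos_no_constant) (auto simp: graded_piece_iff)
      qed (use x in \<open>auto simp: graded_piece_iff elems_iff\<close>)
      then have "?x = 0" by (intro poly_mapping_eqI) simp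
      then have "cycle F \<epsilon> (Suc i) (basis_elem b)" by simp
      from minimal[OF graded_piece_elems[OF b] this, of b] show False by simp
    qed
  qed

  have gens_L: "gens (?L i) = {b \<in> gens (?F i). gdeg (?F i) b = int (i + d)}"
    and gdeg_L [simp]: "gdeg (?L i) = gdeg (?F i)"
    and diff_L [simp]: "diff (linear_strand d F) = diff F" for i
    by (simp_all add: linear_strand_def restrict_gens_def)
  have cyc_L [simp]: "cycle (linear_strand d F) \<epsilon> i x \<longleftrightarrow> cycle F \<epsilon> i x" for i x
    by (simp add: cycle_def)
  have elems_LF: "x \<in> elems m n (?F i)" if "x \<in> elems m n (?L i)"
    for i and x :: "('b, 'k) elem"
    using that by (auto simp: elems_iff gens_L)
  have piece_LF: "x \<in> graded_piece m n (?F i) e" if "x \<in> graded_piece m n (?L i) e"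
    for i e and x :: "('b, 'k) elem"
    using that elems_LF by (auto simp: graded_piece_iff)
  have piece_FL: "x \<in> graded_piece m n (?L i) e"
    if x: "x \<in> graded_piece m n (?F i) e"
      and supp: "\<And>b. \<lbrakk>b \<in> gens (?F i); gdeg (?F i) b > int (d + i)\<rbrakk> \<Longrightarrow> Poly_Mapping.lookup x b = 0"
    for i e and x :: "('b, 'k) elem"
  proof -
    have "b \<in> gens (?L i)" if "Poly_Mapping.lookup x b \<noteq> 0" for b
    proof -
      have "b \<in> gens (?F i)" using x that by (auto simp: graded_piece_iff elems_iff)
      then show ?thesis using that supp[of b] deg_ge[of b i] by (force simp: gens_L)
    qed
    then show ?thesis using x by (auto simp: graded_piece_iff elems_iff)
  qed
  have piece_FL_low: "x \<in> graded_piece m n (?L i) (int (d + i))"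
    if x: "x \<in> graded_piece m n (?F i) (int (d + i))" for i and x :: "('b, 'k) elem"
  proof (rule piece_FL[OF x])
    fix b assume "b \<in> gens (?F i)" "gdeg (?F i) b > int (d + i)"
    then show "Poly_Mapping.lookup x b = 0"
      using x by (intro homogeneous_neg[of "int (d + i) - gdeg (?F i) b"]) (auto simp: graded_piece_iff)
  qed
  have d_piece: "diff F (Suc i) x \<in> graded_piece m n (?L i) (int (d + Suc i))"
    if x: "x \<in> graded_piece m n (?F (Suc i)) (int (d + Suc i))" for i x
  proof (rule piece_FL)
    show dx: "diff F (Suc i) x \<in> graded_piece m n (?F i) (int (d + Suc i))"
      by (rule graded_homD(4)[OF dF x])
    fix b assume "b \<in> gens (?F i)" "gdeg (?F i) b > int (d + i)"
    moreover have "Poly_Mapping.lookup (Poly_Mapping.lookup (diff F (Suc i) x) b) 0 = 0"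
      by (rule minimal[OF d_elems boundary_cycle]) (rule graded_piece_elems[OF x])+
    ultimately show "Poly_Mapping.lookup (diff F (Suc i) x) b = 0"
      using dx
      by (intro homogeneous_nonpos_no_constant[of "int (d + Suc i) - gdeg (?F i) b"])
         (auto simp: graded_piece_iff)
  qed
  have dL: "graded_hom m n (?L (Suc i)) (?L i) (diff F (Suc i))" for i
  proof (rule graded_hom_cong)
    show "graded_hom m n (?L (Suc i)) (?L i)
        (linear_extension (\<lambda>b. diff F (Suc i) (basis_elem b)))"
    proof (rule graded_hom_linear_extension)
      fix b assume "b \<in> gens (?L (Suc i))"
      then have "basis_elem b \<in> graded_piece m n (?F (Suc i)) (int (d + Suc i))"
        "gdeg (?L (Suc i)) b = int (d + Suc i)"
        by (auto simp: gens_L intro!: basis_elem_graded_piece)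
      then show "diff F (Suc i) (basis_elem b) \<in> graded_piece m n (?L i) (gdeg (?L (Suc i)) b)"
        using d_piece by metis
    qed
    show "diff F (Suc i) x = linear_extension (\<lambda>b. diff F (Suc i) (basis_elem b)) x"
      if "x \<in> elems m n (?L (Suc i))" for x
      by (rule graded_hom_eq_linear_extension[OF dF elems_LF[OF that]])
  qed
  have cL: "graded_free_complex m n (linear_strand d F)"
    using cF dL elems_LF unfolding graded_free_complex_def by (auto simp: gens_L)
  have augL: "graded_hom m n (?L 0) ring_module (\<lambda>x. to_ring_module (\<epsilon> x))"
    using augF elems_LF piece_LF elems_LF[OF graded_piece_elems]
    unfolding graded_hom_def by (auto simp: image_subset_iff)
  have no_low_cycles: "x = 0" if x: "x \<in> graded_piece m n (?L i) (int (d + i))" and c: "cycle F \<epsilon> i x" for i x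
  proof (rule poly_mapping_eqI)
    fix b
    show "Poly_Mapping.lookup x b = Poly_Mapping.lookup 0 b"
    proof (cases "b \<in> gens (?L i)")
      case True
      then have "homogeneous 0 (Poly_Mapping.lookup x b)"
        using x by (auto simp: graded_piece_iff gens_L dest: spec[of _ b])
      then show ?thesis
        using minimal[OF elems_LF[OF graded_piece_elems[OF x]] c, of b]
        by (simp add: homogeneous_nonpos_no_constant)
    qed (use x in \<open>auto simp: graded_piece_iff elems_iff\<close>)
  qed
  have bij0: "bij_betw \<epsilon> (graded_piece m n (?L 0) (int d)) {p \<in> J. homogeneous (int d) p}"
    unfolding bij_betw_def
  proof
    have "inj_on (\<lambda>x. to_ring_module (\<epsilon> x)) (graded_piece m n (?L 0) (int d))"
      using no_low_cycles[of _ 0] by (intro inj_on_graded_piece[OF augL]) simp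
    then show "inj_on \<epsilon> (graded_piece m n (?L 0) (int d))" by (simp add: inj_on_def)
    show "\<epsilon> ` graded_piece m n (?L 0) (int d) = {p \<in> J. homogeneous (int d) p}" (is "?l = ?r")
    proof
      show "?l \<subseteq> ?r"
        using im_\<epsilon> elems_LF graded_homD(4)[OF augL] by (fastforce dest: graded_piece_elems)
      show "?r \<subseteq> ?l"
      proof
        fix p assume p: "p \<in> ?r"
        then obtain x where x: "x \<in> elems m n (?F 0)" "\<epsilon> x = p" using im_\<epsilon> by blast
        have "to_ring_module (\<epsilon> x) \<in> graded_piece m n ring_module (int d)"
          using p x J by auto
        from graded_lift[OF augF x(1) this]
        obtain y where y: "y \<in> graded_piece m n (?F 0) (int d)" "\<epsilon> y = p" using x(2) by auto
        then show "p \<in> ?l" using piece_FL_low[of y 0] by auto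
      qed
    qed
  qed
  have bij: "bij_betw (diff F (Suc i)) (graded_piece m n (?L (Suc i)) (int (d + Suc i)))
      {x \<in> graded_piece m n (?L i) (int (d + Suc i)). cycle F \<epsilon> i x}" for i
    unfolding bij_betw_def
  proof
    show "inj_on (diff F (Suc i)) (graded_piece m n (?L (Suc i)) (int (d + Suc i)))"
      using no_low_cycles[of _ "Suc i"] by (intro inj_on_graded_piece[OF dL]) simp
    show "diff F (Suc i) ` graded_piece m n (?L (Suc i)) (int (d + Suc i)) =
        {x \<in> graded_piece m n (?L i) (int (d + Suc i)). cycle F \<epsilon> i x}" (is "?l = ?r")
    proof
      show "?l \<subseteq> ?r"
      proof (rule image_subsetI)
        fix x :: "('b, 'k) elem" assume x: "x \<in> graded_piece m n (?L (Suc i)) (int (d + Suc i))"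
        then show "diff F (Suc i) x \<in> ?r"
          using d_piece[OF piece_LF[OF x]] boundary_cycle[OF elems_LF[OF graded_piece_elems[OF x]]]
          by simp
      qed
      show "?r \<subseteq> ?l"
      proof
        fix x assume x: "x \<in> ?r"
        then have xF: "x \<in> graded_piece m n (?F i) (int (d + Suc i))" by (intro piece_LF) simp
        with x have "x \<in> diff F (Suc i) ` elems m n (?F (Suc i))"
          unfolding cyc_iff[symmetric] by (simp add: graded_piece_elems)
        then obtain y where y: "y \<in> elems m n (?F (Suc i))" "diff F (Suc i) y = x" by auto
        with xF have "diff F (Suc i) y \<in> graded_piece m n (?F i) (int (d + Suc i))" by simp
        from graded_lift[OF dF y(1) this]
        obtain z where "z \<in> graded_piece m n (?F (Suc i)) (int (d + Suc i))" "diff F (Suc i) z = x"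
          using y(2) by auto
        then show "x \<in> ?l" using piece_FL_low[of z "Suc i"] by auto
      qed
    qed
  qed
  show ?thesis
    unfolding linearly_exact_def augmentation_def
    using cL augL bij0 bij by (auto simp: gens_L)
qed

section \<open>The differential of the Eagon-Northcott complex\<close>

text \<open>
  If \<open>j\<close> is the \<open>k\<close>-th element of \<open>\<tau>\<close>, counted from 0, this is \<open>(- 1) ^ k\<close>.  As \<open>j\<close> itself is not
  counted, the sign is the same for \<open>\<tau>\<close>, for \<open>\<tau> - {j}\<close> and for \<open>insert j \<tau>\<close>.
\<close>

definition col_sign :: "nat \<Rightarrow> nat set \<Rightarrow> 'a::comm_ring_1" where
  "col_sign j \<tau> = (- 1) ^ card {i \<in> \<tau>. i < j}"

lemma col_sign_square [simp]: "col_sign j \<tau> * col_sign j \<tau> = 1"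
  by (simp add: col_sign_def flip: power_add mult_2)

lemma col_sign_square_left [simp]: "col_sign j \<tau> * (col_sign j \<tau> * x) = x"
  by (simp flip: mult.assoc)

lemma col_sign_neq_0 [simp]: "col_sign j \<tau> \<noteq> (0 :: 'k::field)"
  by (simp add: col_sign_def)

lemma col_sign_remove [simp]: "col_sign j (\<tau> - {j}) = col_sign j \<tau>"
  unfolding col_sign_def by (rule arg_cong[where f = "\<lambda>A. (- 1) ^ card A"]) auto

lemma col_sign_insert_greater: "\<not> p < q \<Longrightarrow> col_sign q (insert p \<tau>) = col_sign q \<tau>"
  unfolding col_sign_def by (rule arg_cong[where f = "\<lambda>A. (- 1) ^ card A"]) auto

lemma col_sign_insert_less:
  assumes "p < q" "p \<notin> \<tau>" "finite \<tau>"
  shows "col_sign q (insert p \<tau>) = - col_sign q \<tau>"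
proof -
  have "{i \<in> insert p \<tau>. i < q} = insert p {i \<in> \<tau>. i < q}" using assms by auto
  then show ?thesis using assms by (simp add: col_sign_def)
qed

lemma col_sign_exchange:
  assumes "p \<noteq> q" "p \<notin> \<tau>" "q \<notin> \<tau>" "finite \<tau>"
  shows "col_sign p \<tau> * col_sign q (insert p \<tau>) =
    - (col_sign q \<tau> * col_sign p (insert q \<tau>) :: 'a::comm_ring_1)"
proof (cases "p < q")
  case True
  then show ?thesis
    using assms by (simp add: col_sign_insert_less col_sign_insert_greater mult.commute)
next
  case False
  then have "q < p" using assms by simp
  then show ?thesis
    using assms by (simp add: col_sign_insert_less col_sign_insert_greater mult.commute)
qed

lemma lookup_power_minus_one_mult:
  fixes p :: "'k::field poly_x"
  shows "Poly_Mapping.lookup ((- 1) ^ k * p) t = (- 1) ^ k * Poly_Mapping.lookup p t"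
  by (induction k) (simp_all add: mult.assoc)

lemma lookup_col_sign_mult [simp]:
  fixes p :: "'k::field poly_x"
  shows "Poly_Mapping.lookup (col_sign j \<tau> * p) t = col_sign j \<tau> * Poly_Mapping.lookup p t"
  by (simp add: col_sign_def lookup_power_minus_one_mult)

lemma card_less_nth_sorted_list:
  fixes \<sigma> :: "nat set"
  assumes "finite \<sigma>" "k < card \<sigma>"
  shows "card {i \<in> \<sigma>. i < sorted_list_of_set \<sigma> ! k} = k"
proof -
  let ?xs = "sorted_list_of_set \<sigma>"
  have len: "length ?xs = card \<sigma>" by simp
  have less: "?xs ! i < ?xs ! j \<longleftrightarrow> i < j" if "i < card \<sigma>" "j < card \<sigma>" for i j
  proof
    show "i < j" if l: "?xs ! i < ?xs ! j"
    proof (rule ccontr)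
      assume "\<not> i < j"
      then have "?xs ! j \<le> ?xs ! i"
        using \<open>i < card \<sigma>\<close> by (intro sorted_nth_mono) simp_all
      then show False using l by simp
    qed
    show "?xs ! i < ?xs ! j" if "i < j"
      using that \<open>j < card \<sigma>\<close> strict_sorted_list_of_set[of \<sigma>]
      by (auto simp: sorted_wrt_iff_nth_less)
  qed
  have "{i \<in> \<sigma>. i < ?xs ! k} = (!) ?xs ` {..<k}" (is "?l = ?r")
  proof
    show "?l \<subseteq> ?r"
    proof
      fix x assume x: "x \<in> ?l"
      then have "x \<in> set ?xs" using assms by simp
      then obtain i where "i < card \<sigma>" "x = ?xs ! i" by (metis in_set_conv_nth len)
      then show "x \<in> ?r" using x less[of i k] assms by auto
    qed
    show "?r \<subseteq> ?l"
    proof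
      fix x assume "x \<in> ?r"
      then obtain i where i: "i < k" "x = ?xs ! i" by auto
      then have "x \<in> set ?xs" using assms len by (metis less_trans nth_mem)
      then show "x \<in> ?l" using i assms less[of i k] by simp
    qed
  qed
  moreover have "inj_on ((!) ?xs) {..<k}"
    using assms by (auto intro!: inj_on_nth)
  ultimately show ?thesis by (simp add: card_image)
qed

lemma bij_betw_nth_sorted_list:
  fixes \<sigma> :: "nat set"
  assumes "finite \<sigma>"
  shows "bij_betw ((!) (sorted_list_of_set \<sigma>)) {..<card \<sigma>} \<sigma>"
  using assms by (intro bij_betw_nth) auto

lemma en_boundary_eq:
  assumes "finite \<sigma>"
  shows "en_boundary m (\<sigma>, a) = (\<Sum>j\<in>\<sigma>. \<Sum>l\<in>{1..m}.
    (if Poly_Mapping.lookup a l = 0 then 0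
     else smul (col_sign j \<sigma> * xvar l j) (basis_elem (\<sigma> - {j}, a - Poly_Mapping.single l 1))))"
    (is "_ = (\<Sum>j\<in>\<sigma>. ?t j (col_sign j \<sigma>))")
proof -
  have "(\<Sum>j\<in>\<sigma>. ?t j (col_sign j \<sigma>)) =
      (\<Sum>k<card \<sigma>. ?t (sorted_list_of_set \<sigma> ! k) (col_sign (sorted_list_of_set \<sigma> ! k) \<sigma>))"
    by (rule sum.reindex_bij_betw[OF bij_betw_nth_sorted_list[OF assms], symmetric])
  also have "\<dots> = (\<Sum>k<card \<sigma>. ?t (sorted_list_of_set \<sigma> ! k) ((- 1) ^ k))"
    using assms by (intro sum.cong refl) (simp add: col_sign_def card_less_nth_sorted_list)
  finally show ?thesis by (simp add: en_boundary_def Let_def)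
qed

lemma sum_sum_delta:
  assumes "finite A" "finite B"
  shows "(\<Sum>j\<in>A. \<Sum>l\<in>B. if j = j0 \<and> l = l0 then f j l else 0) =
    (if j0 \<in> A \<and> l0 \<in> B then f j0 l0 else 0)"
proof -
  have "(\<Sum>j\<in>A. \<Sum>l\<in>B. if j = j0 \<and> l = l0 then f j l else 0) =
      (\<Sum>j\<in>A. if j = j0 then \<Sum>l\<in>B. if l = l0 then f j0 l0 else 0 else 0)"
    by (intro sum.cong refl) (auto intro!: sum.cong)
  then show ?thesis using assms by simp
qed

lemma lookup_en_boundary:
  fixes m :: nat and a :: "nat \<Rightarrow>\<^sub>0 nat"
  assumes \<sigma>: "\<sigma> \<subseteq> {1..n}"
  shows "Poly_Mapping.lookup (en_boundary m (\<sigma>, a)) (\<tau>, c) =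
    (\<Sum>j\<in>{1..n} - \<tau>. \<Sum>l\<in>{1..m}.
      if (\<sigma>, a) = (insert j \<tau>, c + Poly_Mapping.single l 1) then col_sign j \<tau> * xvar l j
      else 0 :: 'a::field poly_x)" (is "?lhs = _")
proof -
  have fin: "finite \<sigma>" using \<sigma> finite_subset by blast
  have a_iff: "Poly_Mapping.lookup a l \<noteq> 0 \<and> c = a - Poly_Mapping.single l 1 \<longleftrightarrow>
      a = c + Poly_Mapping.single l 1" for l
    using minus_single_add_single[of a l] by (auto simp: lookup_add add.commute)
  let ?g = "\<lambda>j. \<Sum>l\<in>{1..m}.
      if (\<sigma>, a) = (insert j \<tau>, c + Poly_Mapping.single l 1) then col_sign j \<tau> * xvar l j
      else 0 :: 'a poly_x"
  have "?lhs =
      (\<Sum>j\<in>\<sigma>. \<Sum>l\<in>{1..m}. if \<sigma> - {j} = \<tau> \<and> a = c + Poly_Mapping.single l 1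
        then col_sign j \<sigma> * xvar l j else 0)"
    unfolding en_boundary_eq[OF fin] lookup_sum
  proof (intro sum.cong refl)
    fix j l
    show "Poly_Mapping.lookup (if Poly_Mapping.lookup a l = 0 then 0 else smul (col_sign j \<sigma> * xvar l j)
          (basis_elem (\<sigma> - {j}, a - Poly_Mapping.single l 1))) (\<tau>, c) =
        (if \<sigma> - {j} = \<tau> \<and> a = c + Poly_Mapping.single l 1 then col_sign j \<sigma> * xvar l j else 0)"
      unfolding a_iff[symmetric] by (auto simp: lookup_single when_def)
  qed
  also have "\<dots> = (\<Sum>j\<in>\<sigma>. if j \<in> \<tau> then 0 else ?g j)"
  proof (intro sum.cong refl)
    fix j assume j: "j \<in> \<sigma>"
    show "(\<Sum>l\<in>{1..m}. if \<sigma> - {j} = \<tau> \<and> a = c + Poly_Mapping.single l 1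
          then col_sign j \<sigma> * xvar l j else 0) = (if j \<in> \<tau> then 0 else ?g j)"
    proof (cases "j \<in> \<tau>")
      case True
      then have "\<sigma> - {j} \<noteq> \<tau>" by auto
      then show ?thesis using True by simp
    next
      case False
      with j have iff: "\<sigma> - {j} = \<tau> \<longleftrightarrow> \<sigma> = insert j \<tau>" by auto
      have "col_sign j (insert j \<tau>) = (col_sign j \<tau> :: 'a poly_x)"
        by (simp add: col_sign_insert_greater)
      then show ?thesis
        using False unfolding iff by (cases "\<sigma> = insert j \<tau>") (simp_all cong: if_cong)
    qed
  qed
  also have "\<dots> = (\<Sum>j\<in>{1..n}. if j \<in> \<tau> then 0 else ?g j)"
  proof (rule sum.mono_neutral_left)
    show "\<forall>j\<in>{1..n} - \<sigma>. (if j \<in> \<tau> then 0 else ?g j) = 0"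
    proof
      fix j assume "j \<in> {1..n} - \<sigma>"
      then have "\<sigma> \<noteq> insert j \<tau>" by auto
      then show "(if j \<in> \<tau> then 0 else ?g j) = 0" by simp
    qed
  qed (use \<sigma> in auto)
  also have "\<dots> = (\<Sum>j\<in>{1..n} - \<tau>. if j \<in> \<tau> then 0 else ?g j)"
    by (intro sum.mono_neutral_right) auto
  also have "\<dots> = (\<Sum>j\<in>{1..n} - \<tau>. ?g j)"
    by (intro sum.cong) auto
  finally show ?thesis .
qed

abbreviation en_diff :: "nat \<Rightarrow> (en_index, 'k::field) elem \<Rightarrow> (en_index, 'k) elem" where
  "en_diff m \<equiv> linear_extension (en_boundary m)"

text \<open>
  The differential read from its target: \<open>b(\<tau>;c)\<close> is reached exactly from the \<open>b(\<tau> \<union> {j}; c + e\<^sub>l)\<close>.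
  All later computations with the differential start from this formula.
\<close>

lemma lookup_en_diff:
  fixes f :: "(en_index, 'k::field) elem"
  assumes "\<forall>b\<in>Poly_Mapping.keys f. fst b \<subseteq> {1..n}"
  shows "Poly_Mapping.lookup (en_diff m f) (\<tau>, c) =
    (\<Sum>j\<in>{1..n} - \<tau>. \<Sum>l\<in>{1..m}. col_sign j \<tau> *
      (xvar l j * Poly_Mapping.lookup f (insert j \<tau>, c + Poly_Mapping.single l 1)))"
proof -
  let ?K = "Poly_Mapping.keys f"
  let ?e = "\<lambda>j l. (insert j \<tau>, c + Poly_Mapping.single l 1)"
  have "Poly_Mapping.lookup (en_diff m f) (\<tau>, c) =
      (\<Sum>b\<in>?K. \<Sum>j\<in>{1..n} - \<tau>. \<Sum>l\<in>{1..m}.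
        if b = ?e j l then Poly_Mapping.lookup f b * (col_sign j \<tau> * xvar l j) else 0)"
    unfolding linear_extension_def lookup_sum lookup_smul
  proof (intro sum.cong refl)
    fix b assume "b \<in> ?K"
    then have "fst b \<subseteq> {1..n}" using assms by blast
    then have "Poly_Mapping.lookup (en_boundary m b) (\<tau>, c) =
        (\<Sum>j\<in>{1..n} - \<tau>. \<Sum>l\<in>{1..m}. if b = ?e j l then col_sign j \<tau> * xvar l j else 0 :: 'k poly_x)"
      using lookup_en_boundary[of "fst b" n m "snd b" \<tau> c] by simp
    then
    show "Poly_Mapping.lookup f b * Poly_Mapping.lookup (en_boundary m b) (\<tau>, c) =
        (\<Sum>j\<in>{1..n} - \<tau>. \<Sum>l\<in>{1..m}.
          if b = ?e j l then Poly_Mapping.lookup f b * (col_sign j \<tau> * xvar l j) else 0)"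
      by (simp only: sum_distrib_left if_distrib[of "(*) (Poly_Mapping.lookup f b)"] mult_zero_right)
  qed
  also have "\<dots> = (\<Sum>j\<in>{1..n} - \<tau>. \<Sum>l\<in>{1..m}. \<Sum>b\<in>?K.
        if b = ?e j l then Poly_Mapping.lookup f b * (col_sign j \<tau> * xvar l j) else 0)"
    by (subst sum.swap) (intro sum.cong refl sum.swap)
  also have "\<dots> = (\<Sum>j\<in>{1..n} - \<tau>. \<Sum>l\<in>{1..m}. col_sign j \<tau> *
      (xvar l j * Poly_Mapping.lookup f (?e j l)))"
    by (intro sum.cong refl) (simp add: in_keys_iff ac_simps)
  finally show ?thesis .
qed

text \<open>
  Terms are cancelled in pairs, since the sum being its own negative proves nothing in
  characteristic 2.
\<close>

lemma sum_antisymmetric: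
  fixes U :: "'i \<Rightarrow> 'i \<Rightarrow> 'a::ab_group_add"
  assumes "finite N" "\<And>i j. \<lbrakk>i \<in> N; j \<in> N; i \<noteq> j\<rbrakk> \<Longrightarrow> U i j = - U j i"
  shows "(\<Sum>i\<in>N. \<Sum>j\<in>N - {i}. U i j) = 0"
  using assms
proof (induction N rule: finite_induct)
  case (insert x N)
  have "(\<Sum>i\<in>N. \<Sum>j\<in>insert x N - {i}. U i j) = (\<Sum>i\<in>N. U i x + (\<Sum>j\<in>N - {i}. U i j))"
  proof (intro sum.cong refl)
    fix i assume "i \<in> N"
    then have "insert x N - {i} = insert x (N - {i})" using insert.hyps by auto
    then show "(\<Sum>j\<in>insert x N - {i}. U i j) = U i x + (\<Sum>j\<in>N - {i}. U i j)"
      using insert.hyps by simp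
  qed
  also have "\<dots> = (\<Sum>i\<in>N. - U x i)"
  proof -
    have "(\<Sum>i\<in>N. \<Sum>j\<in>N - {i}. U i j) = 0"
      by (intro insert.IH insert.prems) auto
    moreover have "(\<Sum>i\<in>N. U i x) = (\<Sum>i\<in>N. - U x i)"
      using insert.hyps by (intro sum.cong refl insert.prems) auto
    ultimately show ?thesis by (simp add: sum.distrib)
  qed
  finally show ?case using insert.hyps by (simp add: sum_negf)
qed simp

text \<open>
  The coefficients of \<open>x\<^bsub>lj\<^esub> x\<^bsub>l'j'\<^esub>\<close> that come from removing \<open>j\<close> and \<open>j'\<close> in the two possible orders
  cancel by \<open>col_sign_exchange\<close>.
\<close>

lemma en_diff_en_diff:
  assumes f: "\<forall>b\<in>Poly_Mapping.keys f. fst b \<subseteq> {1..n}"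
    and df: "\<forall>b\<in>Poly_Mapping.keys (en_diff m f). fst b \<subseteq> {1..n}"
  shows "Poly_Mapping.lookup (en_diff m (en_diff m f)) (\<tau>, c) = 0"
proof -
  define T where "T j l j' l' = col_sign j \<tau> * (xvar l j * (col_sign j' (insert j \<tau>) * (xvar l' j' *
      Poly_Mapping.lookup f (insert j' (insert j \<tau>), c + Poly_Mapping.single l 1 + Poly_Mapping.single l' 1))))"
    for j l j' l'
  define U where "U j j' = (\<Sum>l\<in>{1..m}. \<Sum>l'\<in>{1..m}. T j l j' l')" for j j'
  have U_anti: "U j j' = - U j' j" if "j \<in> {1..n} - \<tau>" "j' \<in> {1..n} - \<tau>" "j \<noteq> j'" for j j'
  proof -
    have "T j l j' l' = - T j' l' j l" for l l'
    proof -
      let ?X = "xvar l j * (xvar l' j' * Poly_Mapping.lookup f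
          (insert j' (insert j \<tau>), c + Poly_Mapping.single l 1 + Poly_Mapping.single l' 1))"
      have T1: "T j l j' l' = (col_sign j \<tau> * col_sign j' (insert j \<tau>)) * ?X"
        by (simp only: T_def ac_simps)
      have T2: "T j' l' j l = (col_sign j' \<tau> * col_sign j (insert j' \<tau>)) * ?X"
        by (simp only: T_def insert_commute[of j j'] ac_simps)
      show ?thesis
      proof (cases "\<tau> \<subseteq> {1..n}")
        case True
        then have "finite \<tau>" using finite_subset by blast
        then have sgn: "col_sign j \<tau> * col_sign j' (insert j \<tau>) =
            - (col_sign j' \<tau> * col_sign j (insert j' \<tau>) :: 'a poly_x)"
          using that by (intro col_sign_exchange) auto
        show ?thesis unfolding T1 T2 sgn by simp
      next
        case False
        then have "Poly_Mapping.lookup f (insert i (insert i' \<tau>), e) = 0" for i i' e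
          using bspec[OF f, of "(insert i (insert i' \<tau>), e)"] by (auto simp: in_keys_iff)
        then show ?thesis by (simp add: T_def)
      qed
    qed
    then have "U j j' = (\<Sum>l\<in>{1..m}. \<Sum>l'\<in>{1..m}. - T j' l' j l)"
      by (simp add: U_def)
    also have "\<dots> = - U j' j"
      unfolding U_def sum_negf by (subst sum.swap) simp
    finally show ?thesis .
  qed
  have U0: "(\<Sum>j\<in>{1..n} - \<tau>. \<Sum>j'\<in>{1..n} - \<tau> - {j}. U j j') = 0"
    by (intro sum_antisymmetric U_anti) simp_all
  have "Poly_Mapping.lookup (en_diff m (en_diff m f)) (\<tau>, c) =
      (\<Sum>j\<in>{1..n} - \<tau>. \<Sum>l\<in>{1..m}. \<Sum>j'\<in>{1..n} - insert j \<tau>. \<Sum>l'\<in>{1..m}. T j l j' l')"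
    by (simp only: lookup_en_diff[OF df] lookup_en_diff[OF f] T_def[abs_def] sum_distrib_left)
  also have "\<dots> = (\<Sum>j\<in>{1..n} - \<tau>. \<Sum>j'\<in>{1..n} - \<tau> - {j}. U j j')"
  proof (rule sum.cong[OF refl])
    fix j
    have "{1..n} - insert j \<tau> = {1..n} - \<tau> - {j}" by auto
    then show "(\<Sum>l\<in>{1..m}. \<Sum>j'\<in>{1..n} - insert j \<tau>. \<Sum>l'\<in>{1..m}. T j l j' l') =
        (\<Sum>j'\<in>{1..n} - \<tau> - {j}. U j j')"
      unfolding U_def by (simp only: sum.swap[of _ "{1..n} - \<tau> - {j}"])
  qed
  finally show ?thesis using U0 by simp
qed

text \<open>
  Every exponent vector of positive total degree is a unit vector plus one of smaller degree.
\<close>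

lemma finite_exponents:
  assumes "finite A"
  shows "finite {a :: 'v \<Rightarrow>\<^sub>0 nat. Poly_Mapping.keys a \<subseteq> A \<and> total a = i}"
proof (induction i)
  case 0
  show ?case by (rule finite_subset[of _ "{0}"]) (auto simp: total_eq_0_iff)
next
  case (Suc i)
  let ?B = "{a :: 'v \<Rightarrow>\<^sub>0 nat. Poly_Mapping.keys a \<subseteq> A \<and> total a = i}"
  have "{a :: 'v \<Rightarrow>\<^sub>0 nat. Poly_Mapping.keys a \<subseteq> A \<and> total a = Suc i} \<subseteq>
      (\<Union>v\<in>A. (\<lambda>a. Poly_Mapping.single v 1 + a) ` ?B)"
  proof
    fix a :: "'v \<Rightarrow>\<^sub>0 nat"
    assume a: "a \<in> {a. Poly_Mapping.keys a \<subseteq> A \<and> total a = Suc i}"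
    then have "a \<noteq> 0" by auto
    then obtain v where v: "Poly_Mapping.lookup a v \<noteq> 0"
      by (metis lookup_zero poly_mapping_eqI)
    let ?b = "a - Poly_Mapping.single v 1"
    have "total (Poly_Mapping.single v 1 + ?b) = Suc i"
      using a minus_single_add_single[OF v] by simp
    then have "total ?b = i" by simp
    moreover have "Poly_Mapping.keys ?b \<subseteq> A"
      using a by (auto simp: in_keys_iff lookup_minus subset_iff)
    moreover have "v \<in> A" using v a by (auto simp: in_keys_iff)
    ultimately show "a \<in> (\<Union>v\<in>A. (\<lambda>a. Poly_Mapping.single v 1 + a) ` ?B)"
      using minus_single_add_single[OF v] by (intro UN_I[of v] image_eqI[of _ _ ?b]) auto
  qed
  then show ?case using Suc assms by (auto intro: finite_subset)
qed

section \<open>The generalized Eagon-Northcott complex\<close>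

text \<open>
  Exponents are compared with \<open>single l 1\<close> throughout, so this numeral should keep its form.
\<close>

declare One_nat_def [simp del]

lemma finite_gens_en_module: "finite (gens (en_module m n i))"
proof (rule finite_subset)
  show "gens (en_module m n i) \<subseteq>
      Pow {1..n} \<times> {a. Poly_Mapping.keys a \<subseteq> {1..m} \<and> total a = i}"
    by (auto simp: en_module_def)
  show "finite (Pow {1..n} \<times> {a :: nat \<Rightarrow>\<^sub>0 nat. Poly_Mapping.keys a \<subseteq> {1..m} \<and> total a = i})"
    by (intro finite_cartesian_product finite_exponents) simp_all
qed

definition gen_en_module :: "nat \<Rightarrow> nat \<Rightarrow> nat set set \<Rightarrow> nat \<Rightarrow> en_index graded_free" where
  "gen_en_module m n \<Delta> i = (en_module m n i)\<lparr>gens := {b \<in> gens (en_module m n i). fst b \<in> \<Delta>}\<rparr>"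

lemma modl_gen_en: "modl (generalized_eagon_northcott m n \<Delta>) = gen_en_module m n \<Delta>"
  by (simp add: generalized_eagon_northcott_def restrict_gens_def eagon_northcott_def
      gen_en_module_def fun_eq_iff)

lemma diff_gen_en: "diff (generalized_eagon_northcott m n \<Delta>) i = en_diff m"
  by (simp add: generalized_eagon_northcott_def restrict_gens_def eagon_northcott_def
      linear_extension_def fun_eq_iff)

lemma gens_gen_en:
  "gens (gen_en_module m n \<Delta> i) =
    {(\<sigma>, a). \<sigma> \<in> \<Delta> \<and> \<sigma> \<subseteq> {1..n} \<and> card \<sigma> = m + i \<and> Poly_Mapping.keys a \<subseteq> {1..m} \<and> total a = i}"
  by (auto simp: gen_en_module_def en_module_def)

lemma gdeg_gen_en: "gdeg (gen_en_module m n \<Delta> i) b = int (m + i)"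
  by (simp add: gen_en_module_def en_module_def)

lemma gen_en_keys:
  assumes "x \<in> elems m n (gen_en_module m n \<Delta> i)"
  shows "\<forall>b\<in>Poly_Mapping.keys x. fst b \<subseteq> {1..n}"
  using assms unfolding elems_def gens_gen_en by fastforce

lemma en_boundary_graded_piece:
  assumes down: "\<And>\<sigma> j. \<sigma> \<in> \<Delta> \<Longrightarrow> \<sigma> - {j} \<in> \<Delta>"
    and b: "b \<in> gens (gen_en_module m n \<Delta> (Suc i))"
  shows "(en_boundary m b :: (en_index, 'k::field) elem) \<in>
    graded_piece m n (gen_en_module m n \<Delta> i) (int (m + Suc i))"
proof -
  let ?G = "gen_en_module m n \<Delta>"
  obtain \<sigma> a where b_eq: "b = (\<sigma>, a)" by fastforce
  from b have \<sigma>: "\<sigma> \<in> \<Delta>" "\<sigma> \<subseteq> {1..n}" "card \<sigma> = m + Suc i"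
    and a: "Poly_Mapping.keys a \<subseteq> {1..m}" "total a = Suc i"
    by (auto simp: b_eq gens_gen_en)
  have fin: "finite \<sigma>" using \<sigma>(2) finite_subset by blast
  have "(smul (col_sign j \<sigma> * xvar l j) (basis_elem (\<sigma> - {j}, a - Poly_Mapping.single l 1))
      :: (en_index, 'k) elem) \<in> graded_piece m n (?G i) (int (m + Suc i))"
    if j: "j \<in> \<sigma>" and l: "l \<in> {1..m}" "Poly_Mapping.lookup a l \<noteq> 0" for j l
  proof -
    let ?a = "a - Poly_Mapping.single l 1"
    have "total (Poly_Mapping.single l 1 + ?a) = Suc i"
      using a(2) minus_single_add_single[OF l(2)] by simp
    then have "total ?a = i" by (simp add: One_nat_def)
    moreover have "Poly_Mapping.keys ?a \<subseteq> {1..m}"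
      using a(1) by (auto simp: in_keys_iff lookup_minus subset_iff)
    moreover have "card (\<sigma> - {j}) = m + i" using \<sigma>(3) j fin by simp
    ultimately have "(\<sigma> - {j}, ?a) \<in> gens (?G i)"
      using \<sigma> down by (auto simp: gens_gen_en)
    then have "(basis_elem (\<sigma> - {j}, ?a) :: (en_index, 'k) elem) \<in> graded_piece m n (?G i) (int (m + i))"
      by (intro basis_elem_graded_piece) (simp_all add: gdeg_gen_en)
    moreover have "(col_sign j \<sigma> * xvar l j :: 'k poly_x) \<in> polyring m n"
      using l j \<sigma>(2) by (auto intro!: polyring_mult polyring_xvar simp: col_sign_def polyring_sign)
    moreover have "homogeneous 1 (col_sign j \<sigma> * xvar l j :: 'k poly_x)"
      using homogeneous_mult[OF homogeneous_sign homogeneous_xvar] by (simp add: col_sign_def)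
    ultimately have "(smul (col_sign j \<sigma> * xvar l j) (basis_elem (\<sigma> - {j}, ?a))
        :: (en_index, 'k) elem) \<in> graded_piece m n (?G i) (1 + int (m + i))"
      by (intro graded_piece_smul)
    then show ?thesis by (simp add: algebra_simps)
  qed
  then show ?thesis
    unfolding b_eq en_boundary_eq[OF fin] by (intro graded_piece_sum) (simp del: of_nat_add)
qed

lemma gen_en_complex:
  assumes down: "\<And>\<sigma> j. \<sigma> \<in> \<Delta> \<Longrightarrow> \<sigma> - {j} \<in> \<Delta>"
  shows "graded_free_complex m n (generalized_eagon_northcott m n \<Delta> :: (en_index, 'k::field) fcomplex)"
proof -
  let ?C = "generalized_eagon_northcott m n \<Delta> :: (en_index, 'k) fcomplex"
  let ?G = "gen_en_module m n \<Delta>"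
  have fin: "finite (gens (?G i))" for i
    by (rule finite_subset[OF _ finite_gens_en_module[of m n i]]) (auto simp: gen_en_module_def)
  have hom: "graded_hom m n (?G (Suc i)) (?G i) (en_diff m :: (en_index, 'k) elem \<Rightarrow> _)" for i
    by (intro graded_hom_linear_extension) (simp only: gdeg_gen_en en_boundary_graded_piece[OF down])
  have "en_diff m (en_diff m x) = 0" if x: "x \<in> elems m n (?G (Suc (Suc i)))" for i and x :: "(en_index, 'k) elem"
  proof (rule poly_mapping_eqI)
    fix b :: en_index
    obtain \<tau> c where "b = (\<tau>, c)" by fastforce
    then show "Poly_Mapping.lookup (en_diff m (en_diff m x)) b = Poly_Mapping.lookup 0 b"
      using en_diff_en_diff[OF gen_en_keys[OF x] gen_en_keys[OF graded_homD(1)[OF hom x]], of \<tau> c]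
      by simp
  qed
  then show ?thesis
    using fin hom by (simp add: graded_free_complex_def diff_gen_en modl_gen_en)
qed

section \<open>Linear cycles and boundaries\<close>

lemma lookup_xvar_mult_single:
  fixes g :: "'k::field poly_x"
  shows "Poly_Mapping.lookup (xvar l' j * g) (Poly_Mapping.single (l, p) 1) =
    (if j = p \<and> l' = l then Poly_Mapping.lookup g 0 else 0)"
  by (auto simp: lookup_xvar_mult lookup_single when_def)

lemma lookup_xvar_mult_two:
  fixes g :: "'k::field poly_x"
  assumes "p \<noteq> q"
  shows "Poly_Mapping.lookup (xvar h j * g) (Poly_Mapping.single (l, p) 1 + Poly_Mapping.single (l', q) 1) =
    (if j = p \<and> h = l then Poly_Mapping.lookup g (Poly_Mapping.single (l', q) 1) else 0) +
    (if j = q \<and> h = l' then Poly_Mapping.lookup g (Poly_Mapping.single (l, p) 1) else 0)"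
  using assms by (auto simp: lookup_xvar_mult lookup_single when_def lookup_add)

lemma en_diff_linear_coeff:
  fixes f :: "(en_index, 'k::field) elem"
  assumes f: "\<forall>b\<in>Poly_Mapping.keys f. fst b \<subseteq> {1..n}"
  shows "Poly_Mapping.lookup (Poly_Mapping.lookup (en_diff m f) (\<tau>, c)) (Poly_Mapping.single (l, p) 1) =
    (if p \<in> {1..n} - \<tau> \<and> l \<in> {1..m}
     then col_sign p \<tau> * Poly_Mapping.lookup (Poly_Mapping.lookup f (insert p \<tau>, c + Poly_Mapping.single l 1)) 0
     else 0)"
proof -
  have "Poly_Mapping.lookup (Poly_Mapping.lookup (en_diff m f) (\<tau>, c)) (Poly_Mapping.single (l, p) 1) =
    (\<Sum>j\<in>{1..n} - \<tau>. \<Sum>h\<in>{1..m}. if j = p \<and> h = l then col_sign j \<tau> *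
      Poly_Mapping.lookup (Poly_Mapping.lookup f (insert j \<tau>, c + Poly_Mapping.single h 1)) 0 else 0)"
    unfolding lookup_en_diff[OF f] lookup_sum lookup_col_sign_mult lookup_xvar_mult_single
    by (intro sum.cong refl) simp
  then show ?thesis by (simp only: sum_sum_delta finite_Diff finite_atLeastAtMost)
qed

lemma en_diff_quadratic_coeff:
  fixes f :: "(en_index, 'k::field) elem"
  assumes f: "\<forall>b\<in>Poly_Mapping.keys f. fst b \<subseteq> {1..n}" and pq: "p \<noteq> q"
  shows "Poly_Mapping.lookup (Poly_Mapping.lookup (en_diff m f) (\<tau>, c))
      (Poly_Mapping.single (l, p) 1 + Poly_Mapping.single (l', q) 1) =
    (if p \<in> {1..n} - \<tau> \<and> l \<in> {1..m} then col_sign p \<tau> * Poly_Mapping.lookup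
       (Poly_Mapping.lookup f (insert p \<tau>, c + Poly_Mapping.single l 1)) (Poly_Mapping.single (l', q) 1) else 0) +
    (if q \<in> {1..n} - \<tau> \<and> l' \<in> {1..m} then col_sign q \<tau> * Poly_Mapping.lookup
       (Poly_Mapping.lookup f (insert q \<tau>, c + Poly_Mapping.single l' 1)) (Poly_Mapping.single (l, p) 1) else 0)"
proof -
  have "Poly_Mapping.lookup (Poly_Mapping.lookup (en_diff m f) (\<tau>, c))
      (Poly_Mapping.single (l, p) 1 + Poly_Mapping.single (l', q) 1) =
    (\<Sum>j\<in>{1..n} - \<tau>. \<Sum>h\<in>{1..m}. if j = p \<and> h = l then col_sign j \<tau> * Poly_Mapping.lookup
       (Poly_Mapping.lookup f (insert j \<tau>, c + Poly_Mapping.single h 1)) (Poly_Mapping.single (l', q) 1) else 0) +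
    (\<Sum>j\<in>{1..n} - \<tau>. \<Sum>h\<in>{1..m}. if j = q \<and> h = l' then col_sign j \<tau> * Poly_Mapping.lookup
       (Poly_Mapping.lookup f (insert j \<tau>, c + Poly_Mapping.single h 1)) (Poly_Mapping.single (l, p) 1) else 0)"
    unfolding lookup_en_diff[OF f] lookup_sum lookup_col_sign_mult lookup_xvar_mult_two[OF pq]
      sum.distrib[symmetric]
    by (intro sum.cong refl) (simp add: distrib_left)
  then show ?thesis by (simp only: sum_sum_delta finite_Diff finite_atLeastAtMost)
qed

lemma total_eq_1:
  assumes "total t = 1"
  obtains v where "t = Poly_Mapping.single v 1"
proof -
  have "t \<noteq> 0" using assms by auto
  then obtain v where v: "Poly_Mapping.lookup t v \<noteq> 0"
    by (metis lookup_zero poly_mapping_eqI)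
  note t = minus_single_add_single[OF v]
  have "total (Poly_Mapping.single v 1 + (t - Poly_Mapping.single v 1)) = 1"
    using t assms by simp
  then have "t - Poly_Mapping.single v 1 = 0" by (simp add: total_eq_0_iff)
  with t have "t = Poly_Mapping.single v 1" by simp
  then show thesis by (rule that)
qed

lemma linear_form_eqI:
  assumes "homogeneous 1 p" "homogeneous 1 q"
    and "\<And>l j. Poly_Mapping.lookup p (Poly_Mapping.single (l, j) 1) = Poly_Mapping.lookup q (Poly_Mapping.single (l, j) 1)"
  shows "p = q"
proof (rule poly_mapping_eqI)
  fix t
  show "Poly_Mapping.lookup p t = Poly_Mapping.lookup q t"
  proof (cases "total t = 1")
    case True
    then obtain v where "t = Poly_Mapping.single v 1" by (rule total_eq_1)
    then show ?thesis using assms(3) by (cases v) simp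
  next
    case False
    then have "Poly_Mapping.lookup p t = 0" "Poly_Mapping.lookup q t = 0"
      using assms(1,2) by (auto simp: homogeneous_iff)
    then show ?thesis by simp
  qed
qed

lemma polyring_linear_coeff:
  assumes "y \<in> polyring m n" "(l, p) \<notin> {1..m} \<times> {1..n}"
  shows "Poly_Mapping.lookup y (Poly_Mapping.single (l, p) 1) = 0"
proof (rule ccontr)
  assume "\<not> ?thesis"
  then have "Poly_Mapping.single (l, p) 1 \<in> Poly_Mapping.keys y" by (simp add: in_keys_iff)
  then have "Poly_Mapping.keys (Poly_Mapping.single (l, p) (1::nat)) \<subseteq> {1..m} \<times> {1..n}"
    using assms(1) unfolding polyring_def by blast
  then show False using assms(2) by simp
qed

abbreviation lin_coeff :: "(en_index, 'k::field) elem \<Rightarrow> nat set \<Rightarrow> (nat \<Rightarrow>\<^sub>0 nat) \<Rightarrow> nat \<Rightarrow> nat \<Rightarrow> 'k" where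
  "lin_coeff z \<sigma> a l p \<equiv> Poly_Mapping.lookup (Poly_Mapping.lookup z (\<sigma>, a)) (Poly_Mapping.single (l, p) 1)"

text \<open>
  The only basis element whose boundary contains \<open>x\<^bsub>lp\<^esub> b(\<rho> - {p}; b - e\<^sub>l)\<close> is \<open>b(\<rho>;b)\<close>, so the
  coefficient of \<open>b(\<rho>;b)\<close> in a preimage of \<open>z\<close> is prescribed by any choice of \<open>p\<close> and \<open>l\<close>.  The two
  conditions say that \<open>z\<close> has no other terms and that the choice does not matter.
\<close>

lemma linear_boundary_criterion:
  fixes z :: "(en_index, 'k::field) elem" and C :: "nat set set" and m n :: nat
  defines "G \<equiv> gen_en_module m n (clique_complex m n C)"
  assumes z: "z \<in> graded_piece m n (G i) (int (m + Suc i))"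
    and diag: "\<And>\<sigma> a l p. \<lbrakk>(\<sigma>, a) \<in> gens (G i); l \<in> {1..m}; p \<in> \<sigma>\<rbrakk> \<Longrightarrow> lin_coeff z \<sigma> a l p = 0"
    and const: "\<And>\<rho> b l l' p q. \<lbrakk>\<rho> \<subseteq> {1..n}; card \<rho> = m + Suc i; Poly_Mapping.keys b \<subseteq> {1..m}; total b = Suc i;
        p \<in> \<rho>; q \<in> \<rho>; Poly_Mapping.lookup b l \<noteq> 0; Poly_Mapping.lookup b l' \<noteq> 0\<rbrakk> \<Longrightarrow>
        col_sign p \<rho> * lin_coeff z (\<rho> - {p}) (b - Poly_Mapping.single l 1) l p =
        col_sign q \<rho> * lin_coeff z (\<rho> - {q}) (b - Poly_Mapping.single l' 1) l' q"
  shows "\<exists>w \<in> graded_piece m n (G (Suc i)) (int (m + Suc i)). en_diff m w = z"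
proof -
  let ?E = "gens (en_module m n (Suc i))"
  have gensG: "gens (G j) = {(\<sigma>, a). \<sigma> \<in> clique_complex m n C \<and> \<sigma> \<subseteq> {1..n} \<and> card \<sigma> = m + j \<and>
      Poly_Mapping.keys a \<subseteq> {1..m} \<and> total a = j}" for j
    unfolding G_def by (rule gens_gen_en)
  have gdegG: "gdeg (G j) b = int (m + j)" for j b unfolding G_def by (rule gdeg_gen_en)
  define g where "g = (\<lambda>(\<rho>, b). let p = Min \<rho>; l = Min (Poly_Mapping.keys b) in
      col_sign p \<rho> * lin_coeff z (\<rho> - {p}) (b - Poly_Mapping.single l 1) l p)"
  have E: "?E = {(\<sigma>, a). \<sigma> \<subseteq> {1..n} \<and> card \<sigma> = m + Suc i \<and> Poly_Mapping.keys a \<subseteq> {1..m} \<and> total a = Suc i}"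
    by (simp add: en_module_def)
  have finE: "finite ?E" by (rule finite_gens_en_module)
  have g_eq: "g (\<rho>, b) = col_sign q \<rho> * lin_coeff z (\<rho> - {q}) (b - Poly_Mapping.single l 1) l q"
    if \<rho>: "(\<rho>, b) \<in> ?E" "q \<in> \<rho>" "Poly_Mapping.lookup b l \<noteq> 0" for \<rho> b q l
  proof -
    have "finite \<rho>" using \<rho>(1) finite_subset by (auto simp: E)
    then have "Min \<rho> \<in> \<rho>" using \<rho>(2) by (intro Min_in) auto
    moreover have "Min (Poly_Mapping.keys b) \<in> Poly_Mapping.keys b"
      using \<rho>(3) by (intro Min_in) (auto simp: in_keys_iff)
    ultimately show ?thesis
      unfolding g_def prod.case Let_def using \<rho> by (intro const) (auto simp: E in_keys_iff)
  qed
  \<comment> \<open>A subset all of whose maximal proper subsets are cliques is a clique, as it has more than \<open>m\<close> elements.\<close>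
  have clique: "\<rho> \<in> clique_complex m n C" if \<rho>: "(\<rho>, b) \<in> ?E" and nz: "g (\<rho>, b) \<noteq> 0" for \<rho> b
  proof -
    have "b \<noteq> 0" using \<rho> by (auto simp: E)
    then obtain l where l: "Poly_Mapping.lookup b l \<noteq> 0" by (metis lookup_zero poly_mapping_eqI)
    have facet: "\<rho> - {q} \<in> clique_complex m n C" if "q \<in> \<rho>" for q
    proof (rule ccontr)
      assume "\<rho> - {q} \<notin> clique_complex m n C"
      then have "(\<rho> - {q}, b - Poly_Mapping.single l 1) \<notin> gens (G i)" by (simp add: gensG)
      then have "Poly_Mapping.lookup z (\<rho> - {q}, b - Poly_Mapping.single l 1) = 0"
        using z by (simp add: graded_piece_iff elems_iff)
      then show False using nz g_eq[OF \<rho> that l] by simp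
    qed
    have "\<tau> \<in> C" if \<tau>: "\<tau> \<subseteq> \<rho>" "card \<tau> = m" for \<tau>
    proof -
      have "\<tau> \<noteq> \<rho>" using \<tau> \<rho> by (auto simp: E)
      then obtain q where "q \<in> \<rho>" "q \<notin> \<tau>" using \<tau> by blast
      then show ?thesis using facet[of q] \<tau> by (auto simp: clique_complex_def)
    qed
    then show ?thesis using \<rho> by (auto simp: E clique_complex_def)
  qed
  define w :: "(en_index, 'k) elem" where
    "w = (\<Sum>b\<in>?E. Poly_Mapping.single b (Poly_Mapping.single 0 (g b)))"
  have w: "Poly_Mapping.lookup w b = (if b \<in> ?E then Poly_Mapping.single 0 (g b) else 0)" for b
  proof -
    have "Poly_Mapping.lookup w b = (\<Sum>c\<in>?E. if c = b then Poly_Mapping.single 0 (g b) else 0)"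
      unfolding w_def lookup_sum lookup_single by (intro sum.cong) (auto simp: when_def)
    then show ?thesis using finE by simp
  qed
  have wG: "w \<in> graded_piece m n (G (Suc i)) (int (m + Suc i))"
    unfolding graded_piece_iff elems_iff
  proof (intro conjI allI impI)
    fix b assume "b \<notin> gens (G (Suc i))"
    then show "Poly_Mapping.lookup w b = 0"
      using clique[of "fst b" "snd b"] by (cases "g b = 0") (auto simp: w gensG E)
  qed (auto simp: w gdegG)
  have keys_w: "\<forall>b\<in>Poly_Mapping.keys w. fst b \<subseteq> {1..n}"
  proof
    fix b assume "b \<in> Poly_Mapping.keys w"
    then have "b \<in> ?E" by (simp add: in_keys_iff w split: if_splits)
    then show "fst b \<subseteq> {1..n}" by (cases b) (simp add: E)
  qed
  have down: "\<sigma> - {j} \<in> clique_complex m n C" if "\<sigma> \<in> clique_complex m n C" for \<sigma> j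
    using that by (auto simp: clique_complex_def)
  have dwG: "en_diff m w \<in> graded_piece m n (G i) (int (m + Suc i))"
  proof (rule graded_homD(4)[OF _ wG])
    show "graded_hom m n (G (Suc i)) (G i) (en_diff m)"
      using gen_en_complex[of "clique_complex m n C" m n, OF down]
      unfolding graded_free_complex_def G_def diff_gen_en modl_gen_en by blast
  qed
  have "Poly_Mapping.lookup (en_diff m w) (\<tau>, c) = Poly_Mapping.lookup z (\<tau>, c)" for \<tau> c
  proof (cases "(\<tau>, c) \<in> gens (G i)")
    case True
    then have \<tau>: "\<tau> \<subseteq> {1..n}" "card \<tau> = m + i" "finite \<tau>" and c: "Poly_Mapping.keys c \<subseteq> {1..m}" "total c = i"
      by (auto simp: gensG finite_subset)
    have hom: "homogeneous 1 (Poly_Mapping.lookup y (\<tau>, c))"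
      if "y \<in> graded_piece m n (G i) (int (m + Suc i))" for y :: "(en_index, 'k) elem"
      using that by (auto simp: graded_piece_iff gdegG)
    show ?thesis
    proof (rule linear_form_eqI[OF hom[OF dwG] hom[OF z]])
      fix l p
      show "lin_coeff (en_diff m w) \<tau> c l p = lin_coeff z \<tau> c l p"
      proof (cases "p \<in> {1..n} \<and> l \<in> {1..m}")
        case pl: True
        show ?thesis
        proof (cases "p \<in> \<tau>")
          case True
          then show ?thesis
            using diag[OF \<open>(\<tau>, c) \<in> gens (G i)\<close>, of l p] pl by (simp add: en_diff_linear_coeff[OF keys_w])
        next
          case False
          have "Poly_Mapping.keys (c + Poly_Mapping.single l 1) \<subseteq> {1..m}"
            using c pl keys_add[of c "Poly_Mapping.single l 1"] by auto
          then have "(insert p \<tau>, c + Poly_Mapping.single l 1) \<in> ?E"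
            using pl \<tau> c False by (auto simp: E)
          moreover from g_eq[OF this, of p l]
          have "g (insert p \<tau>, c + Poly_Mapping.single l 1) = col_sign p \<tau> * lin_coeff z \<tau> c l p"
            using False by (simp add: lookup_add col_sign_insert_greater)
          ultimately show ?thesis
            using pl False by (simp add: en_diff_linear_coeff[OF keys_w] w)
        qed
      next
        case False
        have "Poly_Mapping.lookup z (\<tau>, c) \<in> polyring m n"
          using z by (simp add: graded_piece_iff elems_iff)
        then have "lin_coeff z \<tau> c l p = 0" using False by (intro polyring_linear_coeff) auto
        then show ?thesis using False by (auto simp: en_diff_linear_coeff[OF keys_w])
      qed
    qed
  next
    case False
    then show ?thesis using z dwG by (simp add: graded_piece_iff elems_iff)
  qed
  then have "Poly_Mapping.lookup (en_diff m w) b = Poly_Mapping.lookup z b" for b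
    by (cases b) simp
  then have "en_diff m w = z" by (rule poly_mapping_eqI)
  with wG show ?thesis by blast
qed

text \<open>
  Boundaries of different basis elements have no term in common.
\<close>

lemma en_diff_injective:
  fixes w :: "(en_index, 'k::field) elem"
  assumes w: "w \<in> graded_piece m n (gen_en_module m n \<Delta> (Suc i)) (int (m + Suc i))"
    and d: "en_diff m w = 0"
  shows "w = 0"
proof (rule poly_mapping_eqI)
  let ?G = "gen_en_module m n \<Delta> (Suc i)"
  fix b :: en_index
  show "Poly_Mapping.lookup w b = Poly_Mapping.lookup 0 b"
  proof (cases "b \<in> gens ?G")
    case True
    obtain \<rho> e where b: "b = (\<rho>, e)" by fastforce
    from True have \<rho>: "\<rho> \<subseteq> {1..n}" "card \<rho> = m + Suc i" and e: "Poly_Mapping.keys e \<subseteq> {1..m}" "total e = Suc i"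
      by (auto simp: b gens_gen_en)
    have "\<rho> \<noteq> {}" using \<rho>(2) by auto
    then obtain p where p: "p \<in> \<rho>" by blast
    have "e \<noteq> 0" using e by auto
    then obtain l where l: "Poly_Mapping.lookup e l \<noteq> 0" by (metis lookup_zero poly_mapping_eqI)
    have eq: "insert p (\<rho> - {p}) = \<rho>" "e - Poly_Mapping.single l 1 + Poly_Mapping.single l 1 = e"
      using p minus_single_add_single[OF l] by (auto simp: add.commute)
    have "l \<in> {1..m}" using l e(1) by (meson in_keys_iff subsetD)
    moreover have "p \<in> {1..n} - (\<rho> - {p})" using p \<rho>(1) by auto
    ultimately have "Poly_Mapping.lookup (Poly_Mapping.lookup w b) 0 = 0"
      using en_diff_linear_coeff[OF gen_en_keys[OF graded_piece_elems[OF w]], of m "\<rho> - {p}"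
          "e - Poly_Mapping.single l 1" l p, unfolded eq d]
      by (simp only: b) simp
    moreover have "homogeneous 0 (Poly_Mapping.lookup w b)"
      using w unfolding graded_piece_iff gdeg_gen_en by (cases b) simp
    ultimately show ?thesis by (simp add: homogeneous_nonpos_no_constant)
  next
    case False
    then show ?thesis using w by (cases b) (simp add: graded_piece_iff elems_iff)
  qed
qed

lemma ex_third:
  assumes "card A \<ge> 3"
  obtains r where "r \<in> A" "r \<noteq> p" "r \<noteq> q"
proof -
  have "card {p, q} \<le> 2" by (cases "p = q") auto
  then have "\<not> A \<subseteq> {p, q}" using assms card_mono[of "{p, q}" A] by auto
  then show thesis using that by blast
qed

text \<open>
  For \<open>p \<noteq> q\<close> the coefficient of \<open>x\<^bsub>lp\<^esub> x\<^bsub>l'q\<^esub> b(\<tau>;c)\<close> in the boundary of \<open>z\<close> involves only two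
  coefficients of \<open>z\<close>: that of \<open>x\<^bsub>l'q\<^esub> b(\<tau> \<union> {p}; c + e\<^sub>l)\<close> and that of \<open>x\<^bsub>lp\<^esub> b(\<tau> \<union> {q}; c + e\<^bsub>l'\<^esub>)\<close>.  If
  \<open>p \<in> \<tau>\<close>, only the second one is there, and it vanishes.  Otherwise the two agree up to sign.  The
  general comparison of \<open>(p, l)\<close> with \<open>(q, l')\<close> is a chain of such steps; it exists because \<open>\<rho>\<close> has at
  least three elements and \<open>b\<close> has degree at least 2.
\<close>

lemma higher_linear_cycle:
  fixes z :: "(en_index, 'k::field) elem" and m n :: nat
  assumes m: "m \<ge> 1" and z: "z \<in> elems m n (gen_en_module m n \<Delta> (Suc i))" and cyc: "en_diff m z = 0"
  shows higher_linear_cycle_diag: "\<And>\<sigma> a l p. \<lbrakk>(\<sigma>, a) \<in> gens (gen_en_module m n \<Delta> (Suc i)); l \<in> {1..m}; p \<in> \<sigma>\<rbrakk> \<Longrightarrow>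
      lin_coeff z \<sigma> a l p = 0"
    and higher_linear_cycle_const: "\<And>\<rho> b l l' p q. \<lbrakk>\<rho> \<subseteq> {1..n}; card \<rho> = m + Suc (Suc i); Poly_Mapping.keys b \<subseteq> {1..m};
        total b = Suc (Suc i); p \<in> \<rho>; q \<in> \<rho>; Poly_Mapping.lookup b l \<noteq> 0; Poly_Mapping.lookup b l' \<noteq> 0\<rbrakk> \<Longrightarrow>
        col_sign p \<rho> * lin_coeff z (\<rho> - {p}) (b - Poly_Mapping.single l 1) l p =
        col_sign q \<rho> * lin_coeff z (\<rho> - {q}) (b - Poly_Mapping.single l' 1) l' q"
proof -
  have quad: "(if p \<in> {1..n} - \<tau> \<and> l \<in> {1..m} then col_sign p \<tau> * lin_coeff z (insert p \<tau>) (c + Poly_Mapping.single l 1) l' q else 0) +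
    (if q \<in> {1..n} - \<tau> \<and> l' \<in> {1..m} then col_sign q \<tau> * lin_coeff z (insert q \<tau>) (c + Poly_Mapping.single l' 1) l p else 0) = 0"
    if "p \<noteq> q" for p q l l' \<tau> c
    using en_diff_quadratic_coeff[OF gen_en_keys[OF z] that, of m \<tau> c l l'] by (simp only: cyc) simp
  {
    fix \<sigma> a l p
    assume "(\<sigma>, a) \<in> gens (gen_en_module m n \<Delta> (Suc i))" and l: "l \<in> {1..m}" and p: "p \<in> \<sigma>"
    then have \<sigma>: "\<sigma> \<subseteq> {1..n}" "card \<sigma> = m + Suc i" and a: "Poly_Mapping.keys a \<subseteq> {1..m}" "total a = Suc i"
      by (auto simp: gens_gen_en)
    have "a \<noteq> 0" using a by auto
    then obtain l' where l': "Poly_Mapping.lookup a l' \<noteq> 0" by (metis lookup_zero poly_mapping_eqI)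
    then have l'm: "l' \<in> {1..m}" using a(1) by (meson in_keys_iff subsetD)
    have "\<not> \<sigma> \<subseteq> {p}" using \<sigma>(2) m card_mono[of "{p}" \<sigma>] by auto
    then obtain q where q: "q \<in> \<sigma>" "q \<noteq> p" by blast
    have eq: "insert q (\<sigma> - {q}) = \<sigma>" "a - Poly_Mapping.single l' 1 + Poly_Mapping.single l' 1 = a"
      using q minus_single_add_single[OF l'] by (auto simp: add.commute)
    have "(p \<in> {1..n} - (\<sigma> - {q}) \<and> l \<in> {1..m}) = False"
      "(q \<in> {1..n} - (\<sigma> - {q}) \<and> l' \<in> {1..m}) = True" using p q \<sigma>(1) l'm by auto
    from quad[OF q(2)[symmetric], of "\<sigma> - {q}" l "a - Poly_Mapping.single l' 1" l', unfolded eq this if_True if_False]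
    have "col_sign q (\<sigma> - {q}) * lin_coeff z \<sigma> a l p = 0" by (simp only: add_0)
    then show "lin_coeff z \<sigma> a l p = 0" by simp
  next
    fix \<rho> b l0 l0' p0 q0
    assume \<rho>: "\<rho> \<subseteq> {1..n}" "card \<rho> = m + Suc (Suc i)" and b: "Poly_Mapping.keys b \<subseteq> {1..m}" "total b = Suc (Suc i)"
      and p0: "p0 \<in> \<rho>" and q0: "q0 \<in> \<rho>" and l0: "Poly_Mapping.lookup b l0 \<noteq> 0" and l0': "Poly_Mapping.lookup b l0' \<noteq> 0"
    define H where "H p l = col_sign p \<rho> * lin_coeff z (\<rho> - {p}) (b - Poly_Mapping.single l 1) l p" for p l
    \<comment> \<open>The coefficient of \<open>x\<^bsub>lp\<^esub> x\<^bsub>l'q\<^esub>\<close> at \<open>\<rho> - {p, q}\<close>.\<close>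
    have step: "H p l = H q l'"
      if pq: "p \<in> \<rho>" "q \<in> \<rho>" "p \<noteq> q" and l: "Poly_Mapping.lookup b l \<noteq> 0"
        and l': "Poly_Mapping.lookup (b - Poly_Mapping.single l 1) l' \<noteq> 0" for p q l l'
    proof -
      let ?\<tau> = "\<rho> - {p, q}" and ?c = "b - Poly_Mapping.single l 1 - Poly_Mapping.single l' 1"
      have lm: "l \<in> {1..m}" using l b(1) by (meson in_keys_iff subsetD)
      have "Poly_Mapping.lookup b l' \<noteq> 0" using l' by (auto simp: lookup_minus)
      then have l'm: "l' \<in> {1..m}" using b(1) by (meson in_keys_iff subsetD)
      have ins: "insert p ?\<tau> = \<rho> - {q}" "insert q ?\<tau> = \<rho> - {p}" using pq by auto
      have c: "?c + Poly_Mapping.single l 1 = b - Poly_Mapping.single l' 1"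
        "?c + Poly_Mapping.single l' 1 = b - Poly_Mapping.single l 1"
        using l l' by (auto intro!: poly_mapping_eqI simp: lookup_add lookup_minus lookup_single when_def split: if_splits)
      have in1: "p \<in> {1..n} - ?\<tau>" "q \<in> {1..n} - ?\<tau>" using pq \<rho>(1) by auto
      define A B P Q :: 'k where "A = col_sign p ?\<tau>" and "B = col_sign q ?\<tau>"
        and "P = col_sign p \<rho>" and "Q = col_sign q \<rho>"
      define Zp Zq where "Zp = lin_coeff z (\<rho> - {p}) (b - Poly_Mapping.single l 1) l p"
        and "Zq = lin_coeff z (\<rho> - {q}) (b - Poly_Mapping.single l' 1) l' q"
      have rel: "A * Zq + B * Zp = 0"
        using quad[OF pq(3), of ?\<tau> l ?c l', unfolded ins c] in1 lm l'm
        unfolding A_def B_def Zp_def Zq_def by (simp only: simp_thms if_True)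
      have "finite \<rho>" using \<rho>(1) by (rule finite_subset) simp
      then have sgn: "A * Q = - (B * P)"
        using col_sign_exchange[of p q ?\<tau>, where ?'a = 'k] pq(3)
        unfolding A_def B_def P_def Q_def ins by simp
      have "Q * Zq = (A * A) * (Q * Zq)" by (simp add: A_def)
      also have "\<dots> = (A * Q) * (A * Zq)" by (simp only: ac_simps)
      also have "A * Zq = - (B * Zp)" using rel by (simp add: eq_neg_iff_add_eq_0)
      also have "(A * Q) * - (B * Zp) = (B * B) * (P * Zp)" unfolding sgn by (simp add: ac_simps)
      also have "\<dots> = P * Zp" by (simp add: B_def)
      finally show ?thesis by (simp add: H_def P_def Q_def Zp_def Zq_def)
    qed
    have other: "Poly_Mapping.lookup (b - Poly_Mapping.single l 1) l' \<noteq> 0"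
      if "l \<noteq> l'" "Poly_Mapping.lookup b l' \<noteq> 0" for l l'
      using that by (simp add: lookup_minus lookup_single)
    have card3: "card \<rho> \<ge> 3" using \<rho>(2) m by simp
    have "H p0 l0 = H q0 l0'"
    proof (cases "p0 = q0")
      case True
      show ?thesis
      proof (cases "l0 = l0'")
        case False
        obtain q where q: "q \<in> \<rho>" "q \<noteq> p0" using ex_third[OF card3, of p0 p0] by blast
        obtain r where r: "r \<in> \<rho>" "r \<noteq> p0" "r \<noteq> q" using ex_third[OF card3, of p0 q] by blast
        have "H p0 l0 = H q l0'" using p0 q l0 l0' False by (intro step other) auto
        also have "\<dots> = H r l0" using q r l0 l0' False by (intro step other) auto
        also have "\<dots> = H p0 l0'" using p0 r l0 l0' False by (intro step other) auto
        finally show ?thesis using True by simp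
      qed (simp add: True)
    next
      case pq: False
      show ?thesis
      proof (cases "Poly_Mapping.lookup (b - Poly_Mapping.single l0 1) l0' = 0")
        case True
        have "b - Poly_Mapping.single l0 1 \<noteq> 0"
        proof
          assume "b - Poly_Mapping.single l0 1 = 0"
          then have "b = Poly_Mapping.single l0 1" using minus_single_add_single[OF l0] by simp
          then show False using b(2) by (simp add: One_nat_def)
        qed
        then obtain h where h: "Poly_Mapping.lookup (b - Poly_Mapping.single l0 1) h \<noteq> 0"
          by (metis lookup_zero poly_mapping_eqI)
        then have hb: "Poly_Mapping.lookup b h \<noteq> 0" and hl: "h \<noteq> l0'"
          using True by (auto simp: lookup_minus)
        obtain r where r: "r \<in> \<rho>" "r \<noteq> p0" "r \<noteq> q0" using ex_third[OF card3] by blast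
        have "H p0 l0 = H r h" using p0 r l0 h by (intro step) auto
        also have "\<dots> = H q0 l0'" using q0 r hb hl l0' by (intro step other) auto
        finally show ?thesis .
      qed (use p0 q0 pq l0 in \<open>blast intro: step\<close>)
    qed
    then show "col_sign p0 \<rho> * lin_coeff z (\<rho> - {p0}) (b - Poly_Mapping.single l0 1) l0 p0 =
        col_sign q0 \<rho> * lin_coeff z (\<rho> - {q0}) (b - Poly_Mapping.single l0' 1) l0' q0"
      by (simp add: H_def)
  }
qed

section \<open>Maximal minors\<close>

lemma permutes_less: "\<lbrakk>\<pi> permutes {0..<m}; i < m\<rbrakk> \<Longrightarrow> \<pi> i < (m::nat)"
  using permutes_in_image[of \<pi> "{0..<m}" i] by simp

lemma prod_single_one:
  "finite A \<Longrightarrow> (\<Prod>i\<in>A. Poly_Mapping.single (f i) 1) = (Poly_Mapping.single (\<Sum>i\<in>A. f i) 1 :: 'k::field poly_x)"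
  by (induction A rule: finite_induct) (simp_all add: mult_single)

text \<open>
  The term of the minor that belongs to the permutation \<open>\<pi>\<close>.
\<close>

definition diagonal_monomial :: "nat \<Rightarrow> nat set \<Rightarrow> (nat \<Rightarrow> nat) \<Rightarrow> (nat \<times> nat) \<Rightarrow>\<^sub>0 nat" where
  "diagonal_monomial m \<sigma> \<pi> = (\<Sum>i<m. Poly_Mapping.single (Suc i, sorted_list_of_set \<sigma> ! \<pi> i) 1)"

lemma max_minor_expand:
  "max_minor m \<sigma> = (\<Sum>\<pi>\<in>{\<pi>. \<pi> permutes {0..<m}}.
    of_int (sign \<pi>) * Poly_Mapping.single (diagonal_monomial m \<sigma> \<pi>) (1::'k::field))"
proof -
  have "max_minor m \<sigma> = (\<Sum>\<pi>\<in>{\<pi>. \<pi> permutes {0..<m}}. of_int (sign \<pi>) *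
      (\<Prod>i = 0..<m. xvar (Suc i) (sorted_list_of_set \<sigma> ! \<pi> i) :: 'k poly_x))"
    unfolding max_minor_def
    by (subst det_def'[of _ m]) (auto intro!: sum.cong prod.cong arg_cong2[where f = "(*)"] simp: permutes_less)
  also have "\<dots> = (\<Sum>\<pi>\<in>{\<pi>. \<pi> permutes {0..<m}}.
      of_int (sign \<pi>) * Poly_Mapping.single (diagonal_monomial m \<sigma> \<pi>) 1)"
    by (simp add: xvar_def prod_single_one diagonal_monomial_def atLeast0LessThan)
  finally show ?thesis .
qed

lemma lookup_diagonal_monomial:
  "Poly_Mapping.lookup (diagonal_monomial m \<sigma> \<pi>) (l, j) =
    (if l \<in> {1..m} \<and> sorted_list_of_set \<sigma> ! \<pi> (l - 1) = j then 1 else 0)"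
proof (cases l)
  case 0
  then show ?thesis by (simp add: diagonal_monomial_def lookup_sum lookup_single)
next
  case (Suc k)
  have "Poly_Mapping.lookup (diagonal_monomial m \<sigma> \<pi>) (l, j) =
      (\<Sum>i<m. if i = k then (if sorted_list_of_set \<sigma> ! \<pi> k = j then 1 else 0) else 0)"
    unfolding diagonal_monomial_def lookup_sum lookup_single Suc
    by (intro sum.cong refl) (simp add: when_def)
  then show ?thesis by (simp add: Suc Suc_le_eq)
qed

lemma lookup_sign_mult:
  fixes p :: "'k::field poly_x"
  shows "Poly_Mapping.lookup (of_int (sign \<pi>) * p) t = of_int (sign \<pi>) * Poly_Mapping.lookup p t"
  by (cases "evenperm \<pi>") (simp_all add: sign_def)

lemma bij_betw_permuted_columns:
  fixes \<sigma> :: "nat set"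
  assumes "\<sigma> \<subseteq> {1..n}" "card \<sigma> = m" "\<pi> permutes {0..<m}"
  shows "bij_betw (\<lambda>l. sorted_list_of_set \<sigma> ! \<pi> (l - 1)) {1..m} \<sigma>"
proof -
  have "finite \<sigma>" using assms(1) by (rule finite_subset) simp
  then have 1: "bij_betw ((!) (sorted_list_of_set \<sigma>)) {0..<m} \<sigma>"
    using bij_betw_nth_sorted_list[of \<sigma>] assms by (simp add: atLeast0LessThan)
  have 2: "bij_betw \<pi> {0..<m} {0..<m}" using assms by (simp add: permutes_imp_bij)
  have 3: "bij_betw (\<lambda>l. l - 1) {1..m} {0..<m}"
    by (rule bij_betw_byWitness[where f' = Suc]) (auto simp: One_nat_def)
  show ?thesis using bij_betw_trans[OF bij_betw_trans[OF 3 2] 1] by (simp add: comp_def)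
qed

text \<open>
  The monomials of a minor are the products of one variable from each row and each column.
\<close>

lemma max_minor_support:
  assumes \<sigma>: "\<sigma> \<subseteq> {1..n}" "card \<sigma> = m" and t: "Poly_Mapping.lookup (max_minor m \<sigma> :: 'k::field poly_x) t \<noteq> 0"
  obtains f where "bij_betw f {1..m} \<sigma>"
    "\<And>l j. Poly_Mapping.lookup t (l, j) = (if l \<in> {1..m} \<and> f l = j then 1 else 0)"
proof -
  have "(\<Sum>\<pi>\<in>{\<pi>. \<pi> permutes {0..<m}}. Poly_Mapping.lookup
      (of_int (sign \<pi>) * Poly_Mapping.single (diagonal_monomial m \<sigma> \<pi>) (1::'k)) t) \<noteq> 0"
    using t unfolding max_minor_expand lookup_sum .
  then obtain \<pi> where \<pi>: "\<pi> permutes {0..<m}"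
    "Poly_Mapping.lookup (of_int (sign \<pi>) * Poly_Mapping.single (diagonal_monomial m \<sigma> \<pi>) (1::'k)) t \<noteq> 0"
    by (metis (no_types, lifting) mem_Collect_eq sum.neutral)
  from \<pi>(2) have t_eq: "t = diagonal_monomial m \<sigma> \<pi>"
    by (auto simp: lookup_sign_mult lookup_single when_def split: if_splits)
  show thesis
    by (rule that[OF bij_betw_permuted_columns[OF \<sigma> \<pi>(1)]]) (simp add: t_eq lookup_diagonal_monomial)
qed

text \<open>
  Different permutations give different monomials, so no term of a minor is cancelled; a
  transposition provides a term that contains a given variable.
\<close>

lemma max_minor_monomial:
  assumes \<sigma>: "\<sigma> \<subseteq> {1..n}" "card \<sigma> = m" and l: "l \<in> {1..m}" and q: "q \<in> \<sigma>"
  obtains t where "Poly_Mapping.lookup (max_minor m \<sigma> :: 'k::field poly_x) t \<noteq> 0"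
    "Poly_Mapping.lookup t (l, q) \<noteq> 0"
proof -
  let ?xs = "sorted_list_of_set \<sigma>"
  have fin: "finite \<sigma>" using \<sigma>(1) by (rule finite_subset) simp
  have bij: "bij_betw ((!) ?xs) {..<m} \<sigma>" using bij_betw_nth_sorted_list[OF fin] \<sigma> by simp
  then have "q \<in> (!) ?xs ` {..<m}" using q by (simp add: bij_betw_def)
  then obtain k where k: "k < m" "?xs ! k = q" by blast
  define \<pi> where "\<pi> = transpose (l - 1) k"
  have \<pi>: "\<pi> permutes {0..<m}" unfolding \<pi>_def using l k by (intro permutes_swap_id) auto
  have inj: "\<pi>' = \<pi>" if "\<pi>' permutes {0..<m}" and eq: "diagonal_monomial m \<sigma> \<pi>' = diagonal_monomial m \<sigma> \<pi>" for \<pi>'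
  proof
    fix i
    show "\<pi>' i = \<pi> i"
    proof (cases "i < m")
      case True
      have "Poly_Mapping.lookup (diagonal_monomial m \<sigma> \<pi>') (Suc i, ?xs ! \<pi> i) = 1"
        unfolding eq using True by (simp add: lookup_diagonal_monomial)
      then have "?xs ! \<pi>' i = ?xs ! \<pi> i"
        by (simp add: lookup_diagonal_monomial split: if_splits)
      moreover have "\<pi>' i < m" "\<pi> i < m" using True \<pi> that(1) by (simp_all add: permutes_less)
      ultimately show ?thesis using bij unfolding bij_betw_def inj_on_def by simp
    next
      case False
      then show ?thesis using \<pi> that(1) by (simp add: permutes_def)
    qed
  qed
  let ?t = "diagonal_monomial m \<sigma> \<pi>"
  have "Poly_Mapping.lookup (max_minor m \<sigma> :: 'k poly_x) ?t =
      (\<Sum>\<pi>'\<in>{\<pi>'. \<pi>' permutes {0..<m}}. if \<pi>' = \<pi> then of_int (sign \<pi>) else 0)"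
    unfolding max_minor_expand lookup_sum lookup_sign_mult lookup_single
    using inj by (intro sum.cong refl) (auto simp: when_def)
  also have "\<dots> = of_int (sign \<pi>)" using \<pi> by (simp add: finite_permutations)
  finally have "Poly_Mapping.lookup (max_minor m \<sigma> :: 'k poly_x) ?t \<noteq> 0" by (simp add: sign_def)
  moreover have "Poly_Mapping.lookup ?t (l, q) \<noteq> 0"
    using l k by (simp add: lookup_diagonal_monomial \<pi>_def)
  ultimately show thesis by (rule that)
qed

lemma max_minor_polyring:
  assumes \<sigma>: "\<sigma> \<subseteq> {1..n}" "card \<sigma> = m"
  shows "max_minor m \<sigma> \<in> polyring m n"
  unfolding polyring_def
proof (intro CollectI ballI subrelI)
  fix t l j assume t: "t \<in> Poly_Mapping.keys (max_minor m \<sigma> :: 'a poly_x)" and lj: "(l, j) \<in> Poly_Mapping.keys t"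
  obtain f where f: "bij_betw f {1..m} \<sigma>"
    "\<And>l j. Poly_Mapping.lookup t (l, j) = (if l \<in> {1..m} \<and> f l = j then 1 else 0)"
    using t max_minor_support[OF \<sigma>] by (metis in_keys_iff)
  have "l \<in> {1..m}" "f l = j" using lj f(2)[of l j] by (auto simp: in_keys_iff split: if_splits)
  moreover have "f l \<in> \<sigma>" using f(1) calculation by (auto simp: bij_betw_def)
  ultimately show "(l, j) \<in> {1..m} \<times> {1..n}" using \<sigma>(1) by auto
qed

lemma homogeneous_max_minor: "homogeneous (int m) (max_minor m \<sigma>)"
proof -
  have "total (diagonal_monomial m \<sigma> \<pi>) = m" for \<pi>
  proof -
    have "total (\<Sum>i\<in>A. Poly_Mapping.single (f i) 1) = card A" if "finite A" for f :: "nat \<Rightarrow> nat \<times> nat" and A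
      using that by (induction A rule: finite_induct) (simp_all add: One_nat_def)
    then show ?thesis by (simp add: diagonal_monomial_def)
  qed
  then show ?thesis
    unfolding max_minor_expand
    by (intro homogeneous_sum)
       (auto simp: homogeneous_iff lookup_sign_mult lookup_single when_def split: if_splits)
qed

lemma remove1_nth_nth:
  assumes "distinct xs" "j < length xs" "k < length xs - 1"
  shows "remove1 (xs ! j) xs ! k = xs ! (if k < j then k else Suc k)"
proof -
  have "xs = take j xs @ xs ! j # drop (Suc j) xs" using assms(2) by (simp add: id_take_nth_drop)
  moreover have "xs ! j \<notin> set (take j xs)"
    using assms by (auto simp: in_set_conv_nth nth_eq_iff_index_eq)
  ultimately have "remove1 (xs ! j) xs = take j xs @ drop (Suc j) xs"
    by (metis remove1.simps(2) remove1_append)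
  then show ?thesis using assms by (auto simp: nth_append)
qed

text \<open>
  Laplace expansion of a determinant with a repeated row.
\<close>

lemma max_minor_syzygy:
  assumes \<rho>: "\<rho> \<subseteq> {1..n}" "card \<rho> = Suc m" and l: "l \<in> {1..m}"
  shows "(\<Sum>j\<in>\<rho>. col_sign j \<rho> * xvar l j * max_minor m (\<rho> - {j})) = (0 :: 'k::field poly_x)"
proof -
  let ?ys = "sorted_list_of_set \<rho>"
  have fin: "finite \<rho>" using \<rho>(1) by (rule finite_subset) simp
  have len: "length ?ys = Suc m" using \<rho> by simp
  define A :: "'k poly_x mat" where
    "A = mat (Suc m) (Suc m) (\<lambda>(i, k). xvar (if i < m then Suc i else l) (?ys ! k))"
  have A: "A \<in> carrier_mat (Suc m) (Suc m)" by (simp add: A_def)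
  have "det A = 0"
    using l by (intro det_identical_rows[OF A, of m "l - 1"]) (auto simp: A_def intro!: eq_vecI)
  then have 0: "(\<Sum>k<Suc m. A $$ (m, k) * cofactor A m k) = 0"
    using laplace_expansion_row[OF A, of m] by simp
  have minor: "det (mat_delete A m k) = max_minor m (\<rho> - {?ys ! k})" if "k < Suc m" for k
  proof -
    have "sorted_list_of_set (\<rho> - {?ys ! k}) = remove1 (?ys ! k) ?ys"
      using fin by (simp add: sorted_list_of_set_remove)
    then have nth: "sorted_list_of_set (\<rho> - {?ys ! k}) ! i = ?ys ! (if i < k then i else Suc i)"
      if "i < m" for i
      using that \<open>k < Suc m\<close> len by (simp add: remove1_nth_nth)
    show ?thesis
      unfolding max_minor_def mat_delete_def using that
      by (intro arg_cong[where f = det] eq_matI) (auto simp: A_def nth)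
  qed
  have "(\<Sum>j\<in>\<rho>. col_sign j \<rho> * xvar l j * max_minor m (\<rho> - {j})) =
      (\<Sum>k<Suc m. col_sign (?ys ! k) \<rho> * xvar l (?ys ! k) * max_minor m (\<rho> - {?ys ! k}) :: 'k poly_x)"
    using sum.reindex_bij_betw[OF bij_betw_nth_sorted_list[OF fin], symmetric] \<rho>(2) by simp
  also have "\<dots> = (\<Sum>k<Suc m. (- 1) ^ m * (A $$ (m, k) * cofactor A m k))"
  proof (intro sum.cong refl)
    fix k assume k: "k \<in> {..<Suc m}"
    then have "col_sign (?ys ! k) \<rho> = ((- 1) ^ k :: 'k poly_x)"
      using card_less_nth_sorted_list[OF fin, of k] \<rho>(2) by (simp add: col_sign_def)
    also have "\<dots> = (- 1) ^ m * (- 1) ^ (m + k)"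
      by (simp add: power_add flip: mult.assoc power_mult_distrib)
    finally have sgn: "col_sign (?ys ! k) \<rho> = ((- 1) ^ m * (- 1) ^ (m + k) :: 'k poly_x)" .
    have Amk: "A $$ (m, k) = xvar l (?ys ! k)" using k by (simp add: A_def)
    have cof: "cofactor A m k = (- 1) ^ (m + k) * max_minor m (\<rho> - {?ys ! k})"
      using k by (simp add: cofactor_def minor)
    show "col_sign (?ys ! k) \<rho> * xvar l (?ys ! k) * max_minor m (\<rho> - {?ys ! k}) =
        (- 1) ^ m * (A $$ (m, k) * cofactor A m k)"
      unfolding sgn Amk cof by (simp only: mult.assoc mult.left_commute)
  qed
  also have "\<dots> = 0" using 0 by (simp flip: sum_distrib_left)
  finally show ?thesis .
qed

section \<open>Linear syzygies of the maximal minors\<close>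

definition en_augmentation :: "nat \<Rightarrow> (en_index, 'k::field) elem \<Rightarrow> 'k poly_x" where
  "en_augmentation m x = (\<Sum>b\<in>Poly_Mapping.keys x. Poly_Mapping.lookup x b * max_minor m (fst b))"

lemma to_ring_module_sum: "to_ring_module (sum f A) = (\<Sum>i\<in>A. to_ring_module (f i))"
proof -
  have "to_ring_module 0 = 0" by simp
  then show ?thesis by (induction A rule: infinite_finite_induct) (simp_all flip: to_ring_module_simps(5))
qed

lemma to_ring_module_en_augmentation:
  "to_ring_module (en_augmentation m x) = linear_extension (\<lambda>b. to_ring_module (max_minor m (fst b))) x"
  by (simp add: en_augmentation_def linear_extension_def to_ring_module_sum)

lemma en_augmentation_add: "en_augmentation m (x + y) = en_augmentation m x + en_augmentation m y"
  using arg_cong[OF linear_extension_add[of "\<lambda>b. to_ring_module (max_minor m (fst b))" x y],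
      of "\<lambda>z. Poly_Mapping.lookup z ()"]
  by (simp flip: to_ring_module_en_augmentation)

lemma en_augmentation_zero [simp]: "en_augmentation m 0 = 0"
  by (simp add: en_augmentation_def)

lemma en_augmentation_sum: "en_augmentation m (sum f A) = (\<Sum>i\<in>A. en_augmentation m (f i))"
  by (induction A rule: infinite_finite_induct) (simp_all add: en_augmentation_add)

lemma en_augmentation_smul: "en_augmentation m (smul s x) = s * en_augmentation m x"
  using arg_cong[OF linear_extension_smul[of "\<lambda>b. to_ring_module (max_minor m (fst b))" s x],
      of "\<lambda>z. Poly_Mapping.lookup z ()"]
  by (simp flip: to_ring_module_en_augmentation)

lemma en_augmentation_basis_elem: "en_augmentation m (basis_elem b) = max_minor m (fst b)"
  by (simp add: en_augmentation_def)

lemma en_augmentation_hom: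
  "graded_hom m n (gen_en_module m n \<Delta> 0) ring_module (\<lambda>x. to_ring_module (en_augmentation m x))"
  unfolding to_ring_module_en_augmentation
  by (rule graded_hom_linear_extension)
     (auto simp: gdeg_gen_en gens_gen_en homogeneous_max_minor intro!: max_minor_polyring)

lemma en_augmentation_expand:
  assumes "x \<in> elems m n (gen_en_module m n \<Delta> 0)"
  shows "en_augmentation m x =
    (\<Sum>\<sigma>\<in>{\<sigma>. \<sigma> \<subseteq> {1..n} \<and> card \<sigma> = m}. Poly_Mapping.lookup x (\<sigma>, 0) * max_minor m \<sigma>)"
proof -
  let ?S = "{\<sigma>. \<sigma> \<subseteq> {1..n} \<and> card \<sigma> = m}"
  have inj: "inj_on (\<lambda>\<sigma>. (\<sigma>, 0 :: nat \<Rightarrow>\<^sub>0 nat)) ?S" by (simp add: inj_on_def)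
  have "Poly_Mapping.keys x \<subseteq> (\<lambda>\<sigma>. (\<sigma>, 0)) ` ?S"
    using assms by (auto simp: elems_def gens_gen_en total_eq_0_iff)
  then have "en_augmentation m x =
      (\<Sum>b\<in>(\<lambda>\<sigma>. (\<sigma>, 0)) ` ?S. Poly_Mapping.lookup x b * max_minor m (fst b))"
    unfolding en_augmentation_def by (intro sum.mono_neutral_left) (auto simp: in_keys_iff)
  then show ?thesis by (simp add: sum.reindex[OF inj])
qed

text \<open>
  An element of total degree 1 is a unit vector \<open>e\<^sub>l\<close>, and the claim is the Laplace relation with the
  \<open>l\<close>-th row repeated.
\<close>

lemma en_augmentation_en_boundary:
  assumes "b \<in> gens (gen_en_module m n \<Delta> 1)"
  shows "en_augmentation m (en_boundary m b) = (0 :: 'k::field poly_x)"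
proof -
  obtain \<rho> a where b: "b = (\<rho>, a)" by fastforce
  from assms have \<rho>: "\<rho> \<subseteq> {1..n}" "card \<rho> = Suc m" and a: "Poly_Mapping.keys a \<subseteq> {1..m}" "total a = 1"
    by (auto simp: b gens_gen_en One_nat_def)
  have fin: "finite \<rho>" using \<rho>(1) by (rule finite_subset) simp
  obtain l where l: "a = Poly_Mapping.single l 1" using a(2) by (rule total_eq_1)
  have lm: "l \<in> {1..m}" using a(1) by (simp add: l)
  have "en_boundary m b = (\<Sum>j\<in>\<rho>. \<Sum>h\<in>{1..m}. if h = l
      then smul (col_sign j \<rho> * xvar l j) (basis_elem (\<rho> - {j}, 0)) else 0 :: (en_index, 'k) elem)"
    unfolding b en_boundary_eq[OF fin]
    by (intro sum.cong refl) (auto simp: l lookup_single when_def)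
  also have "\<dots> = (\<Sum>j\<in>\<rho>. smul (col_sign j \<rho> * xvar l j) (basis_elem (\<rho> - {j}, 0)))"
    using lm by simp
  finally show ?thesis
    using max_minor_syzygy[OF \<rho> lm, where ?'k = 'k]
    by (simp add: en_augmentation_sum en_augmentation_smul en_augmentation_basis_elem)
qed

lemma lookup_linear_mult:
  fixes y g :: "'k::field poly_x"
  assumes y: "y \<in> polyring m n" "homogeneous 1 y"
  shows "Poly_Mapping.lookup (y * g) t = (\<Sum>v\<in>{1..m} \<times> {1..n}.
    Poly_Mapping.lookup y (Poly_Mapping.single v 1) *
    (if Poly_Mapping.lookup t v = 0 then 0 else Poly_Mapping.lookup g (t - Poly_Mapping.single v 1)))"
proof -
  let ?V = "{1..m} \<times> {1..n}"
  let ?y = "\<Sum>v\<in>?V. Poly_Mapping.single 0 (Poly_Mapping.lookup y (Poly_Mapping.single v 1)) * xvar (fst v) (snd v)"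
  have "y = ?y"
  proof (rule linear_form_eqI[OF y(2)])
    show "homogeneous 1 ?y"
      using homogeneous_mult[OF homogeneous_const homogeneous_xvar] by (intro homogeneous_sum) simp
    fix l j
    have "Poly_Mapping.lookup ?y (Poly_Mapping.single (l, j) 1) =
        (\<Sum>v\<in>?V. if v = (l, j) then Poly_Mapping.lookup y (Poly_Mapping.single (l, j) 1) else 0)"
      unfolding lookup_sum lookup_const_mult
      using lookup_xvar_mult_single[of _ _ "1 :: 'k poly_x" l j]
      by (intro sum.cong refl) auto
    also have "\<dots> = (if (l, j) \<in> ?V then Poly_Mapping.lookup y (Poly_Mapping.single (l, j) 1) else 0)"
      by (rule sum.delta) simp
    also have "\<dots> = Poly_Mapping.lookup y (Poly_Mapping.single (l, j) 1)"
      using polyring_linear_coeff[OF y(1)] by metis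
    finally show "Poly_Mapping.lookup y (Poly_Mapping.single (l, j) 1) =
        Poly_Mapping.lookup ?y (Poly_Mapping.single (l, j) 1)" by simp
  qed
  then have "Poly_Mapping.lookup (y * g) t = Poly_Mapping.lookup (?y * g) t" by simp
  also have "\<dots> = (\<Sum>v\<in>?V. Poly_Mapping.lookup y (Poly_Mapping.single v 1) *
      (if Poly_Mapping.lookup t v = 0 then 0 else Poly_Mapping.lookup g (t - Poly_Mapping.single v 1)))"
    unfolding sum_distrib_right lookup_sum mult.assoc lookup_const_mult lookup_xvar_mult prod.collapse ..
  finally show ?thesis .
qed

lemma max_minor_degrees:
  assumes \<sigma>: "\<sigma> \<subseteq> {1..n}" "card \<sigma> = m" and t: "Poly_Mapping.lookup (max_minor m \<sigma> :: 'k::field poly_x) t \<noteq> 0"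
  shows max_minor_row_degree: "l \<in> {1..m} \<Longrightarrow> (\<Sum>j\<in>{1..n}. Poly_Mapping.lookup t (l, j)) = 1"
    and max_minor_col_degree: "(\<Sum>l\<in>{1..m}. Poly_Mapping.lookup t (l, j)) = (if j \<in> \<sigma> then 1 else 0)"
    and max_minor_row_unique: "\<lbrakk>Poly_Mapping.lookup t (l, p) \<noteq> 0; Poly_Mapping.lookup t (l, q) \<noteq> 0\<rbrakk> \<Longrightarrow> p = q"
proof -
  obtain f where f: "bij_betw f {1..m} \<sigma>"
    "\<And>l j. Poly_Mapping.lookup t (l, j) = (if l \<in> {1..m} \<and> f l = j then 1 else 0)"
    using max_minor_support[OF \<sigma> t] by metis
  show "(\<Sum>j\<in>{1..n}. Poly_Mapping.lookup t (l, j)) = 1" if l: "l \<in> {1..m}"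
  proof -
    have "f l \<in> {1..n}" using bij_betwE[OF f(1)] l \<sigma>(1) by blast
    moreover have "(\<Sum>j\<in>{1..n}. Poly_Mapping.lookup t (l, j)) = (\<Sum>j\<in>{1..n}. if f l = j then 1 else 0)"
      using l by (simp add: f(2))
    ultimately show ?thesis by simp
  qed
  have fin: "finite \<sigma>" using \<sigma>(1) by (rule finite_subset) simp
  have "(\<Sum>l\<in>{1..m}. Poly_Mapping.lookup t (l, j)) = (\<Sum>l\<in>{1..m}. if f l = j then 1 else 0)"
    by (intro sum.cong refl) (simp add: f(2))
  also have "\<dots> = (\<Sum>i\<in>\<sigma>. if i = j then 1 else 0)"
    by (rule sum.reindex_bij_betw[OF f(1)])
  finally show "(\<Sum>l\<in>{1..m}. Poly_Mapping.lookup t (l, j)) = (if j \<in> \<sigma> then 1 else 0)"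
    using fin by simp
  show "p = q" if "Poly_Mapping.lookup t (l, p) \<noteq> 0" "Poly_Mapping.lookup t (l, q) \<noteq> 0"
    using that by (auto simp: f(2) split: if_splits)
qed

text \<open>
  A monomial \<open>x\<^bsub>lp\<^esub> t\<^sub>0\<close>, with \<open>t\<^sub>0\<close> a term of the minor on \<open>\<sigma>\<close>, has degree 2 in row \<open>l\<close> and degree 1 in
  all others.  So any other factorization into a variable and a term of a minor splits off a variable
  of row \<open>l\<close>.  The column degrees are those of \<open>\<sigma>\<close> with \<open>p\<close> added.  If \<open>p \<in> \<sigma>\<close>, then column \<open>p\<close> has
  degree 2, and the variable is \<open>x\<^bsub>lp\<^esub>\<close>; otherwise the minor lives on \<open>\<sigma> \<union> {p}\<close> without the column of
  the variable.
\<close>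

lemma max_minor_multiple_unique:
  fixes t0 :: "(nat \<times> nat) \<Rightarrow>\<^sub>0 nat"
  defines "t l p \<equiv> t0 + Poly_Mapping.single (l, p) 1"
  assumes \<sigma>: "\<sigma> \<subseteq> {1..n}" "card \<sigma> = m" and t0: "Poly_Mapping.lookup (max_minor m \<sigma> :: 'k::field poly_x) t0 \<noteq> 0"
    and \<sigma>': "\<sigma>' \<subseteq> {1..n}" "card \<sigma>' = m"
    and l: "l \<in> {1..m}" and l': "l' \<in> {1..m}" and p: "p \<in> {1..n}" and p': "p' \<in> {1..n}"
    and div: "Poly_Mapping.lookup (t l p) (l', p') \<noteq> 0"
    and t': "Poly_Mapping.lookup (max_minor m \<sigma>' :: 'k poly_x) (t l p - Poly_Mapping.single (l', p') 1) \<noteq> 0"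
  shows "l' = l" and "p \<in> \<sigma> \<Longrightarrow> p' = p" and "p \<in> \<sigma> \<Longrightarrow> \<sigma>' = \<sigma>" and "p \<notin> \<sigma> \<Longrightarrow> \<sigma>' = insert p \<sigma> - {p'}"
    and "p' = p \<or> Poly_Mapping.lookup t0 (l, p') \<noteq> 0"
proof -
  let ?t' = "t l p - Poly_Mapping.single (l', p') 1"
  have eq: "Poly_Mapping.lookup t0 (h, j) + (if h = l \<and> j = p then 1 else 0) =
      Poly_Mapping.lookup ?t' (h, j) + (if h = l' \<and> j = p' then 1 else 0)" for h j
  proof -
    have "Poly_Mapping.lookup (t l p) (h, j) = Poly_Mapping.lookup (Poly_Mapping.single (l', p') 1 + ?t') (h, j)"
      by (simp only: minus_single_add_single[OF div])
    then show ?thesis by (auto simp: t_def lookup_add lookup_single when_def)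
  qed
  have "(\<Sum>j\<in>{1..n}. Poly_Mapping.lookup t0 (l, j) + (if j = p then 1 else 0)) =
      (\<Sum>j\<in>{1..n}. Poly_Mapping.lookup ?t' (l, j) + (if l = l' \<and> j = p' then 1 else 0))"
    using eq[of l] by simp
  then have "1 + 1 = 1 + (\<Sum>j\<in>{1..n}. if l = l' \<and> j = p' then 1 else (0::nat))"
    using max_minor_row_degree[OF \<sigma> t0 l] max_minor_row_degree[OF \<sigma>' t' l] p
    by (simp add: sum.distrib)
  then show ll: "l' = l" by (cases "l = l'") simp_all
  have col: "(if j \<in> \<sigma> then 1 else 0) + (if j = p then 1 else 0) =
      (if j \<in> \<sigma>' then 1 else 0) + (if j = p' then 1 else (0::nat))" for j
  proof -
    have "(\<Sum>h\<in>{1..m}. Poly_Mapping.lookup t0 (h, j) + (if h = l then if j = p then 1 else 0 else 0)) =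
        (\<Sum>h\<in>{1..m}. Poly_Mapping.lookup ?t' (h, j) + (if h = l' then if j = p' then 1 else 0 else 0))"
    proof (intro sum.cong refl)
      fix h
      show "Poly_Mapping.lookup t0 (h, j) + (if h = l then if j = p then 1 else 0 else 0) =
        Poly_Mapping.lookup ?t' (h, j) + (if h = l' then if j = p' then 1 else 0 else 0)"
        unfolding if_if_eq_conj by (rule eq)
    qed
    then show ?thesis
      using max_minor_col_degree[OF \<sigma> t0, of j] max_minor_col_degree[OF \<sigma>' t', of j] l l'
      by (simp add: sum.distrib)
  qed
  show pp: "p' = p" if "p \<in> \<sigma>" using col[of p] that by (simp split: if_splits)
  show "\<sigma>' = \<sigma>" if "p \<in> \<sigma>"
  proof (rule Set.set_eqI)
    fix j show "j \<in> \<sigma>' \<longleftrightarrow> j \<in> \<sigma>" using col[of j] pp[OF that] by (simp split: if_splits)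
  qed
  show "\<sigma>' = insert p \<sigma> - {p'}" if "p \<notin> \<sigma>"
  proof (rule Set.set_eqI)
    fix j show "j \<in> \<sigma>' \<longleftrightarrow> j \<in> insert p \<sigma> - {p'}" using col[of j] that by (auto split: if_splits)
  qed
  show "p' = p \<or> Poly_Mapping.lookup t0 (l, p') \<noteq> 0"
    using div ll by (auto simp: t_def lookup_add lookup_single when_def split: if_splits)
qed

lemma first_syzygy_coeff:
  fixes z :: "(en_index, 'k::field) elem"
  assumes z: "z \<in> graded_piece m n (gen_en_module m n \<Delta> 0) (int (m + 1))" and cyc: "en_augmentation m z = 0"
  shows "(\<Sum>x\<in>{\<sigma>. \<sigma> \<subseteq> {1..n} \<and> card \<sigma> = m} \<times> ({1..m} \<times> {1..n}).
    Poly_Mapping.lookup (Poly_Mapping.lookup z (fst x, 0)) (Poly_Mapping.single (snd x) 1) *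
    (if Poly_Mapping.lookup t (snd x) = 0 then 0
     else Poly_Mapping.lookup (max_minor m (fst x)) (t - Poly_Mapping.single (snd x) 1))) = 0"
proof -
  let ?S = "{\<sigma>. \<sigma> \<subseteq> {1..n} \<and> card \<sigma> = m}"
  have zl: "Poly_Mapping.lookup z (\<sigma>, 0) \<in> polyring m n" "homogeneous 1 (Poly_Mapping.lookup z (\<sigma>, 0))" for \<sigma>
    using z by (auto simp: graded_piece_iff elems_iff gdeg_gen_en)
  have "0 = Poly_Mapping.lookup (en_augmentation m z) t" by (simp add: cyc)
  also have "\<dots> = (\<Sum>\<sigma>\<in>?S. Poly_Mapping.lookup (Poly_Mapping.lookup z (\<sigma>, 0) * max_minor m \<sigma>) t)"
    by (simp add: en_augmentation_expand[OF graded_piece_elems[OF z]] lookup_sum)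
  finally show ?thesis
    unfolding lookup_linear_mult[OF zl] sum.cartesian_product by (simp add: case_prod_beta)
qed

lemma first_syzygy_diag:
  fixes z :: "(en_index, 'k::field) elem"
  assumes z: "z \<in> graded_piece m n (gen_en_module m n \<Delta> 0) (int (m + 1))" and cyc: "en_augmentation m z = 0"
    and \<sigma>: "\<sigma> \<subseteq> {1..n}" "card \<sigma> = m" and l: "l \<in> {1..m}" and p: "p \<in> \<sigma>"
  shows "lin_coeff z \<sigma> 0 l p = 0"
proof -
  let ?A = "{\<sigma>. \<sigma> \<subseteq> {1..n} \<and> card \<sigma> = m} \<times> ({1..m} \<times> {1..n})"
  obtain t0 where t0: "Poly_Mapping.lookup (max_minor m \<sigma> :: 'k poly_x) t0 \<noteq> 0"
    using max_minor_monomial[OF \<sigma> l p] by blast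
  have pn: "p \<in> {1..n}" using p \<sigma>(1) by blast
  define t where "t = t0 + Poly_Mapping.single (l, p) 1"
  define g where "g x = Poly_Mapping.lookup (Poly_Mapping.lookup z (fst x, 0)) (Poly_Mapping.single (snd x) 1) *
    (if Poly_Mapping.lookup t (snd x) = 0 then 0
     else Poly_Mapping.lookup (max_minor m (fst x)) (t - Poly_Mapping.single (snd x) 1))" for x
  have "(\<Sum>x\<in>?A. g x) = (\<Sum>x\<in>{(\<sigma>, l, p)}. g x)"
  proof (rule sum.mono_neutral_right)
    show "finite ?A" by (simp add: finite_subset[of _ "Pow {1..n}"] Collect_mono_iff)
    show "{(\<sigma>, l, p)} \<subseteq> ?A" using \<sigma> l pn by simp
    show "\<forall>x\<in>?A - {(\<sigma>, l, p)}. g x = 0"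
    proof
      fix x assume x: "x \<in> ?A - {(\<sigma>, l, p)}"
      obtain \<sigma>' l' p' where x_eq: "x = (\<sigma>', l', p')" by (metis surj_pair)
      show "g x = 0"
      proof (rule ccontr)
        assume "g x \<noteq> 0"
        then have nz: "Poly_Mapping.lookup t (l', p') \<noteq> 0"
          "Poly_Mapping.lookup (max_minor m \<sigma>' :: 'k poly_x) (t - Poly_Mapping.single (l', p') 1) \<noteq> 0"
          by (auto simp: g_def x_eq split: if_splits)
        have \<sigma>': "\<sigma>' \<subseteq> {1..n}" "card \<sigma>' = m" and l': "l' \<in> {1..m}" and p': "p' \<in> {1..n}"
          using x by (auto simp: x_eq)
        note u = max_minor_multiple_unique[OF \<sigma> t0 \<sigma>' l l' pn p' nz[unfolded t_def]]
        show False using u(1) u(2)[OF p] u(3)[OF p] x by (simp add: x_eq)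
      qed
    qed
  qed
  moreover have "(\<Sum>x\<in>?A. g x) = 0" unfolding g_def by (rule first_syzygy_coeff[OF z cyc])
  ultimately have "lin_coeff z \<sigma> 0 l p * Poly_Mapping.lookup (max_minor m \<sigma>) t0 = 0"
    by (simp add: g_def t_def lookup_add)
  then show ?thesis using t0 by simp
qed

text \<open>
  The coefficient of \<open>x\<^bsub>lp\<^esub> t\<^sub>0\<close> in a vanishing linear combination of minors, where \<open>t\<^sub>0\<close> contains \<open>x\<^bsub>lq\<^esub>\<close>:
  as row \<open>l\<close> of this monomial consists of \<open>x\<^bsub>lp\<^esub>\<close> and \<open>x\<^bsub>lq\<^esub>\<close>, there are just two contributions.
\<close>

lemma first_syzygy_two_terms:
  fixes z :: "(en_index, 'k::field) elem"
  assumes z: "z \<in> graded_piece m n (gen_en_module m n \<Delta> 0) (int (m + 1))" and cyc: "en_augmentation m z = 0"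
    and \<sigma>: "\<sigma> \<subseteq> {1..n}" "card \<sigma> = m" and l: "l \<in> {1..m}" and p: "p \<in> {1..n}" "p \<notin> \<sigma>" and q: "q \<in> \<sigma>"
    and t0: "Poly_Mapping.lookup (max_minor m \<sigma> :: 'k poly_x) t0 \<noteq> 0" "Poly_Mapping.lookup t0 (l, q) \<noteq> 0"
  shows "lin_coeff z \<sigma> 0 l p * Poly_Mapping.lookup (max_minor m \<sigma>) t0 +
    lin_coeff z (insert p \<sigma> - {q}) 0 l q * Poly_Mapping.lookup (max_minor m (insert p \<sigma> - {q}))
      (t0 + Poly_Mapping.single (l, p) 1 - Poly_Mapping.single (l, q) 1) = 0"
proof -
  let ?A = "{\<sigma>. \<sigma> \<subseteq> {1..n} \<and> card \<sigma> = m} \<times> ({1..m} \<times> {1..n})"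
  let ?\<sigma>q = "insert p \<sigma> - {q}"
  have qn: "q \<in> {1..n}" using q \<sigma>(1) by blast
  have pq: "p \<noteq> q" using p q by blast
  have fin: "finite \<sigma>" using \<sigma>(1) by (rule finite_subset) simp
  then have \<sigma>q: "?\<sigma>q \<subseteq> {1..n}" "card ?\<sigma>q = m" using \<sigma> p q by auto
  define t where "t = t0 + Poly_Mapping.single (l, p) 1"
  define g where "g x = Poly_Mapping.lookup (Poly_Mapping.lookup z (fst x, 0)) (Poly_Mapping.single (snd x) 1) *
    (if Poly_Mapping.lookup t (snd x) = 0 then 0
     else Poly_Mapping.lookup (max_minor m (fst x)) (t - Poly_Mapping.single (snd x) 1))" for x
  have "(\<Sum>x\<in>?A. g x) = (\<Sum>x\<in>{(\<sigma>, l, p), (?\<sigma>q, l, q)}. g x)"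
  proof (rule sum.mono_neutral_right)
    show "finite ?A" by (simp add: finite_subset[of _ "Pow {1..n}"] Collect_mono_iff)
    show "{(\<sigma>, l, p), (?\<sigma>q, l, q)} \<subseteq> ?A" using \<sigma> \<sigma>q l p qn by simp
    show "\<forall>x\<in>?A - {(\<sigma>, l, p), (?\<sigma>q, l, q)}. g x = 0"
    proof
      fix x assume x: "x \<in> ?A - {(\<sigma>, l, p), (?\<sigma>q, l, q)}"
      obtain \<sigma>' l' p' where x_eq: "x = (\<sigma>', l', p')" by (metis surj_pair)
      show "g x = 0"
      proof (rule ccontr)
        assume "g x \<noteq> 0"
        then have nz: "Poly_Mapping.lookup t (l', p') \<noteq> 0"
          "Poly_Mapping.lookup (max_minor m \<sigma>' :: 'k poly_x) (t - Poly_Mapping.single (l', p') 1) \<noteq> 0"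
          by (auto simp: g_def x_eq split: if_splits)
        have \<sigma>': "\<sigma>' \<subseteq> {1..n}" "card \<sigma>' = m" and l': "l' \<in> {1..m}" and p': "p' \<in> {1..n}"
          using x by (auto simp: x_eq)
        note u = max_minor_multiple_unique[OF \<sigma> t0(1) \<sigma>' l l' p(1) p' nz[unfolded t_def]]
        have "p' = p \<or> p' = q" using u(5) max_minor_row_unique[OF \<sigma> t0(1) _ t0(2)] by blast
        moreover have "insert p \<sigma> - {p} = \<sigma>" using p(2) by auto
        ultimately show False using u(1) u(4)[OF p(2)] x by (auto simp: x_eq)
      qed
    qed
  qed
  moreover have "(\<Sum>x\<in>?A. g x) = 0" unfolding g_def by (rule first_syzygy_coeff[OF z cyc])
  ultimately have "g (\<sigma>, l, p) + g (?\<sigma>q, l, q) = 0" using pq by simp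
  then show ?thesis using t0(2) by (simp add: g_def t_def lookup_add)
qed

text \<open>
  The two-term relation compares the coefficients of \<open>z\<close>, up to coefficients of minors.  These are
  eliminated with the same relation for a syzygy whose coefficients are known signs, the boundary
  of \<open>b(\<rho>; e\<^sub>l)\<close>.
\<close>

lemma first_syzygy_const:
  fixes z :: "(en_index, 'k::field) elem"
  assumes z: "z \<in> graded_piece m n (gen_en_module m n \<Delta> 0) (int (m + 1))" and cyc: "en_augmentation m z = 0"
    and \<rho>: "\<rho> \<subseteq> {1..n}" "card \<rho> = Suc m" and l: "l \<in> {1..m}" and p: "p \<in> \<rho>" and q: "q \<in> \<rho>"
  shows "col_sign p \<rho> * lin_coeff z (\<rho> - {p}) 0 l p = col_sign q \<rho> * lin_coeff z (\<rho> - {q}) 0 l q"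
proof (cases "p = q")
  case False
  have fin: "finite \<rho>" using \<rho>(1) by (rule finite_subset) simp
  let ?\<sigma> = "\<rho> - {p}"
  have \<sigma>: "?\<sigma> \<subseteq> {1..n}" "card ?\<sigma> = m" "p \<in> {1..n}" "p \<notin> ?\<sigma>" "q \<in> ?\<sigma>" "insert p ?\<sigma> - {q} = \<rho> - {q}"
    using \<rho> p q fin False by auto
  obtain t0 where t0: "Poly_Mapping.lookup (max_minor m ?\<sigma> :: 'k poly_x) t0 \<noteq> 0" "Poly_Mapping.lookup t0 (l, q) \<noteq> 0"
    using max_minor_monomial[OF \<sigma>(1,2) l \<sigma>(5)] by blast
  define b where "b = (\<rho>, Poly_Mapping.single l (1::nat))"
  have b: "b \<in> gens (gen_en_module m n UNIV 1)"
    using \<rho> l by (simp add: b_def gens_gen_en)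
  let ?z = "en_boundary m b :: (en_index, 'k) elem"
  have z': "?z \<in> graded_piece m n (gen_en_module m n UNIV 0) (int (m + 1))"
    using en_boundary_graded_piece[of UNIV b m n 0] b by (simp add: One_nat_def)
  have sgn: "lin_coeff ?z (\<rho> - {j}) 0 l j = col_sign j \<rho>" if j: "j \<in> \<rho>" for j
  proof -
    have "j \<in> {1..n} - (\<rho> - {j})" "insert j (\<rho> - {j}) = \<rho>" using j \<rho>(1) by auto
    moreover have "\<forall>c\<in>Poly_Mapping.keys (basis_elem b :: (en_index, 'k) elem). fst c \<subseteq> {1..n}"
      using \<rho>(1) by (simp add: b_def)
    ultimately show ?thesis
      using en_diff_linear_coeff[of "basis_elem b :: (en_index, 'k) elem" n m "\<rho> - {j}" 0 l j] l
      by (simp add: linear_extension_basis_elem b_def)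
  qed
  let ?cp = "Poly_Mapping.lookup (max_minor m ?\<sigma> :: 'k poly_x) t0"
  let ?cq = "Poly_Mapping.lookup (max_minor m (\<rho> - {q}) :: 'k poly_x)
      (t0 + Poly_Mapping.single (l, p) 1 - Poly_Mapping.single (l, q) 1)"
  have 1: "lin_coeff z ?\<sigma> 0 l p * ?cp + lin_coeff z (\<rho> - {q}) 0 l q * ?cq = 0"
    using first_syzygy_two_terms[OF z cyc \<sigma>(1,2) l \<sigma>(3,4,5) t0] unfolding \<sigma>(6) .
  \<comment> \<open>The known syzygy determines the ratio of the two minor coefficients.\<close>
  have 2: "col_sign p \<rho> * ?cp + col_sign q \<rho> * ?cq = 0"
    using first_syzygy_two_terms[OF z' en_augmentation_en_boundary[OF b] \<sigma>(1,2) l \<sigma>(3,4,5) t0]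
    unfolding \<sigma>(6) sgn[OF p] sgn[OF q] .
  define P Q Zp Zq :: 'k where "P = col_sign p \<rho>" and "Q = col_sign q \<rho>"
    and "Zp = lin_coeff z ?\<sigma> 0 l p" and "Zq = lin_coeff z (\<rho> - {q}) 0 l q"
  have PP: "P * P = 1" "Q * Q = 1" by (simp_all add: P_def Q_def)
  have "?cq = Q * (Q * ?cq)" by (simp add: Q_def)
  also have "Q * ?cq = - (P * ?cp)" using 2 by (simp add: P_def Q_def eq_neg_iff_add_eq_0 add.commute)
  finally have cq: "?cq = - (Q * P) * ?cp" by simp
  have "(Zp - Zq * (Q * P)) * ?cp = 0"
    using 1 unfolding Zp_def[symmetric] Zq_def[symmetric] cq by (simp add: algebra_simps)
  then have "Zp = Zq * (Q * P)" using t0(1) by simp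
  then have "P * Zp = Q * Zq * (P * P)" by (simp add: ac_simps)
  then show ?thesis using PP by (simp add: P_def Q_def Zp_def Zq_def)
qed simp

lemma uniform_clutterD:
  assumes "uniform_clutter m n C" "\<sigma> \<in> C"
  shows "\<sigma> \<subseteq> {1..n}" "card \<sigma> = m" "finite \<sigma>"
proof -
  show "\<sigma> \<subseteq> {1..n}" "card \<sigma> = m"
    using assms by (auto simp: uniform_clutter_def clutter_def)
  then show "finite \<sigma>" by (simp add: finite_subset)
qed

lemma clique_facets:
  assumes "uniform_clutter m n C"
  shows "gens (gen_en_module m n (clique_complex m n C) 0) = (\<lambda>\<sigma>. (\<sigma>, 0)) ` C"
proof -
  note C = uniform_clutterD[OF assms]
  have circuit: "\<sigma> \<in> clique_complex m n C" if "\<sigma> \<in> C" for \<sigma>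
  proof -
    have "\<tau> \<in> C" if "\<tau> \<subseteq> \<sigma>" "card \<tau> = m" for \<tau>
      using card_subset_eq[OF C(3)[OF \<open>\<sigma> \<in> C\<close>] that(1)] C(2)[OF \<open>\<sigma> \<in> C\<close>] that(2) \<open>\<sigma> \<in> C\<close> by simp
    then show ?thesis using C(1)[OF that] by (simp add: clique_complex_def)
  qed
  show ?thesis
  proof (intro equalityI subsetI)
    fix b assume "b \<in> gens (gen_en_module m n (clique_complex m n C) 0)"
    then obtain \<sigma> where "b = (\<sigma>, 0)" "\<sigma> \<in> clique_complex m n C" "card \<sigma> = m"
      by (auto simp: gens_gen_en total_eq_0_iff)
    then show "b \<in> (\<lambda>\<sigma>. (\<sigma>, 0)) ` C" by (simp add: clique_complex_def)
  next
    fix b :: en_index assume "b \<in> (\<lambda>\<sigma>. (\<sigma>, 0)) ` C"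
    then obtain \<sigma> where "b = (\<sigma>, 0)" "\<sigma> \<in> C" by blast
    then show "b \<in> gens (gen_en_module m n (clique_complex m n C) 0)"
      using C(1,2)[OF \<open>\<sigma> \<in> C\<close>] circuit by (simp add: gens_gen_en)
  qed
qed

text \<open>
  The column degrees of a term of a minor determine the minor.
\<close>

lemma max_minor_independent:
  fixes c :: "nat set \<Rightarrow> 'k::field"
  assumes m: "m \<ge> 1"
    and 0: "(\<Sum>\<sigma>\<in>{\<sigma>. \<sigma> \<subseteq> {1..n} \<and> card \<sigma> = m}. Poly_Mapping.single 0 (c \<sigma>) * max_minor m \<sigma>) = 0"
    and \<sigma>: "\<sigma> \<subseteq> {1..n}" "card \<sigma> = m"
  shows "c \<sigma> = 0"
proof -
  let ?S = "{\<sigma>. \<sigma> \<subseteq> {1..n} \<and> card \<sigma> = m}"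
  have fin: "finite ?S" by (rule finite_subset[of _ "Pow {1..n}"]) auto
  have "\<sigma> \<noteq> {}" using \<sigma> m by auto
  then obtain q where "q \<in> \<sigma>" by blast
  then obtain t where t: "Poly_Mapping.lookup (max_minor m \<sigma> :: 'k poly_x) t \<noteq> 0"
    using max_minor_monomial[OF \<sigma>, of 1 q] m by auto
  have other: "Poly_Mapping.lookup (max_minor m \<sigma>' :: 'k poly_x) t = 0" if "\<sigma>' \<in> ?S" "\<sigma>' \<noteq> \<sigma>" for \<sigma>'
  proof (rule ccontr)
    assume "Poly_Mapping.lookup (max_minor m \<sigma>' :: 'k poly_x) t \<noteq> 0"
    then have "(if j \<in> \<sigma>' then 1 else 0) = (if j \<in> \<sigma> then 1 else (0::nat))" for j
      using max_minor_col_degree[OF \<sigma> t, of j] max_minor_col_degree[of \<sigma>' n m t j, where ?'k = 'k] that(1)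
      by simp
    then have "j \<in> \<sigma>' \<longleftrightarrow> j \<in> \<sigma>" for j by (metis zero_neq_one)
    then show False using that(2) by blast
  qed
  have "0 = (\<Sum>\<sigma>'\<in>?S. c \<sigma>' * Poly_Mapping.lookup (max_minor m \<sigma>') t)"
    using arg_cong[OF 0, of "\<lambda>p. Poly_Mapping.lookup p t"] by (simp add: lookup_sum lookup_const_mult)
  also have "\<dots> = (\<Sum>\<sigma>'\<in>?S. if \<sigma>' = \<sigma> then c \<sigma> * Poly_Mapping.lookup (max_minor m \<sigma>) t else 0)"
    by (intro sum.cong refl) (auto simp: other)
  also have "\<dots> = c \<sigma> * Poly_Mapping.lookup (max_minor m \<sigma>) t"
    using fin \<sigma> by simp
  finally show ?thesis using t by simp
qed

lemma en_augmentation_injective: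
  fixes x :: "(en_index, 'k::field) elem"
  assumes m: "m \<ge> 1" and x: "x \<in> graded_piece m n (gen_en_module m n \<Delta> 0) (int m)"
    and 0: "en_augmentation m x = 0"
  shows "x = 0"
proof (rule poly_mapping_eqI)
  let ?S = "{\<sigma>. \<sigma> \<subseteq> {1..n} \<and> card \<sigma> = m}"
  define c where "c \<sigma> = Poly_Mapping.lookup (Poly_Mapping.lookup x (\<sigma>, 0)) 0" for \<sigma>
  have const: "Poly_Mapping.lookup x (\<sigma>, 0) = Poly_Mapping.single 0 (c \<sigma>)" for \<sigma>
    unfolding c_def using x by (intro homogeneous_0_const) (simp add: graded_piece_iff gdeg_gen_en)
  have sum0: "(\<Sum>\<sigma>\<in>?S. Poly_Mapping.single 0 (c \<sigma>) * max_minor m \<sigma>) = 0"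
    using 0 by (simp add: en_augmentation_expand[OF graded_piece_elems[OF x]] const)
  fix b :: en_index
  show "Poly_Mapping.lookup x b = Poly_Mapping.lookup 0 b"
  proof (cases "b \<in> gens (gen_en_module m n \<Delta> 0)")
    case True
    then obtain \<sigma> where "b = (\<sigma>, 0)" "\<sigma> \<subseteq> {1..n}" "card \<sigma> = m"
      by (auto simp: gens_gen_en total_eq_0_iff)
    then show ?thesis using const[of \<sigma>] max_minor_independent[OF m sum0] by simp
  next
    case False
    then show ?thesis using x by (cases b) (simp add: graded_piece_iff elems_iff)
  qed
qed

section \<open>Determinantal facet ideals\<close>

lemma det_facet_ideal_eq_image:
  assumes C: "uniform_clutter m n C"
  shows "(det_facet_ideal m n C :: 'k::field poly_x set) =
    en_augmentation m ` elems m n (gen_en_module m n (clique_complex m n C) 0)"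
proof -
  let ?G = "gen_en_module m n (clique_complex m n C) 0"
  let ?mm = "max_minor m :: nat set \<Rightarrow> 'k poly_x"
  note gens = clique_facets[OF C]
  show ?thesis
  proof (intro equalityI subsetI)
    fix p :: "'k poly_x" assume "p \<in> det_facet_ideal m n C"
    then obtain B c where B: "finite B" "B \<subseteq> ?mm ` C" "c ` B \<subseteq> polyring m n" and p: "p = (\<Sum>g\<in>B. c g * g)"
      unfolding det_facet_ideal_def ideal_generated_def by auto
    define s where "s = inv_into C ?mm"
    have s: "s g \<in> C" "?mm (s g) = g" if "g \<in> B" for g
      using B(2) that by (auto simp: s_def intro: inv_into_into f_inv_into_f)
    have "(\<Sum>g\<in>B. smul (c g) (basis_elem (s g, 0))) \<in> elems m n ?G"
      using s B(3) by (intro elems_sum elems_smul basis_elem_elems) (auto simp: gens)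
    moreover have "en_augmentation m (\<Sum>g\<in>B. smul (c g) (basis_elem (s g, 0))) = p"
      unfolding p en_augmentation_sum en_augmentation_smul en_augmentation_basis_elem
      by (intro sum.cong refl) (simp add: s)
    ultimately show "p \<in> en_augmentation m ` elems m n ?G" by blast
  next
    fix p :: "'k poly_x" assume "p \<in> en_augmentation m ` elems m n ?G"
    then obtain x :: "(en_index, 'k) elem" where x: "x \<in> elems m n ?G" and p: "p = en_augmentation m x" by blast
    have finC: "finite C"
      by (rule finite_subset[of _ "Pow {1..n}"]) (use uniform_clutterD[OF C] in auto)
    \<comment> \<open>Sort the coefficients by the minor they multiply.\<close>
    define c where "c g = (\<Sum>\<sigma>\<in>{\<sigma> \<in> C. ?mm \<sigma> = g}. Poly_Mapping.lookup x (\<sigma>, 0))" for g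
    have inj: "inj_on (\<lambda>\<sigma>. (\<sigma>, 0 :: nat \<Rightarrow>\<^sub>0 nat)) C" by (simp add: inj_on_def)
    have "Poly_Mapping.keys x \<subseteq> (\<lambda>\<sigma>. (\<sigma>, 0)) ` C"
      using x unfolding elems_def gens by blast
    then have "p = (\<Sum>b\<in>(\<lambda>\<sigma>. (\<sigma>, 0)) ` C. Poly_Mapping.lookup x b * max_minor m (fst b))"
      unfolding p en_augmentation_def using finC by (intro sum.mono_neutral_left) (auto simp: in_keys_iff)
    also have "\<dots> = (\<Sum>\<sigma>\<in>C. Poly_Mapping.lookup x (\<sigma>, 0) * ?mm \<sigma>)"
      by (simp add: sum.reindex[OF inj])
    also have "\<dots> = (\<Sum>g\<in>?mm ` C. \<Sum>\<sigma>\<in>{\<sigma> \<in> C. ?mm \<sigma> = g}. Poly_Mapping.lookup x (\<sigma>, 0) * ?mm \<sigma>)"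
      by (rule sum.image_gen[OF finC])
    also have "\<dots> = (\<Sum>g\<in>?mm ` C. c g * g)"
      unfolding c_def sum_distrib_right by (intro sum.cong refl) simp
    finally have "p = (\<Sum>g\<in>?mm ` C. c g * g)" .
    moreover have "c ` ?mm ` C \<subseteq> polyring m n"
      using x by (auto simp: c_def elems_iff intro!: polyring_sum)
    ultimately show "p \<in> det_facet_ideal m n C"
      unfolding det_facet_ideal_def ideal_generated_def using finC by blast
  qed
qed

lemma det_facet_ideal_polyring:
  assumes C: "uniform_clutter m n C"
  shows "det_facet_ideal m n C \<subseteq> polyring m n"
proof -
  have "en_augmentation m x \<in> polyring m n"
    if "x \<in> elems m n (gen_en_module m n (clique_complex m n C) 0)" for x :: "(en_index, 'a) elem"
    using graded_homD(1)[OF en_augmentation_hom that] by simp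
  then show ?thesis unfolding det_facet_ideal_eq_image[OF C] by blast
qed

lemma det_facet_ideal_lift:
  fixes p :: "'k::field poly_x"
  assumes C: "uniform_clutter m n C" and p: "p \<in> det_facet_ideal m n C" "homogeneous e p"
  obtains x where "x \<in> graded_piece m n (gen_en_module m n (clique_complex m n C) 0) e"
    "en_augmentation m x = p"
proof -
  obtain x where x: "x \<in> elems m n (gen_en_module m n (clique_complex m n C) 0)" "en_augmentation m x = p"
    using p(1) unfolding det_facet_ideal_eq_image[OF C] by blast
  have "to_ring_module (en_augmentation m x) \<in> graded_piece m n ring_module e"
    using x p det_facet_ideal_polyring[OF C] by auto
  from graded_lift[OF en_augmentation_hom x(1) this]
  show thesis using x(2) that by auto
qed

lemma det_facet_ideal_low_degree:
  fixes p :: "'k::field poly_x"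
  assumes C: "uniform_clutter m n C" and p: "p \<in> det_facet_ideal m n C" "homogeneous e p" "e < int m"
  shows "p = 0"
proof -
  obtain x where x: "x \<in> graded_piece m n (gen_en_module m n (clique_complex m n C) 0) e"
    "en_augmentation m x = p" by (rule det_facet_ideal_lift[OF C p(1,2)])
  have "homogeneous (e - int m) (Poly_Mapping.lookup x b)" for b
    using x(1) by (cases b) (simp add: graded_piece_iff gdeg_gen_en)
  then have "Poly_Mapping.lookup x b = 0" for b
    using p(3) by (intro homogeneous_neg[of "e - int m"]) auto
  then have "x = 0" by (intro poly_mapping_eqI) simp
  then show ?thesis using x(2) by simp
qed

lemma initial_degree_det_facet_ideal:
  assumes m: "m \<ge> 1" and n: "n \<ge> 1" and C: "uniform_clutter m n C"
  shows "initial_degree (det_facet_ideal m n C :: 'k::field poly_x set) = m"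
  unfolding initial_degree_def
proof (rule Least_equality)
  have "\<Union>C \<noteq> {}" using n C unfolding uniform_clutter_def clutter_def by simp
  then obtain \<sigma> where \<sigma>C: "\<sigma> \<in> C" by blast
  note \<sigma> = uniform_clutterD(1,2)[OF C \<sigma>C]
  have "(basis_elem (\<sigma>, 0) :: (en_index, 'k) elem) \<in> elems m n (gen_en_module m n (clique_complex m n C) 0)"
    using \<sigma>C by (intro basis_elem_elems) (simp add: clique_facets[OF C])
  then have "(max_minor m \<sigma> :: 'k poly_x) \<in> det_facet_ideal m n C"
    unfolding det_facet_ideal_eq_image[OF C] by (force simp: en_augmentation_basis_elem)
  moreover have "(max_minor m \<sigma> :: 'k poly_x) \<noteq> 0"
  proof -
    have "\<sigma> \<noteq> {}" using \<sigma> m by auto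
    then obtain q where "q \<in> \<sigma>" by blast
    then obtain t where "Poly_Mapping.lookup (max_minor m \<sigma> :: 'k poly_x) t \<noteq> 0"
      using max_minor_monomial[OF \<sigma>, of 1 q] m by auto
    then show ?thesis by auto
  qed
  ultimately show "\<exists>p\<in>det_facet_ideal m n C :: 'k poly_x set. p \<noteq> 0 \<and> homogeneous (int m) p"
    using homogeneous_max_minor by blast
next
  fix d assume "\<exists>p\<in>det_facet_ideal m n C :: 'k poly_x set. p \<noteq> 0 \<and> homogeneous (int d) p"
  then show "m \<le> d" using det_facet_ideal_low_degree[OF C] by (metis linorder_not_le of_nat_less_iff)
qed

section \<open>The linear strand of a determinantal facet ideal\<close>

text \<open>
  The cycles to be bounded are linear syzygies of the minors for \<open>i = 0\<close>, and cycles of the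
  Eagon-Northcott complex with linear coefficients for \<open>i > 0\<close>; both satisfy the conditions of
  \<open>linear_boundary_criterion\<close>.
\<close>

theorem generalized_eagon_northcott_linearly_exact:
  assumes m: "m \<ge> 1" and C: "uniform_clutter m n C"
  shows "linearly_exact m n m (det_facet_ideal m n C :: 'k::field poly_x set)
    (generalized_eagon_northcott m n (clique_complex m n C)) (en_augmentation m)"
proof -
  let ?J = "det_facet_ideal m n C :: 'k poly_x set"
  let ?C = "generalized_eagon_northcott m n (clique_complex m n C) :: (en_index, 'k) fcomplex"
  let ?G = "gen_en_module m n (clique_complex m n C)"
  have cC: "graded_free_complex m n ?C"
    by (rule gen_en_complex) (auto simp: clique_complex_def)
  have d: "graded_hom m n (?G (Suc i)) (?G i) (en_diff m :: (en_index, 'k) elem \<Rightarrow> _)"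
    and dd: "\<And>x :: (en_index, 'k) elem. x \<in> elems m n (?G (Suc (Suc i))) \<Longrightarrow> en_diff m (en_diff m x) = 0" for i
    using cC by (simp_all add: graded_free_complex_def modl_gen_en diff_gen_en)
  have aug: "graded_hom m n (?G 0) ring_module (\<lambda>x :: (en_index, 'k) elem. to_ring_module (en_augmentation m x))"
    by (rule en_augmentation_hom)
  have aug_d: "en_augmentation m (en_diff m x) = 0" if x: "x \<in> elems m n (?G (Suc 0))" for x :: "(en_index, 'k) elem"
  proof -
    have zero: "graded_hom m n (?G (Suc 0)) ring_module (\<lambda>_ :: (en_index, 'k) elem. 0 :: (unit, 'k) elem)"
      by (auto simp: graded_hom_def)
    have "to_ring_module (en_augmentation m (en_diff m x)) = 0"
      by (rule graded_hom_eqI[OF graded_hom_comp[OF d aug] zero _ x])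
         (simp add: linear_extension_basis_elem en_augmentation_en_boundary[unfolded One_nat_def])
    then show ?thesis by simp
  qed
  have bij0: "bij_betw (en_augmentation m) (graded_piece m n (?G 0) (int m)) {p \<in> ?J. homogeneous (int m) p}"
    unfolding bij_betw_def
  proof
    have "inj_on (\<lambda>x :: (en_index, 'k) elem. to_ring_module (en_augmentation m x)) (graded_piece m n (?G 0) (int m))"
      using en_augmentation_injective[OF m] by (intro inj_on_graded_piece[OF aug]) simp
    then show "inj_on (en_augmentation m :: (en_index, 'k) elem \<Rightarrow> _) (graded_piece m n (?G 0) (int m))"
      by (simp add: inj_on_def)
    show "en_augmentation m ` graded_piece m n (?G 0) (int m) = {p \<in> ?J. homogeneous (int m) p}"
    proof (intro equalityI subsetI)
      fix p :: "'k poly_x" assume "p \<in> en_augmentation m ` graded_piece m n (?G 0) (int m)"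
      then obtain x :: "(en_index, 'k) elem" where x: "x \<in> graded_piece m n (?G 0) (int m)" "p = en_augmentation m x"
        by blast
      then show "p \<in> {p \<in> ?J. homogeneous (int m) p}"
        using graded_homD(4)[OF aug x(1)] graded_piece_elems[OF x(1)] det_facet_ideal_eq_image[OF C] by auto
    next
      fix p :: "'k poly_x" assume "p \<in> {p \<in> ?J. homogeneous (int m) p}"
      then show "p \<in> en_augmentation m ` graded_piece m n (?G 0) (int m)"
        using det_facet_ideal_lift[OF C, of p "int m"] by blast
    qed
  qed
  have bij: "bij_betw (en_diff m) (graded_piece m n (?G (Suc i)) (int (m + Suc i)))
      {x \<in> graded_piece m n (?G i) (int (m + Suc i)). cycle ?C (en_augmentation m) i x}" for i
    unfolding bij_betw_def
  proof
    show "inj_on (en_diff m :: (en_index, 'k) elem \<Rightarrow> _) (graded_piece m n (?G (Suc i)) (int (m + Suc i)))"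
      using en_diff_injective by (intro inj_on_graded_piece[OF d]) blast
    show "en_diff m ` graded_piece m n (?G (Suc i)) (int (m + Suc i)) =
        {x \<in> graded_piece m n (?G i) (int (m + Suc i)). cycle ?C (en_augmentation m) i x}" (is "?l = ?r")
    proof (intro equalityI subsetI)
      fix y :: "(en_index, 'k) elem" assume "y \<in> ?l"
      then obtain x :: "(en_index, 'k) elem" where x: "x \<in> graded_piece m n (?G (Suc i)) (int (m + Suc i))" "y = en_diff m x"
        by blast
      have "cycle ?C (en_augmentation m) i y"
        using graded_piece_elems[OF x(1)] aug_d dd x(2) by (cases i) (simp_all add: diff_gen_en)
      then show "y \<in> ?r" using graded_homD(4)[OF d x(1)] x(2) by simp
    next
      fix z :: "(en_index, 'k) elem" assume z: "z \<in> ?r"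
      then have zG: "z \<in> graded_piece m n (?G i) (int (m + Suc i))" and cyc: "cycle ?C (en_augmentation m) i z"
        by auto
      have "\<exists>w\<in>graded_piece m n (?G (Suc i)) (int (m + Suc i)). en_diff m w = z"
      proof (cases i)
        case 0
        have z0: "z \<in> graded_piece m n (?G 0) (int (m + 1))" "en_augmentation m z = 0"
          using zG cyc by (simp_all add: 0 One_nat_def)
        show ?thesis
        proof (rule linear_boundary_criterion[OF zG])
          fix \<sigma> a l p assume "(\<sigma>, a) \<in> gens (?G i)" "l \<in> {1..m}" "p \<in> \<sigma>"
          then show "lin_coeff z \<sigma> a l p = 0"
            using first_syzygy_diag[OF z0, of \<sigma> l p] by (auto simp: 0 gens_gen_en total_eq_0_iff)
        next
          fix \<rho> b l l' p q
          assume \<rho>: "\<rho> \<subseteq> {1..n}" "card \<rho> = m + Suc i" and b: "Poly_Mapping.keys b \<subseteq> {1..m}" "total b = Suc i"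
            and pq: "p \<in> \<rho>" "q \<in> \<rho>" and l: "Poly_Mapping.lookup b l \<noteq> 0" "Poly_Mapping.lookup b l' \<noteq> 0"
          have "total b = 1" using b(2) by (simp add: 0 One_nat_def)
          then obtain h where "b = Poly_Mapping.single h 1" by (rule total_eq_1)
          then have h: "b = Poly_Mapping.single l 1" "l' = l"
            using l by (auto simp: lookup_single when_def split: if_splits)
          have "l \<in> {1..m}" using b(1) by (simp add: h)
          then show "col_sign p \<rho> * lin_coeff z (\<rho> - {p}) (b - Poly_Mapping.single l 1) l p =
              col_sign q \<rho> * lin_coeff z (\<rho> - {q}) (b - Poly_Mapping.single l' 1) l' q"
            using first_syzygy_const[OF z0 \<rho>(1) _ _ pq, of l] \<rho>(2) by (simp add: h 0)
        qed
      next
        case (Suc i')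
        have z0: "z \<in> elems m n (?G (Suc i'))" "en_diff m z = 0"
          using graded_piece_elems[OF zG] cyc by (simp_all add: Suc diff_gen_en)
        show ?thesis
        proof (rule linear_boundary_criterion[OF zG])
          fix \<sigma> a l p assume "(\<sigma>, a) \<in> gens (?G i)" "l \<in> {1..m}" "p \<in> \<sigma>"
          then show "lin_coeff z \<sigma> a l p = 0"
            unfolding Suc by (rule higher_linear_cycle_diag[OF m z0])
        next
          fix \<rho> b l l' p q
          assume "\<rho> \<subseteq> {1..n}" "card \<rho> = m + Suc i" "Poly_Mapping.keys b \<subseteq> {1..m}" "total b = Suc i"
            "p \<in> \<rho>" "q \<in> \<rho>" "Poly_Mapping.lookup b l \<noteq> 0" "Poly_Mapping.lookup b l' \<noteq> 0"
          then show "col_sign p \<rho> * lin_coeff z (\<rho> - {p}) (b - Poly_Mapping.single l 1) l p =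
              col_sign q \<rho> * lin_coeff z (\<rho> - {q}) (b - Poly_Mapping.single l' 1) l' q"
            unfolding Suc by (rule higher_linear_cycle_const[OF m z0])
        qed
      qed
      then show "z \<in> ?l" by blast
    qed
  qed
  show ?thesis
    unfolding linearly_exact_def augmentation_def modl_gen_en diff_gen_en
    using cC aug bij0 bij by (simp add: gdeg_gen_en)
qed

theorem theorem4p1:
  fixes m n :: nat
    and C :: "nat set set"
    and F :: "('b, 'k::field) fcomplex"
    and \<epsilon> :: "('b, 'k) elem \<Rightarrow> 'k poly_x"
  assumes "m \<ge> 1" and "n \<ge> 1"
    and "uniform_clutter m n C"
    and "minimal_graded_free_resolution m n (det_facet_ideal m n C :: 'k poly_x set) F \<epsilon>"
  shows "complex_isomorphic m n
           (linear_strand (initial_degree (det_facet_ideal m n C :: 'k poly_x set)) F)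
           (generalized_eagon_northcott m n (clique_complex m n C) :: (en_index, 'k) fcomplex)"
proof -
  let ?J = "det_facet_ideal m n C :: 'k poly_x set"
  have "linearly_exact m n m ?J (linear_strand m F) \<epsilon>"
    by (rule linear_strand_linearly_exact[OF assms(4) det_facet_ideal_polyring[OF assms(3)]
          det_facet_ideal_low_degree[OF assms(3)]])
  from linearly_exact_unique[OF this generalized_eagon_northcott_linearly_exact[OF assms(1,3)]]
  show ?thesis by (simp only: initial_degree_det_facet_ideal[OF assms(1-3)])
qed

end
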